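(* Let $N\ge1$ and $0\le r\le N$. There exist constants $C_1,C_2>0$ such that for all $u\in L^1(T_N,\Lambda^r)$ with $du=0$ and all $L>0$ there exists $v\in L^\infty(T_N,\Lambda^r)$ with $dv=0$ and (i) $\|v\|_{L^\infty(T_N,\Lambda^r)}\le C_1L$; (ii) $|\{y\in T_N: v(y)\neq u(y)\}|\le \frac{C_2}{L}\int_{\{y\in T_N:|u(y)|>L\}}|u(y)|\,dy$; (iii) $\|v-u\|_{L^1(T_N,\Lambda^r)}\le C_2\int_{\{y\in T_N:|u(y)|>L\}}|u(y)|\,dy$.
   Context: $T_N=\mathbb R^N/\mathbb Z^N$ is the $N$-torus (functions on it identified with $\mathbb Z^N$-periodic functions), with Lebesgue measure $|\cdot|$. $\Lambda^r$ is the $r$-fold exterior power of $(\mathbb R^N)^*$ with the Euclidean norm $|\cdot|$ in the basis $\theta_{k_1}\wedge\dots\wedge\theta_{k_r}$ ($k_1<\dots<k_r$). $d$ is the exterior derivative, understood in the sense of distributions: $dw=0$ means $\int_{T_N}d\phi\wedge w=0$ for all $\phi\in C^\infty(T_N,\Lambda^{N-r-1})$. *)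

theory Defs
  imports "HOL-Analysis.Analysis"
begin

text \<open>The torus T_N is represented by the unit cube cbox 0 1 in real^'n (with 'n a finite,
linearly ordered index type, CARD('n) = N); boundary has measure zero. Test functions are
Z^N-periodic smooth functions on real^'n.  An r-form w is a function assigning to each point a
coefficient family indexed by sets K of coordinates; only the K with card K = r are used
(coefficient of theta_{k_1} wedge ... wedge theta_{k_r}, k_1 < ... < k_r, K = {k_1,...,k_r}).\<close>

definition torus_cube :: "(real^'n) set" where
  "torus_cube = cbox 0 1"

definition periodic_fun :: "(real^'n \<Rightarrow> real) \<Rightarrow> bool" where
  "periodic_fun f \<longleftrightarrow> (\<forall>x v. (\<forall>i. v $ i \<in> \<int>) \<longrightarrow> f (x + v) = f x)"

definition pderiv :: "'n \<Rightarrow> (real^'n \<Rightarrow> real) \<Rightarrow> real^'n \<Rightarrow> real" where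
  "pderiv j f x = frechet_derivative f (at x) (axis j 1)"

fun Ck :: "nat \<Rightarrow> (real^'n \<Rightarrow> real) \<Rightarrow> bool" where
  "Ck 0 f = continuous_on UNIV f"
| "Ck (Suc k) f = (f differentiable_on UNIV \<and> continuous_on UNIV f \<and> (\<forall>j. Ck k (pderiv j f)))"

definition smooth_fun :: "(real^'n \<Rightarrow> real) \<Rightarrow> bool" where
  "smooth_fun f \<longleftrightarrow> (\<forall>k. Ck k f)"

definition form_norm :: "nat \<Rightarrow> ('n set \<Rightarrow> real) \<Rightarrow> real" where
  "form_norm r a = sqrt (\<Sum>K\<in>{K. card K = r}. (a K)\<^sup>2)"

definition form_neq :: "nat \<Rightarrow> ('n set \<Rightarrow> real) \<Rightarrow> ('n set \<Rightarrow> real) \<Rightarrow> bool" where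
  "form_neq r a b \<longleftrightarrow> (\<exists>K. card K = r \<and> a K \<noteq> b K)"

text \<open>Distributional closedness dw = 0 for an r-form w on T_N: for all smooth
(N-r-1)-forms phi, integral of d phi wedge w vanishes.  Written componentwise: for each
(r+1)-set J of coordinates (complement of the index set of a component of phi) and every smooth
periodic scalar phi,
  sum_{j in J} (-1)^{#{k in J. k < j}} integral w_{J - {j}} * d_j phi = 0.\<close>
definition closed_form :: "nat \<Rightarrow> (real^'n::{finite,linorder} \<Rightarrow> ('n set \<Rightarrow> real)) \<Rightarrow> bool" where
  "closed_form r w \<longleftrightarrow>
     (\<forall>J \<phi>. card J = Suc r \<and> smooth_fun \<phi> \<and> periodic_fun \<phi> \<longrightarrow>
        (\<Sum>j\<in>J. (-1::real) ^ card {k\<in>J. k < j} *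
            (LINT x:torus_cube|lebesgue. w x (J - {j}) * pderiv j \<phi> x)) = 0)"

end

theory Submission
  imports Defs
begin

text \<open>The truncation averages pullbacks: \<open>v\<close> is the mean over \<open>y\<close> in the unit ball of the pullback of
  \<open>u\<close> under \<open>x \<mapsto> x + e(x) y\<close>, where \<open>e\<close> is a \<open>C\<^sup>1\<close> function comparable to the distance from a closed
  set \<open>X\<close> and with small gradient. Pullbacks of closed forms are closed. On \<open>X\<close> the map is the identity,
  so \<open>v = u\<close> there; off \<open>X\<close> the value \<open>v(x)\<close> is bounded by the mean of \<open>|u|\<close> over a ball of radius
  comparable to the distance from \<open>X\<close>. The complement of \<open>X\<close> consists of the points where the maximal
  function of \<open>|u| 1\<^bsub>|u| > L\<^esub>\<close> exceeds \<open>L\<close>, together with an open neighbourhood of \<open>{|u| > L}\<close> of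
  comparable measure; so its measure is at most a constant times \<open>(1/L) \<integral>\<^bsub>|u| > L\<^esub> |u|\<close>, and \<open>v\<close> is at
  most a constant times \<open>L\<close>. Since \<open>e\<close> is only Lipschitz across the boundary of \<open>X\<close>, it is approximated by
  globally \<open>C\<^sup>1\<close> functions that are eventually equal to it at every point off \<open>X\<close>.\<close>

section \<open>The torus as a fundamental cell\<close>

text \<open>Altering values pointwise would destroy closedness; a single pullback preserves it but
  leaves an unbounded form unbounded. Only the mean over \<open>y\<close> yields values controlled
  by \<open>L\<close>. Displacing along a fixed vector makes the differential a rank-one
  perturbation of the identity, so the pullback is affine in the gradient of \<open>e\<close>:
  products of its derivatives never occur.

  The obstacle is regularity. \<open>u\<close> is merely integrable and \<open>e\<close> merely C1,
  so neither Stokes' theorem nor equality of mixed second derivatives applies directly. Mollified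
  forms are treated first, with a weak form of that equality, and the limit is taken after a change
  of variables that moves the displacement onto the test function.

  The maximal function is controlled on \<open>X\<close> only. A mean about a point off
  \<open>X\<close> is therefore compared with one over a larger ball about the nearest point of
  \<open>X\<close>; the loss is a fixed factor because \<open>e\<close> is bounded below by a
  multiple of the distance. Removing an open neighbourhood of the large values takes the place of
  Lebesgue points: it gives \<open>|u| \<le> L\<close> at every point of \<open>X\<close>.\<close>

definition int_lattice :: "(real^'n) set" where
  "int_lattice = {k. \<forall>i. k $ i \<in> \<int>}"

definition unit_cell :: "(real^'n) set" where
  "unit_cell = {x. \<forall>i. 0 \<le> x $ i \<and> x $ i < 1}"

definition wrap :: "real^'n \<Rightarrow> real^'n" where
  "wrap x = (\<chi> i. frac (x $ i))"

text \<open>A measure on the whole space rather than on a subspace, so that periodic functions on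
  \<open>real^'n\<close> are integrated without changing their type. The cell is half-open and hence
  contains exactly one lattice translate of each point.\<close>

definition torus :: "(real^'n) measure" where
  "torus = density lborel (indicator unit_cell)"

definition lattice_periodic :: "(real^'n \<Rightarrow> 'b) \<Rightarrow> bool" where
  "lattice_periodic f \<longleftrightarrow> (\<forall>x. \<forall>k\<in>int_lattice. f (x + k) = f x)"

lemma lattice_periodicD: "lattice_periodic f \<Longrightarrow> k \<in> int_lattice \<Longrightarrow> f (x + k) = f x"
  by (simp add: lattice_periodic_def)

lemma lattice_periodicI: "(\<And>x k. k \<in> int_lattice \<Longrightarrow> f (x + k) = f x) \<Longrightarrow> lattice_periodic f"
  by (simp add: lattice_periodic_def)

lemma periodic_fun_iff: "periodic_fun f \<longleftrightarrow> lattice_periodic f"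
  by (auto simp: periodic_fun_def lattice_periodic_def int_lattice_def)

lemma zero_in_int_lattice [simp]: "0 \<in> int_lattice"
  by (simp add: int_lattice_def)

lemma int_lattice_uminus [simp]: "- k \<in> int_lattice \<longleftrightarrow> k \<in> int_lattice"
  by (simp add: int_lattice_def)

lemma int_lattice_add: "k \<in> int_lattice \<Longrightarrow> l \<in> int_lattice \<Longrightarrow> k + l \<in> int_lattice"
  by (simp add: int_lattice_def)

lemma countable_int_lattice: "countable (int_lattice :: (real^'n) set)"
proof -
  have "int_lattice \<subseteq> (\<lambda>f. \<chi> i. real_of_int (f i)) ` (UNIV :: ('n \<Rightarrow> int) set)"
  proof
    fix k :: "real^'n" assume "k \<in> int_lattice"
    then have "k = (\<chi> i. real_of_int \<lfloor>k $ i\<rfloor>)"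
      by (auto simp: int_lattice_def vec_eq_iff elim!: Ints_cases)
    then show "k \<in> (\<lambda>f. \<chi> i. real_of_int (f i)) ` UNIV"
      by (intro image_eqI[where x="\<lambda>i. \<lfloor>k $ i\<rfloor>"]) auto
  qed
  then show ?thesis
    by (rule countable_subset) simp
qed

lemma closed_int_lattice: "closed (int_lattice :: (real^'n) set)"
proof -
  have "int_lattice = (\<Inter>i. {k :: real^'n. k $ i \<in> \<int>})"
    by (auto simp: int_lattice_def)
  moreover have "closed {k :: real^'n. k $ i \<in> \<int>}" for i
    using continuous_closed_vimage[OF closed_Ints, of "\<lambda>k::real^'n. k $ i"]
    by (simp add: vimage_def continuous_on_eq_continuous_at)
  ultimately show ?thesis by (metis closed_INT)
qed

lemma finite_bounded_int_lattice: "finite {k \<in> int_lattice :: (real^'n) set. norm k \<le> R}"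
proof -
  define A where "A = {- \<lceil>\<bar>R\<bar>\<rceil> .. \<lceil>\<bar>R\<bar>\<rceil>}"
  have "{k \<in> int_lattice :: (real^'n) set. norm k \<le> R} \<subseteq> (\<lambda>f. \<chi> i. real_of_int (f i)) ` (PiE UNIV (\<lambda>_::'n. A))"
  proof
    fix k :: "real^'n" assume k: "k \<in> {k \<in> int_lattice. norm k \<le> R}"
    then have "k = (\<chi> i. real_of_int \<lfloor>k $ i\<rfloor>)"
      by (auto simp: int_lattice_def vec_eq_iff elim!: Ints_cases)
    moreover have "\<lfloor>k $ i\<rfloor> \<in> A" for i
    proof -
      have "\<bar>k $ i\<bar> \<le> \<bar>R\<bar>" using k component_le_norm_cart[of k i] by auto
      then have "k $ i \<le> real_of_int \<lceil>\<bar>R\<bar>\<rceil>" "- real_of_int \<lceil>\<bar>R\<bar>\<rceil> \<le> k $ i"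
        by linarith+
      then show ?thesis
        unfolding A_def by (simp add: le_floor_iff) linarith
    qed
    ultimately show "k \<in> (\<lambda>f. \<chi> i. real_of_int (f i)) ` (PiE UNIV (\<lambda>_. A))"
      by (intro image_eqI[where x="\<lambda>i. \<lfloor>k $ i\<rfloor>"]) auto
  qed
  moreover have "finite (PiE (UNIV::'n set) (\<lambda>_. A))"
    by (intro finite_PiE) (auto simp: A_def)
  ultimately show ?thesis
    using finite_surj by blast
qed

lemma wrap_in_unit_cell: "wrap x \<in> unit_cell"
  by (simp add: wrap_def unit_cell_def frac_lt_1)

lemma norm_unit_cell_le:
  fixes x :: "real^'n" assumes "x \<in> unit_cell" shows "norm x \<le> CARD('n)"
proof -
  have "norm x \<le> (\<Sum>i\<in>UNIV. \<bar>x $ i\<bar>)" by (rule norm_le_l1_cart)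
  also have "\<dots> \<le> (\<Sum>i\<in>(UNIV::'n set). 1)"
    using assms by (intro sum_mono) (auto simp: unit_cell_def less_imp_le)
  finally show ?thesis by simp
qed

lemma wrap_diff_int_lattice: "wrap x - x \<in> int_lattice"
  by (auto simp: wrap_def int_lattice_def frac_def)

lemma wrap_unique:
  assumes "k \<in> int_lattice" "x + k \<in> unit_cell"
  shows "x + k = wrap x"
proof -
  have "x $ i + k $ i = frac (x $ i)" for i
  proof -
    obtain m where m: "k $ i = of_int m"
      using assms(1) by (auto simp: int_lattice_def elim!: Ints_cases)
    have "0 \<le> x $ i + k $ i" "x $ i + k $ i < 1"
      using assms(2) by (auto simp: unit_cell_def)
    then have "\<lfloor>x $ i\<rfloor> = - m" unfolding m by linarith
    then show ?thesis by (simp add: m frac_def)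
  qed
  then show ?thesis by (simp add: vec_eq_iff wrap_def)
qed

lemma wrap_id: "x \<in> unit_cell \<Longrightarrow> wrap x = x"
  using wrap_unique[of 0 x] by simp

lemma lattice_periodic_wrap: "lattice_periodic f \<Longrightarrow> f (wrap x) = f x"
  using lattice_periodicD[of f "wrap x - x" x] by (simp add: wrap_diff_int_lattice)

lemma wrap_add: "k \<in> int_lattice \<Longrightarrow> wrap (x + k) = wrap x"
  using wrap_unique[of "k + (wrap (x + k) - (x + k))" x] wrap_in_unit_cell[of "x + k"]
    int_lattice_add[OF _ wrap_diff_int_lattice, of k "x + k"]
  by simp

lemma lattice_periodic_comp_wrap: "lattice_periodic (\<lambda>x. f (wrap x))"
  by (simp add: lattice_periodic_def wrap_add)

lemma borel_measurable_vec_componentwise: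
  fixes f :: "'a \<Rightarrow> real^'n"
  assumes "\<And>i. (\<lambda>x. f x $ i) \<in> borel_measurable M"
  shows "f \<in> borel_measurable M"
  using assms by (subst borel_measurable_euclidean_space) (auto simp: Basis_vec_def inner_axis)

lemma measurable_vec_nth [measurable]: "(\<lambda>x :: real^'n. x $ i) \<in> borel_measurable borel"
  by (intro borel_measurable_continuous_onI continuous_intros)

lemma wrap_measurable [measurable]: "wrap \<in> borel_measurable borel"
  unfolding wrap_def by (rule borel_measurable_vec_componentwise) (simp add: frac_def)

lemma unit_cell_borel [measurable]: "unit_cell \<in> sets borel"
proof -
  have "unit_cell = (\<Inter>i. {x \<in> space borel. 0 \<le> x $ i \<and> x $ i < 1} :: (real^'n) set)"
    by (auto simp: unit_cell_def)
  also have "\<dots> \<in> sets borel" by measurable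
  finally show ?thesis .
qed

lemma sets_torus [simp, measurable_cong]: "sets torus = sets borel"
  by (simp add: torus_def)

lemma space_torus [simp]: "space torus = UNIV"
  by (simp add: torus_def)

lemma unit_cell_bounds: "box 0 (1 :: real^'n) \<subseteq> unit_cell" "unit_cell \<subseteq> cbox 0 (1 :: real^'n)"
  by (auto simp: unit_cell_def mem_box_cart less_imp_le)

lemma emeasure_unit_cell: "emeasure lborel (unit_cell :: (real^'n) set) = 1"
proof (rule antisym)
  have *: "(\<Prod>b\<in>Basis. (1 :: real^'n) \<bullet> b) = 1" "\<forall>b\<in>Basis. 0 \<le> (1 :: real^'n) \<bullet> b"
    by (auto intro!: prod.neutral simp: Basis_vec_def inner_axis)
  show "emeasure lborel (unit_cell :: (real^'n) set) \<le> 1"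
    using emeasure_mono[OF unit_cell_bounds(2)[where 'n='n], of lborel] *
    by (simp add: emeasure_lborel_cbox_eq)
  show "1 \<le> emeasure lborel (unit_cell :: (real^'n) set)"
    using emeasure_mono[OF unit_cell_bounds(1)[where 'n='n], of lborel] *
    by (simp add: emeasure_lborel_box_eq)
qed

lemma emeasure_torus_UNIV [simp]: "emeasure (torus :: (real^'n) measure) UNIV = 1"
  using emeasure_unit_cell by (simp add: torus_def emeasure_density)

lemma finite_measure_torus: "finite_measure (torus :: (real^'n) measure)"
  by standard simp

interpretation torus: finite_measure "torus :: (real^'n) measure"
  by (rule finite_measure_torus)

lemma measure_torus_UNIV [simp]: "measure (torus :: (real^'n) measure) UNIV = 1"
  by (simp add: measure_def)

lemma nn_integral_torus:
  "f \<in> borel_measurable borel \<Longrightarrow> (\<integral>\<^sup>+x. f x \<partial>torus) = (\<integral>\<^sup>+x. f x * indicator unit_cell x \<partial>lborel)"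
  by (simp add: torus_def nn_integral_density mult.commute)

section \<open>Unfolding integrals over the whole space onto the fundamental cell\<close>

lemma lborel_nn_integral_translate:
  fixes f :: "'a::euclidean_space \<Rightarrow> ennreal"
  assumes [measurable]: "f \<in> borel_measurable borel"
  shows "(\<integral>\<^sup>+x. f (x + c) \<partial>lborel) = (\<integral>\<^sup>+x. f x \<partial>lborel)"
proof -
  have "(\<integral>\<^sup>+x. f x \<partial>lborel) = (\<integral>\<^sup>+x. f x \<partial>distr lborel borel ((+) c))"
    by (simp add: lborel_distr_plus)
  also have "\<dots> = (\<integral>\<^sup>+x. f (c + x) \<partial>lborel)"
    by (rule nn_integral_distr) auto
  finally show ?thesis by (simp add: add.commute)
qed

lemma count_lattice_unit_cell:
  fixes x :: "real^'n"
  shows "(\<integral>\<^sup>+k. indicator unit_cell (x + k) \<partial>count_space int_lattice) = (1::ennreal)"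
proof -
  have "(\<integral>\<^sup>+k. indicator unit_cell (x + k) \<partial>count_space int_lattice)
      = (\<integral>\<^sup>+k. indicator {wrap x - x} k \<partial>count_space int_lattice)"
  proof (rule nn_integral_cong)
    fix k :: "real^'n" assume "k \<in> space (count_space int_lattice)"
    then have "x + k \<in> unit_cell \<longleftrightarrow> k = wrap x - x"
      using wrap_unique[of k x] wrap_in_unit_cell[of x] by (auto simp: algebra_simps)
    then show "indicator unit_cell (x + k) = (indicator {wrap x - x} k :: ennreal)"
      by (simp add: indicator_def)
  qed
  also have "\<dots> = 1"
    using wrap_diff_int_lattice[of x] by (simp add: nn_integral_indicator emeasure_count_space)
  finally show ?thesis .
qed

lemma count_lattice_unit_cell_minus:
  fixes x :: "real^'n"
  shows "(\<integral>\<^sup>+k. indicator unit_cell (x - k) \<partial>count_space int_lattice) = (1::ennreal)"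
proof -
  have "bij_betw uminus int_lattice (int_lattice :: (real^'n) set)"
    by (rule bij_betwI[where g=uminus]) auto
  then have "(\<integral>\<^sup>+k. indicator unit_cell (x - k) \<partial>count_space int_lattice)
     = (\<integral>\<^sup>+k. (indicator unit_cell (x + k) :: ennreal) \<partial>count_space int_lattice)"
    by (subst nn_integral_bij_count_space[of uminus int_lattice int_lattice, symmetric]) auto
  then show ?thesis by (simp add: count_lattice_unit_cell)
qed

text \<open>The factor \<open>1\<close> is written as the sum over \<open>k\<close> of the
  indicators of the translated cells; Tonelli and the translation by \<open>k\<close> carry each
  piece back to the cell, where periodicity leaves \<open>f\<close> unchanged. Three choices of
  \<open>h\<close> occur later: a shifted cell, a Borel set and a large ball.\<close>

lemma nn_integral_unfold_torus:
  fixes f h :: "real^'n \<Rightarrow> ennreal"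
  assumes f [measurable]: "f \<in> borel_measurable borel" and per: "lattice_periodic f"
    and h [measurable]: "h \<in> borel_measurable borel"
  shows "(\<integral>\<^sup>+x. h x * f x \<partial>lborel)
       = (\<integral>\<^sup>+x. (\<integral>\<^sup>+k. h (x + k) \<partial>count_space int_lattice) * f x \<partial>torus)"
proof -
  have "(\<integral>\<^sup>+x. h x * f x \<partial>lborel)
      = (\<integral>\<^sup>+x. \<integral>\<^sup>+k. h x * f x * indicator unit_cell (x - k) \<partial>count_space int_lattice \<partial>lborel)"
    by (simp add: nn_integral_cmult count_lattice_unit_cell_minus)
  also have "\<dots> = (\<integral>\<^sup>+k. \<integral>\<^sup>+x. h x * f x * indicator unit_cell (x - k) \<partial>lborel \<partial>count_space int_lattice)"
    by (rule nn_integral_count_space_nn_integral[OF countable_int_lattice]) measurable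
  also have "\<dots> = (\<integral>\<^sup>+k. \<integral>\<^sup>+x. h (x + k) * f x * indicator unit_cell x \<partial>lborel \<partial>count_space int_lattice)"
  proof (rule nn_integral_cong)
    fix k :: "real^'n" assume k: "k \<in> space (count_space int_lattice)"
    have "(\<integral>\<^sup>+x. h x * f x * indicator unit_cell (x - k) \<partial>lborel)
        = (\<integral>\<^sup>+x. h (x + k) * f (x + k) * indicator unit_cell ((x + k) - k) \<partial>lborel)"
      by (rule lborel_nn_integral_translate[symmetric]) measurable
    then show "(\<integral>\<^sup>+x. h x * f x * indicator unit_cell (x - k) \<partial>lborel)
        = (\<integral>\<^sup>+x. h (x + k) * f x * indicator unit_cell x \<partial>lborel)"
      using k per by (simp add: lattice_periodicD)
  qed
  also have "\<dots> = (\<integral>\<^sup>+x. \<integral>\<^sup>+k. h (x + k) * f x * indicator unit_cell x \<partial>count_space int_lattice \<partial>lborel)"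
    by (rule nn_integral_count_space_nn_integral[OF countable_int_lattice, symmetric]) measurable
  also have "\<dots> = (\<integral>\<^sup>+x. indicator unit_cell x * ((\<integral>\<^sup>+k. h (x + k) \<partial>count_space int_lattice) * f x) \<partial>lborel)"
    by (rule nn_integral_cong) (simp add: nn_integral_multc nn_integral_cmult mult_ac split: split_indicator)
  also have "\<dots> = (\<integral>\<^sup>+x. (\<integral>\<^sup>+k. h (x + k) \<partial>count_space int_lattice) * f x \<partial>torus)"
  proof -
    interpret C: sigma_finite_measure "count_space (int_lattice :: (real^'n) set)"
      by (rule sigma_finite_measure_count_space_countable[OF countable_int_lattice])
    have "(\<lambda>p. h (fst p + snd p)) \<in> borel_measurable (borel \<Otimes>\<^sub>M count_space int_lattice)"
      by (rule measurable_compose_countable'[OF _ _ countable_int_lattice, where f="\<lambda>k p. h (fst p + k)" and g=snd]) auto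
    then have "case_prod (\<lambda>x k. h (x + k)) \<in> borel_measurable (borel \<Otimes>\<^sub>M count_space int_lattice)"
      by (simp add: case_prod_beta')
    then have [measurable]: "(\<lambda>x. \<integral>\<^sup>+k. h (x + k) \<partial>count_space int_lattice) \<in> borel_measurable borel"
      by (rule C.borel_measurable_nn_integral)
    show ?thesis
      unfolding torus_def by (subst nn_integral_density) (auto)
  qed
  finally show ?thesis .
qed

text \<open>A shifted cell is again a fundamental domain: with \<open>h\<close> its indicator, the
  lattice sum in the unfolding formula equals \<open>1\<close>.\<close>

lemma torus_distr_translate: "distr torus borel (\<lambda>x. wrap (x + z)) = torus"
proof (rule measure_eqI)
  fix A assume "A \<in> sets (distr torus borel (\<lambda>x. wrap (x + z)))"
  then have [measurable]: "A \<in> sets borel" by simp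
  let ?f = "\<lambda>x. indicator A (wrap x) :: ennreal"
  have per: "lattice_periodic ?f" by (rule lattice_periodic_comp_wrap)
  have "emeasure (distr torus borel (\<lambda>x. wrap (x + z))) A = (\<integral>\<^sup>+x. indicator A x \<partial>distr torus borel (\<lambda>x. wrap (x + z)))"
    by simp
  also have "\<dots> = (\<integral>\<^sup>+x. ?f (x + z) \<partial>torus)"
    by (rule nn_integral_distr) auto
  also have "\<dots> = (\<integral>\<^sup>+x. ?f (x + z) * indicator unit_cell ((x + z) - z) \<partial>lborel)"
    by (simp add: nn_integral_torus)
  also have "\<dots> = (\<integral>\<^sup>+x. ?f x * indicator unit_cell (x - z) \<partial>lborel)"
    by (rule lborel_nn_integral_translate) simp
  also have "\<dots> = (\<integral>\<^sup>+x. indicator unit_cell (x - z) * ?f x \<partial>lborel)"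
    by (simp add: mult.commute)
  also have "\<dots> = (\<integral>\<^sup>+x. (\<integral>\<^sup>+k. indicator unit_cell ((x + k) - z) \<partial>count_space int_lattice) * ?f x \<partial>torus)"
    by (rule nn_integral_unfold_torus[OF _ per]) simp_all
  also have "\<dots> = (\<integral>\<^sup>+x. ?f x \<partial>torus)"
  proof (intro nn_integral_cong)
    fix x :: "real^'a"
    have "x + k - z = (x - z) + k" for k by simp
    then show "(\<integral>\<^sup>+k. indicator unit_cell ((x + k) - z) \<partial>count_space int_lattice) * ?f x = ?f x"
      using count_lattice_unit_cell[of "x - z"] by (simp only: mult_1)
  qed
  also have "\<dots> = (\<integral>\<^sup>+x. indicator A x \<partial>torus)"
    unfolding nn_integral_torus[OF borel_measurable_indicator[OF \<open>A \<in> sets borel\<close>]]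
    by (subst nn_integral_torus) (auto intro!: nn_integral_cong split: split_indicator simp: wrap_id)
  also have "\<dots> = emeasure torus A" by simp
  finally show "emeasure (distr torus borel (\<lambda>x. wrap (x + z))) A = emeasure torus A" .
qed simp

lemma torus_integral_translate:
  fixes f :: "real^'n \<Rightarrow> 'b::{banach, second_countable_topology}"
  assumes [measurable]: "f \<in> borel_measurable borel" and per: "lattice_periodic f"
  shows "(\<integral>x. f (x + z) \<partial>torus) = (\<integral>x. f x \<partial>torus)"
  using integral_distr[of "\<lambda>x. wrap (x + z)" torus borel f]
  by (simp add: torus_distr_translate lattice_periodic_wrap[OF per])

text \<open>A point of the hull has at least one translate in \<open>S\<close>, so the indicator of
  the hull is at most the number of such translates; unfolding with \<open>f = 1\<close> integrates
  this number to the measure of \<open>S\<close>.\<close>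

lemma emeasure_torus_lattice_hull:
  assumes [measurable]: "S \<in> sets borel"
  shows "emeasure torus {x. \<exists>k\<in>int_lattice. x + k \<in> S} \<le> emeasure lborel S"
proof -
  let ?H = "{x. \<exists>k\<in>int_lattice. x + k \<in> S}"
  have "?H = (\<Union>k\<in>int_lattice. {x \<in> space borel. x + k \<in> S})" by auto
  also have "\<dots> \<in> sets borel"
    by (intro sets.countable_UN'[OF countable_int_lattice] image_subsetI) measurable
  finally have [measurable]: "?H \<in> sets borel" .
  have "emeasure torus ?H = (\<integral>\<^sup>+x. indicator ?H x \<partial>torus)" by simp
  also have "\<dots> \<le> (\<integral>\<^sup>+x. (\<integral>\<^sup>+k. indicator S (x + k) \<partial>count_space int_lattice) * 1 \<partial>torus)"
  proof (intro nn_integral_mono)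
    fix x :: "real^'a"
    show "indicator ?H x \<le> (\<integral>\<^sup>+k. indicator S (x + k) \<partial>count_space int_lattice) * (1::ennreal)"
    proof (cases "x \<in> ?H")
      case True
      then obtain k where k: "k \<in> int_lattice" "x + k \<in> S" by auto
      have "(1::ennreal) = (\<integral>\<^sup>+l. indicator {k} l \<partial>count_space int_lattice)"
        using k by (simp add: nn_integral_indicator emeasure_count_space)
      also have "\<dots> \<le> (\<integral>\<^sup>+k. indicator S (x + k) \<partial>count_space int_lattice)"
        using k by (intro nn_integral_mono) (auto split: split_indicator)
      finally show ?thesis using True by simp
    qed simp
  qed
  also have "\<dots> = (\<integral>\<^sup>+x. indicator S x * 1 \<partial>lborel)"
    by (rule nn_integral_unfold_torus[symmetric]) (simp_all add: lattice_periodic_def)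
  also have "\<dots> = emeasure lborel S" by simp
  finally show ?thesis .
qed

lemma nn_integral_bounded_le_torus:
  fixes R :: real
  obtains M :: nat where "\<And>f :: real^'n \<Rightarrow> ennreal. f \<in> borel_measurable borel \<Longrightarrow> lattice_periodic f \<Longrightarrow>
     (\<integral>\<^sup>+x\<in>cball 0 R. f x \<partial>lborel) \<le> of_nat M * (\<integral>\<^sup>+x. f x \<partial>torus)"
proof
  \<comment> \<open>Points of the cell have norm at most \<open>CARD('n)\<close>, so only these
    finitely many translations can bring one of them into the ball.\<close>
  let ?F = "{k \<in> int_lattice :: (real^'n) set. norm k \<le> R + CARD('n)}"
  fix f :: "real^'n \<Rightarrow> ennreal" assume f [measurable]: "f \<in> borel_measurable borel" and per: "lattice_periodic f"
  have "(\<integral>\<^sup>+x\<in>cball 0 R. f x \<partial>lborel) = (\<integral>\<^sup>+x. indicator (cball 0 R) x * f x \<partial>lborel)"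
    by (simp add: mult.commute)
  also have "\<dots> = (\<integral>\<^sup>+x. (\<integral>\<^sup>+k. indicator (cball 0 R) (x + k) \<partial>count_space int_lattice) * f x \<partial>torus)"
    by (rule nn_integral_unfold_torus[OF f per]) (intro borel_measurable_indicator, simp)
  also have "\<dots> \<le> (\<integral>\<^sup>+x. of_nat (card ?F) * f x \<partial>torus)"
  proof (rule nn_integral_mono_AE, unfold torus_def, subst AE_density, simp, rule AE_I2, intro impI mult_right_mono)
    fix x :: "real^'n" assume "0 < (indicator unit_cell x :: ennreal)"
    then have x: "x \<in> unit_cell" by (auto split: split_indicator_asm)
    have nx: "norm x \<le> CARD('n)" by (rule norm_unit_cell_le[OF x])
    have "(\<integral>\<^sup>+k. indicator (cball 0 R) (x + k) \<partial>count_space int_lattice)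
        \<le> (\<integral>\<^sup>+k. (indicator ?F k :: ennreal) \<partial>count_space int_lattice)"
    proof (intro nn_integral_mono)
      fix k :: "real^'n" assume k: "k \<in> space (count_space int_lattice)"
      have "norm k \<le> norm (x + k) + norm x"
        using norm_triangle_ineq4[of "x + k" x] by simp
      then show "indicator (cball 0 R) (x + k) \<le> (indicator ?F k :: ennreal)"
        using k nx by (auto split: split_indicator)
    qed
    also have "\<dots> = of_nat (card ?F)"
      using finite_bounded_int_lattice[of "R + CARD('n)", where 'n='n]
      by (simp add: nn_integral_indicator emeasure_count_space Collect_conj_eq Int_ac)
    finally show "(\<integral>\<^sup>+k. indicator (cball 0 R) (x + k) \<partial>count_space int_lattice) \<le> (of_nat (card ?F) :: ennreal)" .
  qed simp
  also have "\<dots> = of_nat (card ?F) * (\<integral>\<^sup>+x. f x \<partial>torus)"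
    by (rule nn_integral_cmult) simp
  finally show "(\<integral>\<^sup>+x\<in>cball 0 R. f x \<partial>lborel) \<le> of_nat (card ?F) * (\<integral>\<^sup>+x. f x \<partial>torus)" .
qed

section \<open>Periodic functions of class C1\<close>

text \<open>The derivative is stored as a gradient field, so that directional derivatives, products
  and the rank-one pullback become vector algebra.\<close>

definition C1_periodic :: "(real^'n \<Rightarrow> real) \<Rightarrow> (real^'n \<Rightarrow> real^'n) \<Rightarrow> bool" where
  "C1_periodic f f' \<longleftrightarrow> lattice_periodic f \<and> (\<forall>x. (f has_derivative (\<lambda>h. f' x \<bullet> h)) (at x)) \<and> continuous_on UNIV f'"

lemma periodic_continuous_bounded:
  fixes f :: "real^'n \<Rightarrow> 'b::real_normed_vector"
  assumes "continuous_on UNIV f" "lattice_periodic f"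
  obtains B where "B > 0" "\<And>x. norm (f x) \<le> B"
proof -
  have "compact (f ` cball 0 (CARD('n)))"
    using assms(1) by (intro compact_continuous_image) (auto intro: continuous_on_subset)
  then obtain B where B: "B > 0" "\<And>y. y \<in> f ` cball 0 (CARD('n)) \<Longrightarrow> norm y \<le> B"
    using compact_imp_bounded bounded_pos by metis
  have "norm (f x) \<le> B" for x
  proof -
    have "f x = f (wrap x)" by (simp add: lattice_periodic_wrap[OF assms(2)])
    also have "\<dots> \<in> f ` cball 0 (CARD('n))"
      using norm_unit_cell_le[OF wrap_in_unit_cell[of x]] by auto
    finally show ?thesis by (rule B)
  qed
  with B(1) show thesis by (rule that)
qed

lemma periodic_continuous_uniformly:
  fixes f :: "real^'n \<Rightarrow> 'b::real_normed_vector"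
  assumes "continuous_on UNIV f" and per: "lattice_periodic f" and "e > 0"
  obtains d where "d > 0" "\<And>x y. norm (x - y) < d \<Longrightarrow> norm (f x - f y) < e"
proof -
  let ?K = "cball (0::real^'n) (CARD('n) + 1)"
  have "uniformly_continuous_on ?K f"
    using assms(1) by (intro compact_uniformly_continuous) (auto intro: continuous_on_subset)
  then obtain d where d: "d > 0" "\<And>x y. x \<in> ?K \<Longrightarrow> y \<in> ?K \<Longrightarrow> dist y x < d \<Longrightarrow> dist (f y) (f x) < e"
    using \<open>e > 0\<close> unfolding uniformly_continuous_on_def by metis
  have "norm (f x - f y) < e" if "norm (x - y) < min d 1" for x y
  proof -
    \<comment> \<open>Both points are moved by the same lattice vector into a fixed compact ball;
      its radius exceeds that of a ball around the cell by \<open>1\<close> to make room for the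
      nearby point.\<close>
    define k where "k = wrap x - x"
    have k: "k \<in> int_lattice" by (simp add: k_def wrap_diff_int_lattice)
    have n: "norm (x + k) \<le> CARD('n)"
      using norm_unit_cell_le[OF wrap_in_unit_cell[of x]] by (simp add: k_def)
    have "norm (y + k) \<le> norm (x + k) + norm (x - y)"
      using norm_triangle_ineq4[of "x + k" "x - y"] by (simp add: add.commute)
    then have "dist (f (x + k)) (f (y + k)) < e"
      using n that by (intro d(2)) (auto simp: mem_cball_0 dist_norm simp del: mem_cball)
    then show ?thesis
      using lattice_periodicD[OF per k] by (simp add: dist_norm)
  qed
  then show thesis using d(1) that[of "min d 1"] by simp
qed

lemma C1_periodicD:
  assumes "C1_periodic f f'"
  shows "lattice_periodic f" "\<And>x. (f has_derivative (\<lambda>h. f' x \<bullet> h)) (at x)"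
    "continuous_on UNIV f'" "continuous_on UNIV f"
proof -
  show d: "(f has_derivative (\<lambda>h. f' x \<bullet> h)) (at x)" for x
    using assms by (simp add: C1_periodic_def)
  show "continuous_on UNIV f"
    using has_derivative_continuous[OF d] by (simp add: continuous_at_imp_continuous_on)
qed (use assms in \<open>simp_all add: C1_periodic_def\<close>)

text \<open>Translating \<open>f\<close> by a lattice vector changes nothing, and the derivative at
  a point is unique.\<close>

lemma C1_periodic_gradient_periodic:
  assumes "C1_periodic f f'"
  shows "lattice_periodic f'"
  unfolding lattice_periodic_def
proof (intro allI ballI)
  fix x k :: "real^'a" assume k: "k \<in> int_lattice"
  have "((\<lambda>x. f (x + k)) has_derivative (\<lambda>h. f' (x + k) \<bullet> h)) (at x)"
    by (rule has_derivative_compose[of "\<lambda>x. x + k" "\<lambda>h. h" x UNIV f "\<lambda>h. f' (x + k) \<bullet> h"])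
       (auto intro!: derivative_eq_intros C1_periodicD(2)[OF assms])
  then have "(f has_derivative (\<lambda>h. f' (x + k) \<bullet> h)) (at x)"
    using lattice_periodicD[OF C1_periodicD(1)[OF assms] k] by simp
  with C1_periodicD(2)[OF assms, of x] have "(\<lambda>h. f' (x + k) \<bullet> h) = (\<lambda>h. f' x \<bullet> h)"
    by (rule has_derivative_unique[rotated])
  then show "f' (x + k) = f' x"
    by (metis vector_eq_rdot)
qed

lemma C1_periodic_bounds:
  assumes "C1_periodic f f'"
  obtains B where "B > 0" "\<And>x. \<bar>f x\<bar> \<le> B" "\<And>x. norm (f' x) \<le> B"
proof -
  obtain B1 where "B1 > 0" "\<And>x. norm (f x) \<le> B1"
    by (rule periodic_continuous_bounded[OF C1_periodicD(4)[OF assms] C1_periodicD(1)[OF assms]]) auto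
  moreover obtain B2 where "B2 > 0" "\<And>x. norm (f' x) \<le> B2"
    by (rule periodic_continuous_bounded[OF C1_periodicD(3)[OF assms] C1_periodic_gradient_periodic[OF assms]]) auto
  ultimately show thesis
    by (intro that[of "max B1 B2"]) (auto simp: le_max_iff_disj)
qed

lemma C1_periodic_measurable:
  assumes "C1_periodic f f'"
  shows "f \<in> borel_measurable borel" "f' \<in> borel_measurable borel"
  using C1_periodicD(3,4)[OF assms] by (auto intro: borel_measurable_continuous_onI)

section \<open>Derivatives, translations and convolutions under the integral\<close>

lemma torus_integrable_bounded:
  fixes f :: "real^'n \<Rightarrow> 'b::{banach,second_countable_topology}"
  assumes "f \<in> borel_measurable borel" "\<And>x. norm (f x) \<le> B"
  shows "integrable torus f"
  using assms by (intro torus.integrable_const_bound[where B=B]) auto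

lemma torus_integrable_continuous:
  fixes f :: "real^'n \<Rightarrow> 'b::{banach,second_countable_topology}"
  assumes "continuous_on UNIV f" "lattice_periodic f"
  shows "integrable torus f"
proof -
  obtain B where "\<And>x. norm (f x) \<le> B" using periodic_continuous_bounded[OF assms] by metis
  with assms show ?thesis by (intro torus_integrable_bounded borel_measurable_continuous_onI)
qed

text \<open>Dominated convergence concerns sequences, so the limit that defines the derivative is
  tested along arbitrary sequences. The mean value inequality bounds the remainder divided by the
  size of the increment by \<open>2 * B z\<close>, uniformly in the increment.\<close>

lemma has_derivative_integral_dominated:
  fixes G :: "'v::euclidean_space \<Rightarrow> 'a \<Rightarrow> real" and G' :: "'v \<Rightarrow> 'a \<Rightarrow> 'v"
  assumes G: "\<And>x z. ((\<lambda>x. G x z) has_derivative (\<lambda>h. G' x z \<bullet> h)) (at x)"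
    and bound: "\<And>x z. norm (G' x z) \<le> B z"
    and B: "integrable M B"
    and int: "\<And>x. integrable M (G x)"
    and meas: "\<And>x. G' x \<in> borel_measurable M"
  shows "((\<lambda>x. \<integral>z. G x z \<partial>M) has_derivative (\<lambda>h. (\<integral>z. G' x z \<partial>M) \<bullet> h)) (at x)"
proof -
  have intG': "integrable M (G' x)" for x
    by (rule Bochner_Integration.integrable_bound[OF B meas]) (use bound in \<open>auto intro: order_trans[OF _ abs_ge_self]\<close>)
  have "((\<lambda>h. norm ((\<integral>z. G (x + h) z \<partial>M) - (\<integral>z. G x z \<partial>M) - (\<integral>z. G' x z \<partial>M) \<bullet> h) / norm h) \<longlongrightarrow> 0) (at 0)"
  proof (subst tendsto_at_iff_sequentially, intro allI impI)
    fix X :: "nat \<Rightarrow> 'v" assume X: "\<forall>i. X i \<in> UNIV - {0}" "X \<longlonglongrightarrow> 0"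
    define D where "D i z = (G (x + X i) z - G x z - G' x z \<bullet> X i) / norm (X i)" for i z
    have bd: "norm (D i z) \<le> 2 * B z" for i z
    proof -
      have "norm (G (x + X i) z - G x z) \<le> B z * norm (x + X i - x)"
      proof (rule differentiable_bound[where S=UNIV and f'="\<lambda>x h. G' x z \<bullet> h"])
        show "onorm (\<lambda>h. G' y z \<bullet> h) \<le> B z" for y
        proof (rule onorm_le)
          fix h
          have "norm (G' y z \<bullet> h) \<le> norm (G' y z) * norm h" by (rule Cauchy_Schwarz_ineq2[folded real_norm_def])
          also have "\<dots> \<le> B z * norm h" by (intro mult_right_mono bound) simp
          finally show "norm (G' y z \<bullet> h) \<le> B z * norm h" .
        qed
      qed (use G in \<open>auto intro: has_derivative_at_withinI\<close>)
      moreover have "norm (G' x z \<bullet> X i) \<le> B z * norm (X i)"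
        by (rule order_trans[OF Cauchy_Schwarz_ineq2[folded real_norm_def]]) (intro mult_right_mono bound norm_ge_zero)
      ultimately have "norm (G (x + X i) z - G x z - G' x z \<bullet> X i) \<le> 2 * B z * norm (X i)"
        using norm_triangle_ineq4[of "G (x + X i) z - G x z" "G' x z \<bullet> X i"] by simp
      then show ?thesis using X(1) by (auto simp: D_def divide_le_eq)
    qed
    have "(\<lambda>i. \<integral>z. D i z \<partial>M) \<longlonglongrightarrow> (\<integral>z. 0 \<partial>M)"
    proof (rule integral_dominated_convergence)
      show "integrable M (\<lambda>z. 2 * B z)" using B by simp
      show "(\<lambda>z. 0::real) \<in> borel_measurable M" by simp
      show "D i \<in> borel_measurable M" for i
        unfolding D_def using int meas by (auto dest!: borel_measurable_integrable intro!: borel_measurable_divide borel_measurable_diff borel_measurable_inner)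
      show "AE z in M. norm (D i z) \<le> 2 * B z" for i using bd by simp
      show "AE z in M. (\<lambda>i. D i z) \<longlonglongrightarrow> 0"
      proof (rule AE_I2)
        fix z
        have "((\<lambda>h. norm (G (x + h) z - G x z - G' x z \<bullet> h) / norm h) \<longlongrightarrow> 0) (at 0)"
          using G[of z x] by (simp add: has_derivative_at)
        then have "(\<lambda>i. norm (G (x + X i) z - G x z - G' x z \<bullet> X i) / norm (X i)) \<longlonglongrightarrow> 0"
          using X by (auto simp: tendsto_at_iff_sequentially o_def)
        then have "(\<lambda>i. norm (D i z)) \<longlonglongrightarrow> 0" by (simp add: D_def)
        then show "(\<lambda>i. D i z) \<longlonglongrightarrow> 0" by (rule tendsto_norm_zero_cancel)
      qed
    qed
    then have "(\<lambda>i. \<integral>z. D i z \<partial>M) \<longlonglongrightarrow> 0" by simp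
    then have lim: "(\<lambda>i. norm (\<integral>z. D i z \<partial>M)) \<longlonglongrightarrow> 0" by (rule tendsto_norm_zero)
    have "(\<integral>z. D i z \<partial>M) = ((\<integral>z. G (x + X i) z \<partial>M) - (\<integral>z. G x z \<partial>M) - (\<integral>z. G' x z \<partial>M) \<bullet> X i) / norm (X i)" for i
      using int intG' by (simp add: D_def)
    with lim show "((\<lambda>h. norm ((\<integral>z. G (x + h) z \<partial>M) - (\<integral>z. G x z \<partial>M) - (\<integral>z. G' x z \<partial>M) \<bullet> h) / norm h) \<circ> X) \<longlonglongrightarrow> 0"
      by (simp add: o_def)
  qed
  then show ?thesis
    by (simp add: has_derivative_at bounded_linear_inner_right)
qed

lemma has_real_derivative_integral_dominated:
  fixes G G' :: "real \<Rightarrow> 'a \<Rightarrow> real"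
  assumes G: "\<And>t z. ((\<lambda>t. G t z) has_real_derivative G' t z) (at t)"
    and bound: "\<And>t z. \<bar>G' t z\<bar> \<le> B z"
    and B: "integrable M B"
    and int: "\<And>t. integrable M (G t)"
    and meas: "\<And>t. G' t \<in> borel_measurable M"
  shows "((\<lambda>t. \<integral>z. G t z \<partial>M) has_real_derivative (\<integral>z. G' t z \<partial>M)) (at t)"
  using has_derivative_integral_dominated[of G G' B M t] assms
  by (simp add: has_field_derivative_def)

lemma C1_periodic_line_derivative:
  assumes "C1_periodic f f'"
  shows "((\<lambda>t. f (x + t *\<^sub>R v)) has_real_derivative f' (x + t *\<^sub>R v) \<bullet> v) (at t)"
proof -
  have "((\<lambda>t. x + t *\<^sub>R v) has_derivative (\<lambda>h. h *\<^sub>R v)) (at t)"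
    by (auto intro!: derivative_eq_intros)
  from has_derivative_compose[OF this C1_periodicD(2)[OF assms]]
  show ?thesis by (simp add: has_field_derivative_def mult_commute_abs)
qed

text \<open>By translation invariance the integral of \<open>f (x + t *\<^sub>R v)\<close> does not
  depend on \<open>t\<close>; differentiating at \<open>t = 0\<close> gives the claim.\<close>

lemma torus_integral_derivative:
  assumes f: "C1_periodic f f'"
  shows "(\<integral>x. f' x \<bullet> v \<partial>torus) = 0"
proof -
  obtain B where B: "B > 0" "\<And>x. \<bar>f x\<bar> \<le> B" "\<And>x. norm (f' x) \<le> B" using C1_periodic_bounds[OF f] by metis
  note [measurable] = C1_periodic_measurable[OF f]
  have "((\<lambda>t. \<integral>x. f (x + t *\<^sub>R v) \<partial>torus) has_real_derivative (\<integral>x. f' (x + 0 *\<^sub>R v) \<bullet> v \<partial>torus)) (at 0)"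
  proof (rule has_real_derivative_integral_dominated)
    show "((\<lambda>t. f (x + t *\<^sub>R v)) has_real_derivative f' (x + t *\<^sub>R v) \<bullet> v) (at t)" for x t
      by (rule C1_periodic_line_derivative[OF f])
    show "\<bar>f' (x + t *\<^sub>R v) \<bullet> v\<bar> \<le> B * norm v" for x t
      by (rule order_trans[OF Cauchy_Schwarz_ineq2]) (intro mult_right_mono B norm_ge_zero)
    show "integrable torus (\<lambda>x. f (x + t *\<^sub>R v))" for t
      by (rule torus_integrable_bounded[where B=B]) (use B in simp_all)
  qed simp_all
  moreover have "(\<lambda>t. \<integral>x. f (x + t *\<^sub>R v) \<partial>torus) = (\<lambda>t. \<integral>x. f x \<partial>torus)"
    by (rule ext, rule torus_integral_translate) (use C1_periodicD(1)[OF f] in simp_all)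
  ultimately have "((\<lambda>t::real. \<integral>x. f x \<partial>torus) has_real_derivative (\<integral>x. f' x \<bullet> v \<partial>torus)) (at 0)"
    by simp
  from DERIV_unique[OF this DERIV_const] show ?thesis .
qed

lemma C1_periodic_mult:
  assumes f: "C1_periodic f f'" and g: "C1_periodic g g'"
  shows "C1_periodic (\<lambda>x. f x * g x) (\<lambda>x. f x *\<^sub>R g' x + g x *\<^sub>R f' x)"
  unfolding C1_periodic_def
proof (intro conjI allI)
  show "lattice_periodic (\<lambda>x. f x * g x)"
    by (intro lattice_periodicI) (simp add: lattice_periodicD[OF C1_periodicD(1)[OF f]] lattice_periodicD[OF C1_periodicD(1)[OF g]])
  show "((\<lambda>x. f x * g x) has_derivative (\<lambda>h. (f x *\<^sub>R g' x + g x *\<^sub>R f' x) \<bullet> h)) (at x)" for x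
    using has_derivative_mult[OF C1_periodicD(2)[OF f, of x] C1_periodicD(2)[OF g, of x]]
    by (simp add: inner_add_left mult.commute)
  show "continuous_on UNIV (\<lambda>x. f x *\<^sub>R g' x + g x *\<^sub>R f' x)"
    by (intro continuous_intros C1_periodicD(3,4)[OF f] C1_periodicD(3,4)[OF g])
qed

lemma C1_periodic_add:
  assumes f: "C1_periodic f f'" and g: "C1_periodic g g'"
  shows "C1_periodic (\<lambda>x. f x + g x) (\<lambda>x. f' x + g' x)"
  unfolding C1_periodic_def
proof (intro conjI allI)
  show "lattice_periodic (\<lambda>x. f x + g x)"
    by (intro lattice_periodicI) (simp add: lattice_periodicD[OF C1_periodicD(1)[OF f]] lattice_periodicD[OF C1_periodicD(1)[OF g]])
  show "((\<lambda>x. f x + g x) has_derivative (\<lambda>h. (f' x + g' x) \<bullet> h)) (at x)" for x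
    using has_derivative_add[OF C1_periodicD(2)[OF f, of x] C1_periodicD(2)[OF g, of x]]
    by (simp add: inner_add_left)
  show "continuous_on UNIV (\<lambda>x. f' x + g' x)"
    by (intro continuous_intros C1_periodicD(3,4)[OF f] C1_periodicD(3,4)[OF g])
qed

lemma C1_periodic_const: "C1_periodic (\<lambda>x. c) (\<lambda>x. 0)"
  by (simp add: C1_periodic_def lattice_periodic_def)

lemma C1_periodic_scale:
  assumes f: "C1_periodic f f'" shows "C1_periodic (\<lambda>x. c * f x) (\<lambda>x. c *\<^sub>R f' x)"
  using C1_periodic_mult[OF C1_periodic_const[of c] f] by simp

lemma C1_periodic_sum:
  assumes "finite A" "\<And>a. a \<in> A \<Longrightarrow> C1_periodic (f a) (f' a)"
  shows "C1_periodic (\<lambda>x. \<Sum>a\<in>A. f a x) (\<lambda>x. \<Sum>a\<in>A. f' a x)"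
  using assms
proof (induction A rule: finite_induct)
  case (insert a A)
  then show ?case
    using C1_periodic_add[of "f a" "f' a" "\<lambda>x. \<Sum>a\<in>A. f a x" "\<lambda>x. \<Sum>a\<in>A. f' a x"] by simp
qed (simp add: C1_periodic_const)

lemma C1_periodic_translate:
  assumes f: "C1_periodic f f'" shows "C1_periodic (\<lambda>x. f (x + c)) (\<lambda>x. f' (x + c))"
  unfolding C1_periodic_def
proof (intro conjI allI)
  show "lattice_periodic (\<lambda>x. f (x + c))"
  proof (rule lattice_periodicI)
    fix x k :: "real^'a" assume "k \<in> int_lattice"
    then have "f ((x + c) + k) = f (x + c)" by (rule lattice_periodicD[OF C1_periodicD(1)[OF f]])
    then show "f (x + k + c) = f (x + c)" by (simp add: add.assoc add.commute[of k])
  qed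
  show "((\<lambda>x. f (x + c)) has_derivative (\<lambda>h. f' (x + c) \<bullet> h)) (at x)" for x
    by (rule has_derivative_compose[of "\<lambda>x. x + c" "\<lambda>h. h" x UNIV f "\<lambda>h. f' (x + c) \<bullet> h"])
       (auto intro!: derivative_eq_intros C1_periodicD(2)[OF f])
  show "continuous_on UNIV (\<lambda>x. f' (x + c))"
    by (rule continuous_on_compose2[OF C1_periodicD(3)[OF f]]) (auto intro!: continuous_intros)
qed

lemma torus_integral_by_parts:
  assumes f: "C1_periodic f f'" and g: "C1_periodic g g'"
  shows "(\<integral>x. f x * (g' x \<bullet> v) \<partial>torus) = - (\<integral>x. (f' x \<bullet> v) * g x \<partial>torus)"
proof -
  have per: "lattice_periodic (\<lambda>x. f x * (g' x \<bullet> v))" "lattice_periodic (\<lambda>x. (f' x \<bullet> v) * g x)"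
    by (intro lattice_periodicI, simp add: lattice_periodicD[OF C1_periodicD(1)[OF f]] lattice_periodicD[OF C1_periodicD(1)[OF g]]
        lattice_periodicD[OF C1_periodic_gradient_periodic[OF f]] lattice_periodicD[OF C1_periodic_gradient_periodic[OF g]])+
  have "integrable torus (\<lambda>x. f x * (g' x \<bullet> v))" "integrable torus (\<lambda>x. (f' x \<bullet> v) * g x)"
    by (intro torus_integrable_continuous per continuous_intros C1_periodicD(3,4)[OF f] C1_periodicD(3,4)[OF g])+
  then have "(\<integral>x. f x * (g' x \<bullet> v) \<partial>torus) + (\<integral>x. (f' x \<bullet> v) * g x \<partial>torus)
     = (\<integral>x. (f x *\<^sub>R g' x + g x *\<^sub>R f' x) \<bullet> v \<partial>torus)"
    by (subst Bochner_Integration.integral_add[symmetric]) (simp_all add: inner_add_left mult.commute)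
  also have "\<dots> = 0"
    by (rule torus_integral_derivative[OF C1_periodic_mult[OF f g]])
  finally show ?thesis by simp
qed

text \<open>Weak symmetry of second derivatives: moving a translation from one factor to the other
  avoids assuming that either function is twice differentiable.\<close>

lemma torus_integral_gradients_symmetric:
  assumes a: "C1_periodic a a'" and b: "C1_periodic b b'"
  shows "(\<integral>x. (a' x \<bullet> v) * (b' x \<bullet> w) \<partial>torus) = (\<integral>x. (a' x \<bullet> w) * (b' x \<bullet> v) \<partial>torus)"
proof -
  obtain A where A: "A > 0" "\<And>x. \<bar>a x\<bar> \<le> A" "\<And>x. norm (a' x) \<le> A" using C1_periodic_bounds[OF a] by metis
  obtain B where B: "B > 0" "\<And>x. \<bar>b x\<bar> \<le> B" "\<And>x. norm (b' x) \<le> B" using C1_periodic_bounds[OF b] by metis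
  note [measurable] = C1_periodic_measurable[OF a] C1_periodic_measurable[OF b]
  have bd: "\<bar>a' x \<bullet> v\<bar> \<le> A * norm v" "\<bar>a' x \<bullet> w\<bar> \<le> A * norm w" "\<bar>b' x \<bullet> v\<bar> \<le> B * norm v" "\<bar>b' x \<bullet> w\<bar> \<le> B * norm w" for x v w
    by (rule order_trans[OF Cauchy_Schwarz_ineq2], intro mult_right_mono A B norm_ge_zero)+
  have "((\<lambda>t. \<integral>x. (a' x \<bullet> v) * b (x + t *\<^sub>R w) \<partial>torus) has_real_derivative (\<integral>x. (a' x \<bullet> v) * (b' (x + 0 *\<^sub>R w) \<bullet> w) \<partial>torus)) (at 0)"
  proof (rule has_real_derivative_integral_dominated)
    show "((\<lambda>t. (a' x \<bullet> v) * b (x + t *\<^sub>R w)) has_real_derivative (a' x \<bullet> v) * (b' (x + t *\<^sub>R w) \<bullet> w)) (at t)" for x t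
      by (rule DERIV_cmult[OF C1_periodic_line_derivative[OF b]])
    show "\<bar>(a' x \<bullet> v) * (b' (x + t *\<^sub>R w) \<bullet> w)\<bar> \<le> (A * norm v) * (B * norm w)" for x t
      unfolding abs_mult by (intro mult_mono bd abs_ge_zero) (use A in simp)
    show "integrable torus (\<lambda>x. (a' x \<bullet> v) * b (x + t *\<^sub>R w))" for t
      by (rule torus_integrable_bounded[where B="(A * norm v) * B"])
         (use A B bd in \<open>simp_all add: abs_mult mult_mono\<close>)
  qed simp_all
  moreover have "((\<lambda>t. \<integral>x. - ((b' x \<bullet> v) * a (x + t *\<^sub>R (-w))) \<partial>torus) has_real_derivative (\<integral>x. - ((b' x \<bullet> v) * (a' (x + 0 *\<^sub>R (-w)) \<bullet> (-w))) \<partial>torus)) (at 0)"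
  proof (rule has_real_derivative_integral_dominated)
    show "((\<lambda>t. - ((b' x \<bullet> v) * a (x + t *\<^sub>R (-w)))) has_real_derivative - ((b' x \<bullet> v) * (a' (x + t *\<^sub>R (-w)) \<bullet> (-w)))) (at t)" for x t
      by (rule DERIV_minus[OF DERIV_cmult[OF C1_periodic_line_derivative[OF a]]])
    show "\<bar>- ((b' x \<bullet> v) * (a' (x + t *\<^sub>R (-w)) \<bullet> (-w)))\<bar> \<le> (B * norm v) * (A * norm (-w))" for x t
      unfolding abs_mult abs_minus_cancel by (intro mult_mono bd abs_ge_zero) (use B in simp)
    show "integrable torus (\<lambda>x. - ((b' x \<bullet> v) * a (x + t *\<^sub>R (-w))))" for t
      by (rule torus_integrable_bounded[where B="(B * norm v) * A"])
         (use A B bd in \<open>simp_all add: abs_mult mult_mono\<close>)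
  qed simp_all
  moreover have "(\<integral>x. (a' x \<bullet> v) * b (x + t *\<^sub>R w) \<partial>torus) = (\<integral>x. - ((b' x \<bullet> v) * a (x + t *\<^sub>R (-w))) \<partial>torus)" for t
  proof -
    have per: "lattice_periodic (\<lambda>x. (b' x \<bullet> v) * a (x + t *\<^sub>R (-w)))"
      by (intro lattice_periodicI) (simp only: lattice_periodicD[OF C1_periodic_gradient_periodic[OF b]]
          lattice_periodicD[OF C1_periodicD(1)[OF C1_periodic_translate[OF a, of "t *\<^sub>R (-w)"]]])
    have "(\<integral>x. (a' x \<bullet> v) * b (x + t *\<^sub>R w) \<partial>torus) = - (\<integral>x. a x * (b' (x + t *\<^sub>R w) \<bullet> v) \<partial>torus)"
      using torus_integral_by_parts[OF a C1_periodic_translate[OF b], of "t *\<^sub>R w" v] by simp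
    also have "(\<integral>x. a x * (b' (x + t *\<^sub>R w) \<bullet> v) \<partial>torus) = (\<integral>x. (b' (x + t *\<^sub>R w) \<bullet> v) * a (x + t *\<^sub>R w + t *\<^sub>R (-w)) \<partial>torus)"
      by (simp add: mult.commute)
    also have "\<dots> = (\<integral>x. (b' x \<bullet> v) * a (x + t *\<^sub>R (-w)) \<partial>torus)"
      by (rule torus_integral_translate[OF _ per]) simp
    finally show ?thesis by simp
  qed
  ultimately have "(\<integral>x. (a' x \<bullet> v) * (b' x \<bullet> w) \<partial>torus) = (\<integral>x. - ((b' x \<bullet> v) * (a' x \<bullet> (-w))) \<partial>torus)"
    by (simp add: DERIV_unique)
  then show ?thesis by (simp add: mult.commute)
qed

text \<open>The derivative falls on \<open>K\<close> alone, so integrability of \<open>w\<close>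
  suffices: multiples of \<open>|w|\<close> dominate all integrands.\<close>

lemma C1_periodic_convolution:
  assumes K: "C1_periodic K K'" and [measurable]: "w \<in> borel_measurable borel" and w: "integrable torus w"
  shows "C1_periodic (\<lambda>x. \<integral>z. K (x - z) * w z \<partial>torus) (\<lambda>x. \<integral>z. w z *\<^sub>R K' (x - z) \<partial>torus)"
  unfolding C1_periodic_def
proof (intro conjI allI)
  obtain B where B: "B > 0" "\<And>x. \<bar>K x\<bar> \<le> B" "\<And>x. norm (K' x) \<le> B" using C1_periodic_bounds[OF K] by metis
  note [measurable] = C1_periodic_measurable[OF K]
  have p: "K (x + k - z) = K (x - z)" if "k \<in> int_lattice" for x k z
    using lattice_periodicD[OF C1_periodicD(1)[OF K] that, of "x - z"] by (simp add: algebra_simps)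
  have nb: "norm (w z *\<^sub>R K' (x - z)) \<le> B * norm (w z)" for x z
    using mult_left_mono[OF B(3)[of "x - z"] abs_ge_zero[of "w z"]] by (simp add: mult.commute)
  show "lattice_periodic (\<lambda>x. \<integral>z. K (x - z) * w z \<partial>torus)"
    by (simp add: lattice_periodic_def p)
  show "((\<lambda>x. \<integral>z. K (x - z) * w z \<partial>torus) has_derivative (\<lambda>h. (\<integral>z. w z *\<^sub>R K' (x - z) \<partial>torus) \<bullet> h)) (at x)" for x
  proof (rule has_derivative_integral_dominated)
    show "((\<lambda>x. K (x - z) * w z) has_derivative (\<lambda>h. (w z *\<^sub>R K' (x - z)) \<bullet> h)) (at x)" for x z
      using has_derivative_mult_right[OF C1_periodicD(2)[OF C1_periodic_translate[OF K, of "- z"]], of "w z" x]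
      by (simp add: mult.commute)
    show "norm (w z *\<^sub>R K' (x - z)) \<le> B * norm (w z)" for x z
      by (rule nb)
    show "integrable torus (\<lambda>z. B * norm (w z))" using w by simp
    show "integrable torus (\<lambda>z. K (x - z) * w z)" for x
    proof (rule Bochner_Integration.integrable_bound)
      show "integrable torus (\<lambda>z. B * w z)" using w by simp
      have "\<bar>K (x - z)\<bar> * \<bar>w z\<bar> \<le> \<bar>B\<bar> * \<bar>w z\<bar>" for z
        using B(1) B(2)[of "x - z"] by (intro mult_right_mono) linarith+
      then show "AE z in torus. norm (K (x - z) * w z) \<le> norm (B * w z)"
        by (intro AE_I2) (simp only: real_norm_def abs_mult)
    qed simp
  qed simp
  show "continuous_on UNIV (\<lambda>x. \<integral>z. w z *\<^sub>R K' (x - z) \<partial>torus)"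
  proof (rule continuous_at_imp_continuous_on, intro ballI, unfold continuous_at_sequentially, intro allI impI)
    fix x :: "real^'a" and X assume X: "X \<longlonglongrightarrow> x"
    show "((\<lambda>x. \<integral>z. w z *\<^sub>R K' (x - z) \<partial>torus) \<circ> X) \<longlonglongrightarrow> (\<integral>z. w z *\<^sub>R K' (x - z) \<partial>torus)"
      unfolding o_def
    proof (rule integral_dominated_convergence)
      show "integrable torus (\<lambda>z. B * norm (w z))" using w by simp
      show "AE z in torus. norm (w z *\<^sub>R K' (X i - z)) \<le> B * norm (w z)" for i
        by (intro AE_I2 nb)
      show "AE z in torus. (\<lambda>i. w z *\<^sub>R K' (X i - z)) \<longlonglongrightarrow> w z *\<^sub>R K' (x - z)"
        by (intro AE_I2 tendsto_scaleR tendsto_const continuous_on_tendsto_compose[OF C1_periodicD(3)[OF K]]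
            tendsto_diff X) simp_all
    qed simp_all
  qed
qed

section \<open>A smooth approximate identity\<close>

lemma pderiv_eq:
  assumes "(f has_derivative F) (at x)"
  shows "pderiv j f x = F (axis j 1)"
  using frechet_derivative_at[OF assms] by (simp add: pderiv_def)

lemma Ck_Suc_imp: "Ck (Suc k) f \<Longrightarrow> Ck k f"
  by (induction k arbitrary: f) auto

lemma Ck_const: "Ck k (\<lambda>x::real^'n. c)"
proof (induction k arbitrary: c)
  case (Suc k)
  have "pderiv j (\<lambda>x::real^'n. c) = (\<lambda>x. 0)" for j
    by (rule ext) (subst pderiv_eq[OF has_derivative_const], simp)
  with Suc[of 0] show ?case by (simp add: differentiable_on_const)
qed simp

lemma Ck_add: "Ck k f \<Longrightarrow> Ck k g \<Longrightarrow> Ck k (\<lambda>x. f x + g x)"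
proof (induction k arbitrary: f g)
  case 0 then show ?case by (simp add: continuous_on_add)
next
  case (Suc k)
  then have d: "f differentiable at x" "g differentiable at x" for x
    by (auto simp: differentiable_on_def)
  have "pderiv j (\<lambda>x. f x + g x) = (\<lambda>x. pderiv j f x + pderiv j g x)" for j
    by (rule ext, subst pderiv_eq[OF has_derivative_add[OF frechet_derivative_works[THEN iffD1, OF d(1)] frechet_derivative_works[THEN iffD1, OF d(2)]]])
      (simp add: pderiv_def)
  then show ?case using Suc by (auto intro: continuous_on_add differentiable_on_add)
qed

lemma Ck_mult: "Ck k f \<Longrightarrow> Ck k g \<Longrightarrow> Ck k (\<lambda>x. f x * g x)"
proof (induction k arbitrary: f g)
  case 0 then show ?case by (simp add: continuous_on_mult)
next
  case (Suc k)
  then have d: "f differentiable at x" "g differentiable at x" for x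
    by (auto simp: differentiable_on_def)
  have "pderiv j (\<lambda>x. f x * g x) = (\<lambda>x. f x * pderiv j g x + pderiv j f x * g x)" for j
    by (rule ext, subst pderiv_eq[OF has_derivative_mult[OF frechet_derivative_works[THEN iffD1, OF d(1)] frechet_derivative_works[THEN iffD1, OF d(2)]]])
      (simp add: pderiv_def)
  moreover have "Ck k f" "Ck k g" using Suc.prems Ck_Suc_imp by blast+
  ultimately show ?case using Suc by (auto intro: continuous_on_mult differentiable_on_mult Ck_add)
qed

text \<open>Writing minus the sine as a cosine with phase advanced by \<open>pi/2\<close> keeps the
  partial derivatives, up to constants, in the same family, so the induction runs with
  \<open>b\<close> arbitrary.\<close>

lemma Ck_cos: "Ck k (\<lambda>x::real^'n. cos (c * x $ i + b))"
proof (induction k arbitrary: b)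
  case 0 then show ?case by (auto intro!: continuous_intros)
next
  case (Suc k)
  have d: "((\<lambda>x::real^'n. cos (c * x $ i + b)) has_derivative (\<lambda>h. - sin (c * x $ i + b) * (c * h $ i))) (at x)" for x
    by (auto intro!: derivative_eq_intros bounded_linear_imp_has_derivative bounded_linear_vec_nth)
  have "pderiv j (\<lambda>x. cos (c * x $ i + b)) = (\<lambda>x. (if i = j then c else 0) * cos (c * x $ i + (b + pi/2)))" for j
    by (rule ext, subst pderiv_eq[OF d]) (simp add: axis_def cos_add sin_add flip: add.assoc)
  then have "Ck k (pderiv j (\<lambda>x. cos (c * x $ i + b)))" for j
    by (simp only:) (intro Ck_mult Ck_const Suc)
  then show ?case using d
    by (auto intro!: continuous_intros simp: differentiable_on_def differentiable_def)
qed

lemma Ck_prod: "finite A \<Longrightarrow> (\<And>a. a \<in> A \<Longrightarrow> Ck k (f a)) \<Longrightarrow> Ck k (\<lambda>x. \<Prod>a\<in>A. f a x)"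
  by (induction A rule: finite_induct) (simp_all add: Ck_const Ck_mult)

lemma Ck_power: "Ck k f \<Longrightarrow> Ck k (\<lambda>x. f x ^ m)"
  by (induction m) (simp_all add: Ck_const Ck_mult)

lemma smooth_C1_periodic:
  assumes "smooth_fun f" "periodic_fun f"
  shows "C1_periodic f (\<lambda>x. \<chi> j. pderiv j f x)"
  unfolding C1_periodic_def
proof (intro conjI allI)
  have C: "Ck (Suc 0) f" using assms by (auto simp: smooth_fun_def)
  show "lattice_periodic f" using assms by (simp add: periodic_fun_iff)
  show "continuous_on UNIV (\<lambda>x. \<chi> j. pderiv j f x)"
    using C by (intro continuous_on_vec_lambda) auto
  fix x :: "real^'a"
  have d: "(f has_derivative frechet_derivative f (at x)) (at x)"
    using C by (auto simp: differentiable_on_def frechet_derivative_works)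
  have "frechet_derivative f (at x) h = (\<chi> j. pderiv j f x) \<bullet> h" for h
  proof -
    have "frechet_derivative f (at x) h = frechet_derivative f (at x) (\<Sum>j\<in>UNIV. h $ j *\<^sub>R axis j 1)"
      by (simp add: basis_expansion flip: scalar_mult_eq_scaleR)
    also have "\<dots> = (\<Sum>j\<in>UNIV. h $ j * pderiv j f x)"
      using has_derivative_linear[OF d] by (simp add: linear_sum linear_cmul pderiv_def)
    finally show ?thesis by (simp add: inner_vec_def mult.commute)
  qed
  then show "(f has_derivative (\<lambda>h. (\<chi> j. pderiv j f x) \<bullet> h)) (at x)"
    using d by (metis (no_types, lifting) ext)
qed

text \<open>Each factor is the square of \<open>cos (pi * x $ i)\<close>, so the powers are, up to
  normalisation, products of de la Vallee Poussin kernels. As trigonometric polynomials they are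
  smooth and periodic with no gluing, and the maximum \<open>1\<close> is attained exactly on the
  lattice, where high powers concentrate.\<close>

definition cos_bump :: "real^'n \<Rightarrow> real" where
  "cos_bump x = (\<Prod>i\<in>UNIV. (1 + cos (2 * pi * x $ i)) / 2)"

lemma cos_bump_factor: "0 \<le> 1 + cos t" "1 + cos t \<le> (2::real)"
  using cos_ge_minus_one[of t] cos_le_one[of t] by linarith+

lemma cos_bump_bounds: "0 \<le> cos_bump x" "cos_bump x \<le> 1"
  unfolding cos_bump_def by (auto intro!: prod_nonneg prod_le_1 simp: cos_bump_factor)

lemma cos_bump_minus: "cos_bump (- x) = cos_bump x"
  by (simp add: cos_bump_def)

lemma cos_bump_periodic: "lattice_periodic cos_bump"
proof (rule lattice_periodicI)
  fix x k :: "real^'n" assume k: "k \<in> int_lattice"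
  have "cos (2 * pi * (x + k) $ i) = cos (2 * pi * x $ i)" for i
  proof -
    obtain n where n: "k $ i = of_int n" using k by (auto simp: int_lattice_def elim!: Ints_cases)
    show ?thesis by (simp add: n distrib_left cos_add mult.assoc[symmetric])
  qed
  then show "cos_bump (x + k) = cos_bump x" by (simp only: cos_bump_def)
qed

text \<open>No factor exceeds \<open>1\<close>, so a product equal to \<open>1\<close> forces each
  cosine to be \<open>1\<close>.\<close>

lemma cos_bump_eq_1:
  assumes "cos_bump x = 1" shows "x \<in> int_lattice"
  unfolding int_lattice_def
proof (intro CollectI allI)
  fix i
  have "cos_bump x = (1 + cos (2 * pi * x $ i)) / 2 * (\<Prod>i\<in>UNIV - {i}. (1 + cos (2 * pi * x $ i)) / 2)"
    unfolding cos_bump_def by (simp add: prod.remove[of UNIV i])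
  also have "\<dots> \<le> (1 + cos (2 * pi * x $ i)) / 2 * 1"
    by (intro mult_left_mono prod_le_1) (auto simp: cos_bump_factor)
  finally have "cos (2 * pi * x $ i) = 1" using assms cos_le_one[of "2 * pi * x $ i"] by simp
  then obtain n :: int where "2 * pi * x $ i = of_int n * 2 * pi" by (auto simp: cos_one_2pi_int)
  then show "x $ i \<in> \<int>" by simp
qed

lemma cos_bump_continuous: "continuous_on UNIV cos_bump"
  unfolding cos_bump_def by (intro continuous_intros) simp

lemma cos_bump_measurable [measurable]: "cos_bump \<in> borel_measurable borel"
  by (rule borel_measurable_continuous_onI[OF cos_bump_continuous])

lemma smooth_cos_bump_power: "smooth_fun (\<lambda>z. a * cos_bump (x - z) ^ m)"
  unfolding smooth_fun_def
proof
  fix k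
  have "cos_bump (x - z) = (\<Prod>i\<in>UNIV. (1 + cos ((- 2 * pi) * z $ i + 2 * pi * x $ i)) * (1/2))" for z
    unfolding cos_bump_def by (rule prod.cong) (simp_all add: right_diff_distrib)
  then show "Ck k (\<lambda>z. a * cos_bump (x - z) ^ m)"
    by (simp only: , intro Ck_mult Ck_const Ck_power Ck_prod Ck_add Ck_cos finite)
qed

definition torus_kernel :: "nat \<Rightarrow> real^'n \<Rightarrow> real" where
  "torus_kernel m x = (1 / (\<integral>z. cos_bump z ^ m \<partial>(torus :: (real^'n) measure))) * cos_bump x ^ m"

lemma torus_kernel_minus: "torus_kernel m (- x) = torus_kernel m x"
  by (simp add: torus_kernel_def cos_bump_minus)

lemma torus_kernel_periodic: "lattice_periodic (torus_kernel m)"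
  by (intro lattice_periodicI) (simp add: torus_kernel_def lattice_periodicD[OF cos_bump_periodic])

text \<open>For fixed \<open>x\<close> the kernel as a function of \<open>z\<close> is an admissible
  test function. Closedness, which is known only against test functions, thereby passes to the
  convolution at every point \<open>x\<close>.\<close>

lemma torus_kernel_reflected:
  "smooth_fun (\<lambda>z. torus_kernel m (x - z))" "periodic_fun (\<lambda>z. torus_kernel m (x - z))"
proof -
  show "smooth_fun (\<lambda>z. torus_kernel m (x - z))"
    unfolding torus_kernel_def by (rule smooth_cos_bump_power)
  show "periodic_fun (\<lambda>z. torus_kernel m (x - z))"
    unfolding periodic_fun_iff
  proof (rule lattice_periodicI)
    fix z k :: "real^'a" assume "k \<in> int_lattice"
    then show "torus_kernel m (x - (z + k)) = torus_kernel m (x - z)"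
      using lattice_periodicD[OF torus_kernel_periodic, of "- k" m "x - z"] by (simp add: algebra_simps)
  qed
qed

lemma torus_kernel_C1: "\<exists>K'. C1_periodic (torus_kernel m) K'"
  using smooth_C1_periodic[OF torus_kernel_reflected, of m 0] by (auto simp: torus_kernel_minus)

lemma torus_kernel_measurable [measurable]: "torus_kernel m \<in> borel_measurable borel"
  unfolding torus_kernel_def by measurable

lemma cos_bump_power_integrable: "integrable torus (\<lambda>z. cos_bump z ^ m)"
  by (rule torus_integrable_bounded[where B=1]) (auto simp: cos_bump_bounds power_le_one)

text \<open>The function exceeds \<open>p\<close> on a box of positive measure near the origin, so
  the mass of its powers decays no faster than the geometric rate \<open>p\<close>, for any
  \<open>p < 1\<close>.\<close>

lemma cos_bump_mass_bound:
  fixes p :: real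
  assumes "0 \<le> p" "p < 1"
  obtains c where "c > 0" "\<And>m. c * p ^ m \<le> (\<integral>z. cos_bump z ^ m \<partial>(torus :: (real^'n) measure))"
proof -
  have "cos_bump (0 :: real^'n) = 1" by (simp add: cos_bump_def)
  then have "cos_bump (0 :: real^'n) \<in> {p<..}" using assms by simp
  moreover have "open (cos_bump -` {p<..} :: (real^'n) set)"
    using cos_bump_continuous by (intro open_vimage) auto
  ultimately obtain e where e: "e > 0" "\<And>z::real^'n. norm z < e \<Longrightarrow> p < cos_bump z"
    unfolding open_contains_ball by (force simp: subset_eq)
  \<comment> \<open>Small enough for the box to lie in the cell and, since the norm is at most the
    sum of the \<open>CARD('n)\<close> coordinates, in the ball of radius \<open>e\<close>.\<close>
  define s where "s = min (1/2) (e / (2 * CARD('n)))"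
  have s: "0 < s" "s < 1" "CARD('n) * s < e"
    using e(1) by (auto simp: s_def min_def field_simps)
  let ?V = "box 0 (s *\<^sub>R 1) :: (real^'n) set"
  have V1: "?V \<subseteq> unit_cell"
  proof
    fix x assume "x \<in> ?V"
    then have "0 < x $ i" "x $ i < s" for i by (simp_all add: mem_box_cart)
    with s(2) show "x \<in> unit_cell" by (auto simp: unit_cell_def less_imp_le intro: less_trans)
  qed
  have V2: "p < cos_bump z" if "z \<in> ?V" for z
  proof (rule e)
    have "norm z \<le> (\<Sum>i\<in>UNIV. \<bar>z $ i\<bar>)" by (rule norm_le_l1_cart)
    also have "\<dots> \<le> (\<Sum>i\<in>(UNIV::'n set). s)"
      using that by (intro sum_mono) (auto simp: mem_box_cart less_imp_le)
    finally show "norm z < e" using s by simp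
  qed
  have mV: "measure torus ?V > 0"
  proof -
    have pos: "\<forall>b\<in>Basis. 0 < (s *\<^sub>R 1 :: real^'n) \<bullet> b" using s by (auto simp: Basis_vec_def inner_axis)
    then have "emeasure lborel ?V = ennreal (\<Prod>b\<in>Basis. (s *\<^sub>R 1 :: real^'n) \<bullet> b)"
      by (simp add: emeasure_lborel_box_eq less_imp_le)
    moreover have "(\<Prod>b\<in>Basis. (s *\<^sub>R 1 :: real^'n) \<bullet> b) > 0" using pos by (intro prod_pos) auto
    ultimately have "emeasure lborel ?V \<noteq> 0" by (metis ennreal_eq_0_iff not_le)
    moreover have "emeasure torus ?V = emeasure lborel ?V"
      using V1 by (simp add: torus_def emeasure_density Int_absorb1 flip: indicator_inter_arith)
    ultimately show ?thesis
      by (metis ennreal_0 measure_nonneg order_le_less torus.emeasure_eq_measure)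
  qed
  show thesis
  proof
    show "measure torus ?V > 0" by fact
    fix m
    have "measure torus ?V * p ^ m = (\<integral>z. indicator ?V z * p ^ m \<partial>torus)" by simp
    also have "\<dots> \<le> (\<integral>z. cos_bump z ^ m \<partial>(torus :: (real^'n) measure))"
    proof (rule integral_mono)
      show "integrable torus (\<lambda>z. indicator ?V z * p ^ m)"
        by (intro integrable_mult_left) (simp add: torus.emeasure_finite less_top[symmetric])
      show "indicator ?V z * p ^ m \<le> cos_bump z ^ m" for z
        using V2[of z] assms by (auto split: split_indicator intro!: power_mono simp: cos_bump_bounds)
    qed (rule cos_bump_power_integrable)
    finally show "measure torus ?V * p ^ m \<le> (\<integral>z. cos_bump z ^ m \<partial>(torus :: (real^'n) measure))" .
  qed
qed

lemma cos_bump_mass_pos: "0 < (\<integral>z. cos_bump z ^ m \<partial>(torus :: (real^'n) measure))"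
proof -
  obtain c :: real where "c > 0" "c * (1/2) ^ m \<le> (\<integral>z. cos_bump z ^ m \<partial>(torus :: (real^'n) measure))"
    using cos_bump_mass_bound[of "1/2", where 'n='n] by auto
  then show ?thesis
    by (meson less_le_trans mult_pos_pos zero_less_power half_gt_zero zero_less_one)
qed

lemma torus_kernel_nonneg: "0 \<le> torus_kernel m x"
  unfolding torus_kernel_def using cos_bump_mass_pos[of m, where 'n='a]
  by (auto simp: cos_bump_bounds intro!: mult_nonneg_nonneg divide_nonneg_nonneg)

lemma torus_kernel_integrable: "integrable torus (torus_kernel m)"
  unfolding torus_kernel_def by (intro integrable_mult_right cos_bump_power_integrable)

lemma torus_kernel_mass: "(\<integral>z. torus_kernel m z \<partial>(torus :: (real^'n) measure)) = 1"
  unfolding torus_kernel_def using cos_bump_mass_pos[of m, where 'n='n] by simp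

lemma cos_bump_away:
  assumes "d > 0"
  obtains q where "0 \<le> q" "q < 1" "\<And>z :: real^'n. d \<le> infdist z int_lattice \<Longrightarrow> z \<in> unit_cell \<Longrightarrow> cos_bump z \<le> q"
proof -
  \<comment> \<open>The region away from the lattice is unbounded; cutting it with a ball around the
    cell makes it compact, so that \<open>cos_bump\<close> attains its maximum there.\<close>
  define C where "C = {z :: real^'n. d \<le> infdist z int_lattice} \<inter> cball 0 (CARD('n))"
  have "closed {z :: real^'n. d \<le> infdist z int_lattice}"
    by (intro closed_Collect_le continuous_intros)
  then have C: "compact C" unfolding C_def by (intro closed_Int_compact) auto
  have sub: "z \<in> C" if "d \<le> infdist z int_lattice" "z \<in> unit_cell" for z
    using that norm_unit_cell_le[of z] by (simp add: C_def)
  show thesis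
  proof (cases "C = {}")
    case True then show ?thesis using sub by (intro that[of 0]) auto
  next
    case False
    then obtain z0 where z0: "z0 \<in> C" "\<And>z. z \<in> C \<Longrightarrow> cos_bump z \<le> cos_bump z0"
      using continuous_attains_sup[OF C False, of cos_bump] continuous_on_subset[OF cos_bump_continuous] by auto
    have "cos_bump z0 \<noteq> 1"
      using z0(1) assms cos_bump_eq_1[of z0] by (auto simp: C_def infdist_zero)
    then show ?thesis using z0 sub cos_bump_bounds[of z0] by (intro that[of "cos_bump z0"]) auto
  qed
qed

text \<open>Away from the lattice the powers are at most \<open>q ^ m\<close>, while their mass is
  at least a multiple of \<open>p ^ m\<close>; any \<open>p\<close> strictly between
  \<open>q\<close> and \<open>1\<close> gives geometric decay of the quotient.\<close>

lemma torus_kernel_concentrates: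
  assumes "d > 0"
  shows "(\<lambda>m. \<integral>z. torus_kernel m z * indicator {z. d \<le> infdist z int_lattice} z \<partial>(torus :: (real^'n) measure)) \<longlonglongrightarrow> 0"
proof -
  obtain q where q: "0 \<le> q" "q < 1" "\<And>z :: real^'n. d \<le> infdist z int_lattice \<Longrightarrow> z \<in> unit_cell \<Longrightarrow> cos_bump z \<le> q"
    using cos_bump_away[OF assms] by metis
  define p where "p = (1 + q) / 2"
  have p: "0 < p" "p < 1" "q < p" using q by (auto simp: p_def)
  obtain c where c: "c > 0" "\<And>m. c * p ^ m \<le> (\<integral>z. cos_bump z ^ m \<partial>(torus :: (real^'n) measure))"
    using cos_bump_mass_bound[of p, where 'n='n] p by (metis less_imp_le)
  let ?S = "{z :: real^'n. d \<le> infdist z int_lattice}"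
  have "closed ?S" by (intro closed_Collect_le continuous_intros)
  then have [measurable]: "?S \<in> sets borel" by simp
  show ?thesis
  proof (rule tendsto_sandwich[OF always_eventually always_eventually tendsto_const])
    show "(\<lambda>m. (q / p) ^ m / c) \<longlonglongrightarrow> 0"
      using p q by (intro tendsto_divide_zero LIMSEQ_power_zero) auto
    show "\<forall>m. 0 \<le> (\<integral>z. torus_kernel m z * indicator ?S z \<partial>torus)"
      by (auto intro!: Bochner_Integration.integral_nonneg mult_nonneg_nonneg torus_kernel_nonneg)
    show "\<forall>m. (\<integral>z. torus_kernel m z * indicator ?S z \<partial>torus) \<le> (q / p) ^ m / c"
    proof
      fix m
      have "(\<integral>z. torus_kernel m z * indicator ?S z \<partial>torus) \<le> (\<integral>z. (q / p) ^ m / c \<partial>(torus :: (real^'n) measure))"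
      proof (rule integral_mono_AE)
        show "integrable torus (\<lambda>z. torus_kernel m z * indicator ?S z)"
          using torus_kernel_integrable by (rule integrable_real_mult_indicator[rotated]) simp
        have "torus_kernel m z * indicator ?S z \<le> (q / p) ^ m / c" if z: "z \<in> unit_cell" for z
        proof (cases "z \<in> ?S")
          case True
          have "torus_kernel m z = cos_bump z ^ m / (\<integral>z. cos_bump z ^ m \<partial>(torus :: (real^'n) measure))"
            by (simp add: torus_kernel_def)
          also have "\<dots> \<le> q ^ m / (c * p ^ m)"
            using True z q c p by (intro frac_le power_mono zero_le_power) (auto simp: cos_bump_bounds)
          also have "\<dots> = (q / p) ^ m / c" by (simp add: power_divide)
          finally show ?thesis using True by simp
        qed (use p q c in simp)
        then show "AE z in torus. torus_kernel m z * indicator ?S z \<le> (q / p) ^ m / c"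
          unfolding torus_def by (subst AE_density) (auto split: split_indicator)
      qed simp
      also have "\<dots> = (q / p) ^ m / c" by simp
      finally show "(\<integral>z. torus_kernel m z * indicator ?S z \<partial>torus) \<le> (q / p) ^ m / c" .
    qed
  qed
qed

lemma torus_convolution_shift:
  fixes b :: "real^'n \<Rightarrow> real"
  assumes b: "lattice_periodic b" and [measurable]: "b \<in> borel_measurable borel"
  shows "(\<integral>z. torus_kernel m (x - z) * b z \<partial>torus) = (\<integral>z. torus_kernel m z * b (x + z) \<partial>torus)"
proof -
  have "(\<integral>z. torus_kernel m (x - z) * b z \<partial>torus) = (\<integral>z. torus_kernel m (x - (z + x)) * b (z + x) \<partial>torus)"
  proof (rule torus_integral_translate[symmetric])
    show "lattice_periodic (\<lambda>z. torus_kernel m (x - z) * b z)"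
      using torus_kernel_reflected(2)[of m x] lattice_periodicD[OF b]
      by (intro lattice_periodicI) (simp add: periodic_fun_iff lattice_periodicD[of "\<lambda>z. torus_kernel m (x - z)"])
  qed simp
  also have "\<dots> = (\<integral>z. torus_kernel m z * b (x + z) \<partial>torus)"
    by (simp add: torus_kernel_minus add.commute)
  finally show ?thesis .
qed

lemma torus_kernel_approximates:
  fixes b :: "real^'n \<Rightarrow> real"
  assumes cont: "continuous_on UNIV b" and per: "lattice_periodic b" and "e > 0"
  shows "\<forall>\<^sub>F m in sequentially. \<forall>x. \<bar>(\<integral>z. torus_kernel m (x - z) * b z \<partial>torus) - b x\<bar> \<le> e"
proof -
  obtain B where B: "B > 0" "\<And>x. norm (b x) \<le> B" using periodic_continuous_bounded[OF cont per] by metis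
  have e2: "e / 2 > 0" using \<open>e > 0\<close> by simp
  obtain d where d: "d > 0" "\<And>x y. norm (x - y) < d \<Longrightarrow> norm (b x - b y) < e / 2"
    using periodic_continuous_uniformly[OF cont per e2] by metis
  let ?S = "{z :: real^'n. d \<le> infdist z int_lattice}"
  have "closed ?S" by (intro closed_Collect_le continuous_intros)
  then have [measurable]: "?S \<in> sets borel" by simp
  have [measurable]: "b \<in> borel_measurable borel" using cont by (rule borel_measurable_continuous_onI)
  \<comment> \<open>If \<open>z\<close> is within \<open>d\<close> of a lattice point
    \<open>l\<close>, periodicity replaces it by \<open>z - l\<close> and uniform continuity
    applies; elsewhere only the sup bound \<open>B\<close> is available.\<close>
  have bd: "\<bar>b (x + z) - b x\<bar> \<le> e / 2 + 2 * B * indicator ?S z" for x z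
  proof (cases "z \<in> ?S")
    case True
    then show ?thesis using B(2)[of "x + z"] B(2)[of x] \<open>e > 0\<close> by (simp add: abs_le_iff)
  next
    case False
    have "int_lattice \<noteq> ({} :: (real^'n) set)" using zero_in_int_lattice by blast
    then obtain l where l: "l \<in> int_lattice" "dist z l < d"
      using infdist_attains_inf[OF closed_int_lattice, of z] False by (metis mem_Collect_eq not_le)
    have "norm (b (x + (z - l)) - b x) < e / 2" using l(2) by (intro d) (simp add: dist_norm)
    moreover have "b (x + (z - l)) = b (x + z)"
      using lattice_periodicD[OF per, of "- l" "x + z"] l(1) by (simp add: algebra_simps)
    ultimately show ?thesis using False by simp
  qed
  have "\<forall>\<^sub>F m in sequentially. (\<integral>z. torus_kernel m z * indicator ?S z \<partial>torus) < e / (4 * B)"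
    using torus_kernel_concentrates[OF d(1)] B(1) \<open>e > 0\<close> by (intro order_tendstoD(2)) auto
  then show ?thesis
  proof (rule eventually_mono, intro allI)
    \<comment> \<open>The bound \<open>e / (4 * B)\<close> makes the part away from the lattice
      contribute at most \<open>2 * B * (e / (4 * B)) = e / 2\<close>.\<close>
    fix m x assume m: "(\<integral>z. torus_kernel m z * indicator ?S z \<partial>torus) < e / (4 * B)"
    have i1: "integrable torus (\<lambda>z. torus_kernel m z * b (x + z))"
      by (rule Bochner_Integration.integrable_bound[of _ "\<lambda>z. B * torus_kernel m z"])
         (use B torus_kernel_integrable in \<open>auto simp: abs_mult mult.commute[of B] intro!: mult_left_mono\<close>)
    have i2: "integrable torus (\<lambda>z. torus_kernel m z * indicator ?S z)"
      using torus_kernel_integrable by (rule integrable_real_mult_indicator[rotated]) simp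
    have "(\<integral>z. torus_kernel m (x - z) * b z \<partial>torus) - b x
        = (\<integral>z. torus_kernel m z * b (x + z) \<partial>torus) - (\<integral>z. torus_kernel m z * b x \<partial>(torus :: (real^'n) measure))"
      using torus_kernel_mass[of m, where 'n='n] by (simp add: torus_convolution_shift[OF per])
    also have "\<dots> = (\<integral>z. torus_kernel m z * (b (x + z) - b x) \<partial>torus)"
      using i1 torus_kernel_integrable[of m, where 'a='n] by (simp add: right_diff_distrib)
    finally have "\<bar>(\<integral>z. torus_kernel m (x - z) * b z \<partial>torus) - b x\<bar> \<le> (\<integral>z. \<bar>torus_kernel m z * (b (x + z) - b x)\<bar> \<partial>torus)"
      using integral_abs_bound by metis
    also have "\<dots> \<le> (\<integral>z. e / 2 * torus_kernel m z + 2 * B * (torus_kernel m z * indicator ?S z) \<partial>torus)"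
    proof (rule integral_mono)
      show "integrable torus (\<lambda>z. \<bar>torus_kernel m z * (b (x + z) - b x)\<bar>)"
        using i1 torus_kernel_integrable[of m, where 'a='n] by (intro integrable_abs) (simp add: right_diff_distrib)
      show "integrable torus (\<lambda>z. e / 2 * torus_kernel m z + 2 * B * (torus_kernel m z * indicator ?S z))"
        using i2 torus_kernel_integrable by (intro Bochner_Integration.integrable_add integrable_mult_right)
      fix z :: "real^'n"
      have "torus_kernel m z * \<bar>b (x + z) - b x\<bar> \<le> torus_kernel m z * (e / 2 + 2 * B * indicator ?S z)"
        by (intro mult_left_mono bd torus_kernel_nonneg)
      then show "\<bar>torus_kernel m z * (b (x + z) - b x)\<bar> \<le> e / 2 * torus_kernel m z + 2 * B * (torus_kernel m z * indicator ?S z)"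
        unfolding abs_mult by (simp add: torus_kernel_nonneg distrib_left mult_ac)
    qed
    also have "\<dots> = e / 2 + 2 * B * (\<integral>z. torus_kernel m z * indicator ?S z \<partial>torus)"
      using i2 torus_kernel_integrable[of m, where 'a='n] torus_kernel_mass[of m, where 'n='n]
      by (subst Bochner_Integration.integral_add) auto
    also have "\<dots> \<le> e"
    proof -
      have "2 * B * (\<integral>z. torus_kernel m z * indicator ?S z \<partial>torus) \<le> 2 * B * (e / (4 * B))"
        using m B(1) by (intro mult_left_mono) auto
      then show ?thesis using B(1) by simp
    qed
    finally show "\<bar>(\<integral>z. torus_kernel m (x - z) * b z \<partial>torus) - b x\<bar> \<le> e" .
  qed
qed

section \<open>The flow of a rank-one displacement\<close>

text \<open>The differential of the displaced map is
  \<open>h \<mapsto> h + (e' x \<bullet> h) *\<^sub>R y\<close>; its second term produces the extra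
  multiple of \<open>e' x\<close> in the gradient.\<close>

lemma C1_periodic_pullback:
  assumes f: "C1_periodic f f'" and e: "C1_periodic e e'"
  shows "C1_periodic (\<lambda>x. f (x + e x *\<^sub>R y)) (\<lambda>x. f' (x + e x *\<^sub>R y) + (f' (x + e x *\<^sub>R y) \<bullet> y) *\<^sub>R e' x)"
  unfolding C1_periodic_def
proof (intro conjI allI)
  show "lattice_periodic (\<lambda>x. f (x + e x *\<^sub>R y))"
  proof (rule lattice_periodicI)
    fix x k :: "real^'a" assume k: "k \<in> int_lattice"
    have "f (x + k + e (x + k) *\<^sub>R y) = f ((x + e x *\<^sub>R y) + k)"
      using lattice_periodicD[OF C1_periodicD(1)[OF e] k, of x] by (simp add: add.assoc add.commute[of k])
    then show "f (x + k + e (x + k) *\<^sub>R y) = f (x + e x *\<^sub>R y)"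
      using lattice_periodicD[OF C1_periodicD(1)[OF f] k] by simp
  qed
  show "((\<lambda>x. f (x + e x *\<^sub>R y)) has_derivative (\<lambda>h. (f' (x + e x *\<^sub>R y) + (f' (x + e x *\<^sub>R y) \<bullet> y) *\<^sub>R e' x) \<bullet> h)) (at x)" for x
  proof -
    have "((\<lambda>x. x + e x *\<^sub>R y) has_derivative (\<lambda>h. h + (e' x \<bullet> h) *\<^sub>R y)) (at x)"
      by (intro has_derivative_add has_derivative_ident has_derivative_scaleR_left C1_periodicD(2)[OF e])
    from has_derivative_compose[OF this C1_periodicD(2)[OF f]]
    show ?thesis by (simp add: inner_add_left inner_add_right mult.commute)
  qed
  have c: "continuous_on UNIV (\<lambda>x. x + e x *\<^sub>R y)"
    by (intro continuous_intros C1_periodicD(4)[OF e])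
  have "continuous_on UNIV (\<lambda>x. f' (x + e x *\<^sub>R y))"
    by (rule continuous_on_compose2[OF C1_periodicD(3)[OF f] c]) simp
  then show "continuous_on UNIV (\<lambda>x. f' (x + e x *\<^sub>R y) + (f' (x + e x *\<^sub>R y) \<bullet> y) *\<^sub>R e' x)"
    by (intro continuous_intros C1_periodicD(3)[OF e])
qed

text \<open>The volume form is preserved along the flow because the derivative in time of
  the integrand is a divergence. The time parameter is sin t, so that it stays bounded.\<close>

lemma flow_volume_C1:
  fixes f :: "real^'n \<Rightarrow> real"
  assumes f: "C1_periodic f f'" and e: "C1_periodic e e'"
  shows "(\<integral>x. f (x + e x *\<^sub>R y) * (1 + e' x \<bullet> y) \<partial>torus) = (\<integral>x. f x \<partial>torus)"
proof -
  obtain A where A: "A > 0" "\<And>x. \<bar>f x\<bar> \<le> A" "\<And>x. norm (f' x) \<le> A" using C1_periodic_bounds[OF f] by metis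
  obtain B where B: "B > 0" "\<And>x. \<bar>e x\<bar> \<le> B" "\<And>x. norm (e' x) \<le> B" using C1_periodic_bounds[OF e] by metis
  note [measurable] = C1_periodic_measurable[OF f] C1_periodic_measurable[OF e]
  define P where "P s x = x + (s * e x) *\<^sub>R y" for s x
  have [measurable]: "P s \<in> borel_measurable borel" for s unfolding P_def by measurable
  define G where "G t x = f (P (sin t) x) * (1 + sin t * (e' x \<bullet> y))" for t x
  define G' where "G' t x = cos t * ((e x * (f' (P (sin t) x) \<bullet> y)) * (1 + sin t * (e' x \<bullet> y)) + f (P (sin t) x) * (e' x \<bullet> y))" for t x
  have b1: "\<bar>e' x \<bullet> y\<bar> \<le> B * norm y" for x
    by (rule order_trans[OF Cauchy_Schwarz_ineq2]) (intro mult_right_mono B norm_ge_zero)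
  have b2: "\<bar>f' x \<bullet> y\<bar> \<le> A * norm y" for x
    by (rule order_trans[OF Cauchy_Schwarz_ineq2]) (intro mult_right_mono A norm_ge_zero)
  have b3: "\<bar>1 + sin t * (e' x \<bullet> y)\<bar> \<le> 1 + B * norm y" for t x
  proof -
    have "\<bar>sin t * (e' x \<bullet> y)\<bar> \<le> 1 * (B * norm y)"
      unfolding abs_mult by (intro mult_mono b1 abs_sin_le_one) auto
    then show ?thesis by linarith
  qed
  have "((\<lambda>t. \<integral>x. G t x \<partial>torus) has_real_derivative (\<integral>x. G' t x \<partial>torus)) (at t)" for t
  proof (rule has_real_derivative_integral_dominated)
    fix t x
    have "((\<lambda>t. f (x + (sin t) *\<^sub>R (e x *\<^sub>R y))) has_real_derivative (f' (x + sin t *\<^sub>R (e x *\<^sub>R y)) \<bullet> (e x *\<^sub>R y)) * cos t) (at t)"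
      by (rule DERIV_chain2[OF C1_periodic_line_derivative[OF f] DERIV_sin])
    moreover have "((\<lambda>t. 1 + sin t * (e' x \<bullet> y)) has_real_derivative cos t * (e' x \<bullet> y)) (at t)"
      by (auto intro!: derivative_eq_intros)
    ultimately have "((\<lambda>t. f (x + (sin t) *\<^sub>R (e x *\<^sub>R y)) * (1 + sin t * (e' x \<bullet> y))) has_real_derivative G' t x) (at t)"
      by (rule DERIV_cong[OF DERIV_mult]) (simp add: G'_def P_def algebra_simps)
    then show "((\<lambda>t. G t x) has_real_derivative G' t x) (at t)" by (simp add: G_def P_def)
    have "\<bar>G' t x\<bar> \<le> 1 * (((B * (A * norm y)) * (1 + B * norm y)) + A * (B * norm y))"
      unfolding G'_def abs_mult
    proof (rule mult_mono)
      show "\<bar>(e x * (f' (P (sin t) x) \<bullet> y)) * (1 + sin t * (e' x \<bullet> y)) + f (P (sin t) x) * (e' x \<bullet> y)\<bar>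
          \<le> ((B * (A * norm y)) * (1 + B * norm y)) + A * (B * norm y)"
        by (rule order_trans[OF abs_triangle_ineq], unfold abs_mult)
           (intro add_mono mult_mono b1 b2 b3 A B abs_ge_zero mult_nonneg_nonneg norm_ge_zero less_imp_le[OF A(1)] less_imp_le[OF B(1)])
    qed auto
    then show "\<bar>G' t x\<bar> \<le> ((B * (A * norm y)) * (1 + B * norm y)) + A * (B * norm y)" by simp
  next
    show "integrable torus (G t)" for t
    proof (rule torus_integrable_bounded)
      show "norm (G t x) \<le> A * (1 + B * norm y)" for x
        unfolding G_def real_norm_def abs_mult by (intro mult_mono A b3 abs_ge_zero less_imp_le[OF A(1)])
    qed (unfold G_def, measurable)
    show "G' t \<in> borel_measurable torus" for t unfolding G'_def by measurable
  qed simp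
  moreover have "(\<integral>x. G' t x \<partial>torus) = 0" for t
  proof -
    \<comment> \<open>The vector field is \<open>e x * f (P ?s x)\<close> times \<open>y\<close>;
      its divergence is the derivative of this scalar factor in direction \<open>y\<close>, and
      \<open>G'\<close> is \<open>cos t\<close> times that.\<close>
    let ?s = "sin t"
    note F = C1_periodic_pullback[OF f C1_periodic_scale[OF e, of ?s], of y]
    have "(\<integral>x. (f (P ?s x) *\<^sub>R e' x + e x *\<^sub>R (f' (P ?s x) + (f' (P ?s x) \<bullet> y) *\<^sub>R (?s *\<^sub>R e' x))) \<bullet> y \<partial>torus) = 0"
      using torus_integral_derivative[OF C1_periodic_mult[OF F e], of y] by (simp add: P_def)
    moreover have "(f (P ?s x) *\<^sub>R e' x + e x *\<^sub>R (f' (P ?s x) + (f' (P ?s x) \<bullet> y) *\<^sub>R (?s *\<^sub>R e' x))) \<bullet> y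
       = (e x * (f' (P ?s x) \<bullet> y)) * (1 + ?s * (e' x \<bullet> y)) + f (P ?s x) * (e' x \<bullet> y)" for x
      by (simp add: inner_add_left algebra_simps)
    ultimately show ?thesis by (simp add: G'_def)
  qed
  \<comment> \<open>At these two times the sine is \<open>1\<close> and \<open>0\<close>: the full
    displacement and the identity.\<close>
  ultimately have "(\<integral>x. G (pi/2) x \<partial>torus) = (\<integral>x. G 0 x \<partial>torus)"
    using DERIV_isconst_all[of "\<lambda>t. \<integral>x. G t x \<partial>torus"] by metis
  then show ?thesis by (simp add: G_def P_def)
qed

lemma infdist_lattice_invariant:
  assumes H: "\<And>x k. k \<in> int_lattice \<Longrightarrow> x \<in> H \<Longrightarrow> x + k \<in> H" 
  shows "lattice_periodic (\<lambda>x. infdist x H)"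
proof (cases "H = {}")
  case False
  have le: "infdist (x + k) H \<le> infdist x H" if "k \<in> int_lattice" for x k
    unfolding infdist_notempty[OF False]
  proof (rule cINF_mono[OF False])
    show "bdd_below (dist (x + k) ` H)" by (auto intro!: bdd_belowI[of _ 0])
    show "\<exists>n\<in>H. dist (x + k) n \<le> dist x m" if "m \<in> H" for m
      by (rule bexI[of _ "m + k"]) (use that \<open>k \<in> int_lattice\<close> H in auto)
  qed
  show ?thesis
  proof (rule lattice_periodicI)
    fix x k :: "real^'a" assume k: "k \<in> int_lattice"
    show "infdist (x + k) H = infdist x H"
      using le[OF k, of x] le[of "- k" "x + k"] k by simp
  qed
qed (simp add: infdist_def lattice_periodic_def)

text \<open>By the matrix determinant lemma the Jacobian of
  \<open>x \<mapsto> x + e x *\<^sub>R y\<close> is \<open>1 + e' x \<bullet> y\<close>. For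
  \<open>norm y \<le> 1\<close> the bound \<open>1/2\<close> keeps it in \<open>[1/2, 3/2]\<close>
  and makes the displacement \<open>e x *\<^sub>R y\<close> a contraction, hence the map
  invertible.\<close>

definition small_gradient :: "(real^'n \<Rightarrow> real) \<Rightarrow> (real^'n \<Rightarrow> real^'n) \<Rightarrow> bool" where
  "small_gradient e e' \<longleftrightarrow> C1_periodic e e' \<and> (\<forall>x. norm (e' x) \<le> 1/2)"

lemma small_gradientD:
  assumes "small_gradient e e'" "norm y \<le> 1"
  shows "C1_periodic e e'" "norm (e' x) \<le> 1/2" "\<bar>e' x \<bullet> y\<bar> \<le> 1/2" "1/2 \<le> 1 + e' x \<bullet> y" "1 + e' x \<bullet> y \<le> 3/2"
proof -
  show C: "C1_periodic e e'" and n: "norm (e' x) \<le> 1/2" using assms by (auto simp: small_gradient_def)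
  have "\<bar>e' x \<bullet> y\<bar> \<le> 1/2 * 1"
    by (rule order_trans[OF Cauchy_Schwarz_ineq2]) (intro mult_mono n assms(2), auto)
  then show "\<bar>e' x \<bullet> y\<bar> \<le> 1/2" "1/2 \<le> 1 + e' x \<bullet> y" "1 + e' x \<bullet> y \<le> 3/2" by auto
qed

lemma small_gradient_lipschitz:
  assumes "small_gradient e e'"
  shows "\<bar>e x - e y\<bar> \<le> 1/2 * norm (x - y)"
proof -
  have C: "C1_periodic e e'" "\<And>x. norm (e' x) \<le> 1/2" using assms by (auto simp: small_gradient_def)
  have "norm (e x - e y) \<le> 1/2 * norm (x - y)"
  proof (rule differentiable_bound[where S=UNIV and f'="\<lambda>x h. e' x \<bullet> h"])
    show "onorm (\<lambda>h. e' z \<bullet> h) \<le> 1/2" for z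
    proof (rule onorm_le)
      fix h
      have "norm (e' z \<bullet> h) \<le> norm (e' z) * norm h" by (rule Cauchy_Schwarz_ineq2[folded real_norm_def])
      also have "\<dots> \<le> 1/2 * norm h" by (intro mult_right_mono C(2)) simp
      finally show "norm (e' z \<bullet> h) \<le> 1/2 * norm h" .
    qed
  qed (use C1_periodicD(2)[OF C(1)] in auto)
  then show ?thesis by simp
qed

text \<open>Both sides are continuous under uniform convergence, and the convolutions of
  \<open>f\<close> with the kernel are C1 and converge uniformly. An error \<open>d\<close> is
  weighted by at most \<open>3/2\<close> on the left and by \<open>1\<close> on the right, together
  \<open>5/2\<close>.\<close>

lemma flow_volume_continuous:
  fixes f :: "real^'n \<Rightarrow> real"
  assumes cont: "continuous_on UNIV f" and per: "lattice_periodic f"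
    and e: "small_gradient e e'" and y: "norm y \<le> 1"
  shows "(\<integral>x. f (x + e x *\<^sub>R y) * (1 + e' x \<bullet> y) \<partial>torus) = (\<integral>x. f x \<partial>torus)"
proof -
  note e1 = small_gradientD[OF e y]
  have [measurable]: "f \<in> borel_measurable borel" using cont by (rule borel_measurable_continuous_onI)
  note [measurable] = C1_periodic_measurable[OF e1(1)]
  obtain B where B: "B > 0" "\<And>x. norm (f x) \<le> B" using periodic_continuous_bounded[OF cont per] by metis
  let ?D = "\<bar>(\<integral>x. f (x + e x *\<^sub>R y) * (1 + e' x \<bullet> y) \<partial>torus) - (\<integral>x. f x \<partial>torus)\<bar>"
  have if1: "integrable torus (\<lambda>x. f (x + e x *\<^sub>R y) * (1 + e' x \<bullet> y))"
  proof (rule torus_integrable_bounded)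
    show "norm (f (x + e x *\<^sub>R y) * (1 + e' x \<bullet> y)) \<le> B * (3/2)" for x
      unfolding norm_mult using B(2)[of "x + e x *\<^sub>R y"] e1(4,5)[of x] B(1) by (intro mult_mono) auto
  qed measurable
  have if2: "integrable torus f" by (rule torus_integrable_continuous[OF cont per])
  have "?D \<le> d * (5/2)" if d: "d > 0" for d
  proof -
    obtain m where m: "\<And>x. \<bar>(\<integral>z. torus_kernel m (x - z) * f z \<partial>torus) - f x\<bar> \<le> d"
      using torus_kernel_approximates[OF cont per d] by (auto simp: eventually_sequentially)
    obtain K' where K': "C1_periodic (torus_kernel m :: real^'n \<Rightarrow> real) K'" using torus_kernel_C1 by blast
    define g where "g x = (\<integral>z. torus_kernel m (x - z) * f z \<partial>torus)" for x
    obtain g' where g: "C1_periodic g g'"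
      using C1_periodic_convolution[OF K' _ if2] unfolding g_def by auto
    note [measurable] = C1_periodic_measurable[OF g]
    have gf: "\<bar>g x - f x\<bar> \<le> d" for x using m by (simp add: g_def)
    obtain A where A: "A > 0" "\<And>x. \<bar>g x\<bar> \<le> A" using C1_periodic_bounds[OF g] by metis
    have ig1: "integrable torus (\<lambda>x. g (x + e x *\<^sub>R y) * (1 + e' x \<bullet> y))"
    proof (rule torus_integrable_bounded)
      show "norm (g (x + e x *\<^sub>R y) * (1 + e' x \<bullet> y)) \<le> A * (3/2)" for x
        unfolding norm_mult using A(2)[of "x + e x *\<^sub>R y"] e1(4,5)[of x] A(1) by (intro mult_mono) auto
    qed measurable
    have ig2: "integrable torus g" by (rule torus_integrable_continuous[OF C1_periodicD(4)[OF g] C1_periodicD(1)[OF g]])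
    have 1: "\<bar>(\<integral>x. f (x + e x *\<^sub>R y) * (1 + e' x \<bullet> y) \<partial>torus) - (\<integral>x. g (x + e x *\<^sub>R y) * (1 + e' x \<bullet> y) \<partial>torus)\<bar> \<le> d * (3/2)"
    proof -
      have "\<bar>(\<integral>x. f (x + e x *\<^sub>R y) * (1 + e' x \<bullet> y) \<partial>torus) - (\<integral>x. g (x + e x *\<^sub>R y) * (1 + e' x \<bullet> y) \<partial>torus)\<bar>
         = \<bar>\<integral>x. f (x + e x *\<^sub>R y) * (1 + e' x \<bullet> y) - g (x + e x *\<^sub>R y) * (1 + e' x \<bullet> y) \<partial>torus\<bar>"
        by (simp only: Bochner_Integration.integral_diff[OF if1 ig1])
      also have "\<dots> \<le> (\<integral>x. \<bar>f (x + e x *\<^sub>R y) * (1 + e' x \<bullet> y) - g (x + e x *\<^sub>R y) * (1 + e' x \<bullet> y)\<bar> \<partial>torus)"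
        by (rule integral_abs_bound)
      also have "\<dots> \<le> (\<integral>x. d * (3/2) \<partial>(torus :: (real^'n) measure))"
      proof (rule integral_mono)
        fix x
        have "\<bar>(f (x + e x *\<^sub>R y) - g (x + e x *\<^sub>R y)) * (1 + e' x \<bullet> y)\<bar> \<le> d * (3/2)"
          unfolding abs_mult using gf[of "x + e x *\<^sub>R y"] e1(4,5)[of x] d by (intro mult_mono) auto
        then show "\<bar>f (x + e x *\<^sub>R y) * (1 + e' x \<bullet> y) - g (x + e x *\<^sub>R y) * (1 + e' x \<bullet> y)\<bar> \<le> d * (3/2)"
          by (simp only: left_diff_distrib)
      qed (intro integrable_abs Bochner_Integration.integrable_diff if1 ig1, simp)
      finally show ?thesis by simp
    qed
    have 2: "\<bar>(\<integral>x. g x \<partial>torus) - (\<integral>x. f x \<partial>torus)\<bar> \<le> d"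
    proof -
      have "\<bar>(\<integral>x. g x \<partial>torus) - (\<integral>x. f x \<partial>torus)\<bar> = \<bar>\<integral>x. g x - f x \<partial>torus\<bar>"
        by (simp only: Bochner_Integration.integral_diff[OF ig2 if2])
      also have "\<dots> \<le> (\<integral>x. \<bar>g x - f x\<bar> \<partial>torus)" by (rule integral_abs_bound)
      also have "\<dots> \<le> (\<integral>x. d \<partial>(torus :: (real^'n) measure))"
        by (rule integral_mono[OF _ _ gf]) (intro integrable_abs Bochner_Integration.integrable_diff if2 ig2, simp)
      finally show ?thesis by simp
    qed
    show ?thesis using 1 2 flow_volume_C1[OF g e1(1), of y] by linarith
  qed
  then have "?D / (5/2) \<le> 0 + d" if "d > 0" for d using that by (simp add: field_simps)
  then have "?D / (5/2) \<le> 0" by (rule field_le_epsilon)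
  then show ?thesis by simp
qed


section \<open>From continuous to measurable functions: the change of variables formula\<close>

lemma torus_measure_eqI:
  fixes N :: "(real^'n) measure"
  assumes sets: "sets N = sets borel" and cell: "emeasure N (- unit_cell) = 0"
    and eq: "\<And>A. compact A \<Longrightarrow> A \<subseteq> unit_cell \<Longrightarrow> emeasure N A = emeasure torus A"
  shows "N = torus"
proof -
  \<comment> \<open>For closed \<open>A\<close> the set \<open>A \<inter> unit_cell\<close> need not
    be compact, because the cell is half-open; it is exhausted by the compact sets
    \<open>A \<inter> Q n\<close>.\<close>
  define Q where "Q n = cbox 0 ((1 - 1 / (real n + 1)) *\<^sub>R (1 :: real^'n))" for n
  have QU: "(\<Union>n. Q n) = unit_cell"
  proof (intro equalityI subsetI)
    fix x :: "real^'n" assume "x \<in> (\<Union>n. Q n)"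
    then obtain n where n: "\<And>i. 0 \<le> x $ i \<and> x $ i \<le> 1 - 1 / (real n + 1)" by (auto simp: Q_def mem_box_cart)
    have "x $ i < 1" for i by (rule le_less_trans[of _ "1 - 1 / (real n + 1)"]) (use n in simp_all)
    with n show "x \<in> unit_cell" by (simp add: unit_cell_def)
  next
    fix x :: "real^'n" assume x: "x \<in> unit_cell"
    define s where "s = Max (range (\<lambda>i. x $ i))"
    have "s < 1" using x by (auto simp: s_def unit_cell_def)
    then obtain n where "1 / (real n + 1) < 1 - s"
      using reals_Archimedean[of "1 - s"] by (auto simp: inverse_eq_divide add.commute)
    moreover have "x $ i \<le> s" for i by (simp add: s_def)
    ultimately have "x \<in> Q n" using x
      by (auto simp: Q_def mem_box_cart unit_cell_def) (smt (verit))
    then show "x \<in> (\<Union>n. Q n)" by blast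
  qed
  have Qmono: "Q m \<subseteq> Q n" if "m \<le> n" for m n
  proof -
    have "1 / (real n + 1) \<le> 1 / (real m + 1)" using that by (simp add: frac_le)
    then show ?thesis by (auto simp: Q_def mem_box_cart) (smt (verit))
  qed
  have cell': "emeasure N A = emeasure N (A \<inter> unit_cell)" if "A \<in> sets borel" for A
  proof -
    have "emeasure N (A - unit_cell) \<le> emeasure N (- unit_cell)"
      by (intro emeasure_mono) (auto simp: sets)
    then have "emeasure N (A - unit_cell) = 0" using cell by simp
    moreover have "emeasure N A = emeasure N (A \<inter> unit_cell) + emeasure N (A - unit_cell)"
      using that by (subst plus_emeasure) (auto simp: sets Int_Diff_Un)
    ultimately show ?thesis by simp
  qed
  have torus_cell: "emeasure torus A = emeasure torus (A \<inter> unit_cell)" if "A \<in> sets borel" for A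
    using that unfolding torus_def by (simp add: emeasure_density indicator_inter_arith ac_simps)
       (intro nn_integral_cong, auto split: split_indicator)
  show ?thesis
  proof (rule measure_eqI_generator_eq[where E="Collect closed" and \<Omega>=UNIV and A="\<lambda>_. UNIV"])
    show "Int_stable (Collect (closed :: (real^'n) set \<Rightarrow> bool))" by (auto simp: Int_stable_def)
    fix A :: "(real^'n) set" assume "A \<in> Collect closed"
    then have A: "closed A" "A \<in> sets borel" by auto
    have un: "(\<Union>n. A \<inter> Q n) = A \<inter> unit_cell" using QU by blast
    have lim: "(\<lambda>n. emeasure M (A \<inter> Q n)) \<longlonglongrightarrow> emeasure M (A \<inter> unit_cell)" if "sets M = sets borel" for M
      unfolding un[symmetric] using A Qmono that by (intro Lim_emeasure_incseq) (auto simp: incseq_def Q_def)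
    have "emeasure N (A \<inter> Q n) = emeasure torus (A \<inter> Q n)" for n
      using A QU by (intro eq) (auto simp: Q_def intro: closed_Int_compact)
    then have "emeasure N (A \<inter> unit_cell) = emeasure torus (A \<inter> unit_cell)"
      using LIMSEQ_unique[OF lim[OF sets]] lim[OF sets_torus] by simp
    then show "emeasure N A = emeasure torus A"
      using cell'[OF A(2)] torus_cell[OF A(2)] by simp
  next
    have "emeasure N UNIV = emeasure (torus :: (real^'n) measure) UNIV"
    proof -
      have lim: "(\<lambda>n. emeasure M (Q n)) \<longlonglongrightarrow> emeasure M unit_cell" if "sets M = sets borel" for M
        unfolding QU[symmetric] using Qmono that by (intro Lim_emeasure_incseq) (auto simp: incseq_def Q_def)
      have "emeasure N (Q n) = emeasure torus (Q n)" for n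
        using QU by (intro eq) (auto simp: Q_def)
      then have "emeasure N unit_cell = emeasure torus (unit_cell :: (real^'n) set)"
        using LIMSEQ_unique[OF lim[OF sets]] lim[OF sets_torus] by simp
      then show "emeasure N UNIV = emeasure (torus :: (real^'n) measure) UNIV" using cell'[of UNIV] torus_cell[of UNIV] by simp
    qed
    then show "emeasure N UNIV \<noteq> \<infinity>" by simp
  qed (auto simp: sets borel_eq_closed)
qed

text \<open>It is enough to test compact subsets \<open>A\<close> of the cell. Their lattice hull
  \<open>H\<close> is closed, so its indicator is the pointwise limit of the continuous periodic
  functions \<open>max 0 (1 - real j * infdist x H)\<close>, and the formula for continuous
  functions passes to this limit by dominated convergence.\<close>

lemma flow_volume_measure:
  fixes e :: "real^'n \<Rightarrow> real"
  assumes e: "small_gradient e e'" and y: "norm y \<le> 1"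
  shows "distr (density torus (\<lambda>x. 1 + e' x \<bullet> y)) borel (\<lambda>x. wrap (x + e x *\<^sub>R y)) = torus" (is "?N = _")
proof (rule torus_measure_eqI)
  note e1 = small_gradientD[OF e y]
  note [measurable] = C1_periodic_measurable[OF e1(1)]
  show "sets ?N = sets borel" by simp
  have em: "emeasure ?N A = (\<integral>\<^sup>+x. ennreal (1 + e' x \<bullet> y) * indicator A (wrap (x + e x *\<^sub>R y)) \<partial>torus)" if [measurable]: "A \<in> sets borel" for A
    by (subst nn_integral_indicator[symmetric], simp, subst nn_integral_distr, simp, simp, subst nn_integral_density) simp_all
  show "emeasure ?N (- unit_cell) = 0"
    by (subst em) (simp_all add: wrap_in_unit_cell)
  fix A :: "(real^'n) set" assume A: "compact A" "A \<subseteq> unit_cell"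
  then have [measurable]: "A \<in> sets borel" by (simp add: compact_imp_closed)
  define H where "H = {a + k |a k. a \<in> A \<and> k \<in> int_lattice}"
  have "H = (\<Union>x\<in>A. \<Union>y\<in>int_lattice. {x + y})" by (auto simp: H_def)
  then have H: "closed H" using compact_closed_sums[OF A(1) closed_int_lattice] by simp
  have Hper: "x + k \<in> H" if k: "k \<in> int_lattice" and x: "x \<in> H" for x k
  proof -
    obtain a l where "x = a + l" "a \<in> A" "l \<in> int_lattice" using x by (auto simp: H_def)
    then have "x + k = a + (l + k)" "l + k \<in> int_lattice" using k by (auto simp: int_lattice_add)
    with \<open>a \<in> A\<close> show ?thesis unfolding H_def by blast
  qed
  have HA: "x \<in> H \<longleftrightarrow> wrap x \<in> A" for x
  proof
    assume "x \<in> H"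
    then obtain a k where ak: "x = a + k" "a \<in> A" "k \<in> int_lattice" by (auto simp: H_def)
    have "a \<in> unit_cell" using ak(2) A(2) by blast
    then have "wrap x = a" by (simp only: ak(1) wrap_add[OF ak(3)] wrap_id)
    with ak show "wrap x \<in> A" by simp
  next
    assume "wrap x \<in> A"
    moreover have "x = wrap x + (x - wrap x)" "x - wrap x \<in> int_lattice"
      using int_lattice_uminus[of "wrap x - x"] wrap_diff_int_lattice[of x] by simp_all
    ultimately show "x \<in> H" unfolding H_def by blast
  qed
  show "emeasure ?N A = emeasure torus A"
  \<comment> \<open>By convention \<open>infdist\<close> to the empty set is \<open>0\<close>, so
    the cutoffs below would all equal \<open>1\<close>; this case is settled separately.\<close>
  proof (cases "H = {}")
    case True
    have "a \<notin> A" for a using HA[of a] True A(2) wrap_id[of a] by auto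
    then have "A = {}" by blast
    then show ?thesis by simp
  next
    case False
    define f where "f j x = max 0 (1 - real j * infdist x H)" for j :: nat and x
    have fc: "continuous_on UNIV (f j)" for j
      unfolding f_def by (intro continuous_intros)
    then have [measurable]: "f j \<in> borel_measurable borel" for j by (rule borel_measurable_continuous_onI)
    have fp: "lattice_periodic (f j)" for j
      using infdist_lattice_invariant[of H, OF Hper] unfolding f_def lattice_periodic_def by simp
    have fb: "0 \<le> f j x" "f j x \<le> 1" for j x by (auto simp: f_def infdist_nonneg)
    have flim: "(\<lambda>j. f j x) \<longlonglongrightarrow> indicator A (wrap x)" for x
    proof (cases "x \<in> H")
      case True
      then show ?thesis using HA[of x] by (simp add: f_def)
    next
      case False
      then have "infdist x H \<noteq> 0" using in_closed_iff_infdist_zero[OF H \<open>H \<noteq> {}\<close>, of x] by simp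
      then have pos: "infdist x H > 0" using infdist_nonneg[of x H] by linarith
      then obtain J where J: "1 < real J * infdist x H" using reals_Archimedean3 by blast
      have "f j x = 0" if "j \<ge> J" for j
      proof -
        have "real J * infdist x H \<le> real j * infdist x H" using that pos by simp
        then show ?thesis using J by (simp add: f_def)
      qed
      then have "\<forall>\<^sub>F j in sequentially. f j x = 0" by (auto simp: eventually_sequentially)
      moreover have "wrap x \<notin> A" using False HA by blast
      ultimately show ?thesis by (auto intro: tendsto_eventually)
    qed
    have fi: "integrable torus (\<lambda>x. f j (x + e x *\<^sub>R y) * (1 + e' x \<bullet> y))" for j
    proof (rule torus_integrable_bounded)
      show "norm (f j (x + e x *\<^sub>R y) * (1 + e' x \<bullet> y)) \<le> 1 * (3/2)" for x
        unfolding norm_mult using fb[of j "x + e x *\<^sub>R y"] e1(4,5)[of x] by (intro mult_mono) auto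
    qed measurable
    have L1: "(\<lambda>j. \<integral>x. f j (x + e x *\<^sub>R y) * (1 + e' x \<bullet> y) \<partial>torus)
        \<longlonglongrightarrow> (\<integral>x. indicator A (wrap (x + e x *\<^sub>R y)) * (1 + e' x \<bullet> y) \<partial>torus)"
    proof (rule integral_dominated_convergence[where w="\<lambda>_. 3/2"])
      show "AE x in torus. norm (f j (x + e x *\<^sub>R y) * (1 + e' x \<bullet> y)) \<le> 3/2" for j
      proof (rule AE_I2)
        fix x
        have "norm (f j (x + e x *\<^sub>R y) * (1 + e' x \<bullet> y)) \<le> 1 * (3/2)"
          unfolding norm_mult using fb[of j "x + e x *\<^sub>R y"] e1(4,5)[of x] by (intro mult_mono) auto
        then show "norm (f j (x + e x *\<^sub>R y) * (1 + e' x \<bullet> y)) \<le> 3/2" by simp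
      qed
      show "AE x in torus. (\<lambda>j. f j (x + e x *\<^sub>R y) * (1 + e' x \<bullet> y)) \<longlonglongrightarrow> indicator A (wrap (x + e x *\<^sub>R y)) * (1 + e' x \<bullet> y)"
        by (intro AE_I2 tendsto_mult flim tendsto_const)
    qed simp_all
    have L2: "(\<lambda>j. \<integral>x. f j x \<partial>torus) \<longlonglongrightarrow> (\<integral>x. indicator A (wrap x) \<partial>torus)"
    proof (rule integral_dominated_convergence[where w="\<lambda>_. 1"])
      show "AE x in torus. norm (f j x) \<le> 1" for j using fb by simp
      show "AE x in torus. (\<lambda>j. f j x) \<longlonglongrightarrow> indicator A (wrap x)" using flim by simp
    qed simp_all
    have "(\<integral>x. indicator A (wrap (x + e x *\<^sub>R y)) * (1 + e' x \<bullet> y) \<partial>torus) = (\<integral>x. indicator A (wrap x) \<partial>torus)"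
      by (rule LIMSEQ_unique[OF L1]) (simp only: flow_volume_continuous[OF fc fp e y] L2)
    also have "\<dots> = (\<integral>x. indicator A x \<partial>torus)"
      using integral_distr[of "\<lambda>x. wrap (x + 0)" torus borel "indicator A :: _ \<Rightarrow> real"] torus_distr_translate[of "0::real^'n"]
      by simp
    also have "\<dots> = measure torus A" by simp
    finally have int: "(\<integral>x. indicator A (wrap (x + e x *\<^sub>R y)) * (1 + e' x \<bullet> y) \<partial>torus) = measure torus A" .
    have "emeasure ?N A = (\<integral>\<^sup>+x. ennreal (indicator A (wrap (x + e x *\<^sub>R y)) * (1 + e' x \<bullet> y)) \<partial>torus)"
      by (subst em) (auto intro!: nn_integral_cong split: split_indicator)
    also have "\<dots> = ennreal (\<integral>x. indicator A (wrap (x + e x *\<^sub>R y)) * (1 + e' x \<bullet> y) \<partial>torus)"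
    proof (rule nn_integral_eq_integral)
      show "integrable torus (\<lambda>x. indicator A (wrap (x + e x *\<^sub>R y)) * (1 + e' x \<bullet> y))"
      proof (rule torus_integrable_bounded[where B="3/2"])
        show "norm (indicator A (wrap (x + e x *\<^sub>R y)) * (1 + e' x \<bullet> y)) \<le> 3/2" for x
          using e1(4,5)[of x] by (auto split: split_indicator)
      qed measurable
      show "AE x in torus. 0 \<le> indicator A (wrap (x + e x *\<^sub>R y)) * (1 + e' x \<bullet> y)"
      proof (rule AE_I2)
        fix x show "0 \<le> indicator A (wrap (x + e x *\<^sub>R y)) * (1 + e' x \<bullet> y)"
          using e1(4)[of x] by (auto split: split_indicator)
      qed
    qed
    finally show ?thesis using int by (simp add: torus.emeasure_eq_measure)
  qed
qed

lemma flow_nn_integral: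
  fixes h :: "real^'n \<Rightarrow> ennreal"
  assumes e: "small_gradient e e'" and y: "norm y \<le> 1"
    and [measurable]: "h \<in> borel_measurable borel" and per: "lattice_periodic h"
  shows "(\<integral>\<^sup>+x. ennreal (1 + e' x \<bullet> y) * h (x + e x *\<^sub>R y) \<partial>torus) = (\<integral>\<^sup>+x. h x \<partial>torus)"
proof -
  note e1 = small_gradientD[OF e y]
  note [measurable] = C1_periodic_measurable[OF e1(1)]
  have "(\<integral>\<^sup>+x. h x \<partial>torus) = (\<integral>\<^sup>+x. h x \<partial>distr (density torus (\<lambda>x. 1 + e' x \<bullet> y)) borel (\<lambda>x. wrap (x + e x *\<^sub>R y)))"
    by (simp only: flow_volume_measure[OF e y])
  also have "\<dots> = (\<integral>\<^sup>+x. ennreal (1 + e' x \<bullet> y) * h (wrap (x + e x *\<^sub>R y)) \<partial>torus)"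
    by (subst nn_integral_distr, simp, simp, subst nn_integral_density) simp_all
  finally show ?thesis by (simp add: lattice_periodic_wrap[OF per])
qed

text \<open>The factor \<open>2\<close> is the reciprocal of the lower bound \<open>1/2\<close> of
  the Jacobian.\<close>

lemma flow_nn_integral_le:
  fixes h :: "real^'n \<Rightarrow> ennreal"
  assumes e: "small_gradient e e'" and y: "norm y \<le> 1"
    and h [measurable]: "h \<in> borel_measurable borel" and per: "lattice_periodic h"
  shows "(\<integral>\<^sup>+x. h (x + e x *\<^sub>R y) \<partial>torus) \<le> 2 * (\<integral>\<^sup>+x. h x \<partial>torus)"
proof -
  note e1 = small_gradientD[OF e y]
  note [measurable] = C1_periodic_measurable[OF e1(1)]
  have "(\<integral>\<^sup>+x. h (x + e x *\<^sub>R y) \<partial>torus) \<le> (\<integral>\<^sup>+x. 2 * (ennreal (1 + e' x \<bullet> y) * h (x + e x *\<^sub>R y)) \<partial>torus)"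
  proof (rule nn_integral_mono)
    fix x
    have "(1::ennreal) \<le> ennreal (2 * (1 + e' x \<bullet> y))"
      using e1(4)[of x] by (subst ennreal_1[symmetric], intro ennreal_leI) simp
    also have "\<dots> = 2 * ennreal (1 + e' x \<bullet> y)" by (subst ennreal_mult') auto
    finally show "h (x + e x *\<^sub>R y) \<le> 2 * (ennreal (1 + e' x \<bullet> y) * h (x + e x *\<^sub>R y))"
      using mult_right_mono[of 1 "2 * ennreal (1 + e' x \<bullet> y)" "h (x + e x *\<^sub>R y)"] by (simp add: mult.assoc)
  qed
  also have "\<dots> = 2 * (\<integral>\<^sup>+x. h x \<partial>torus)"
    by (subst nn_integral_cmult) (simp_all add: flow_nn_integral[OF e y h per])
  finally show ?thesis .
qed

lemma
  fixes h :: "real^'n \<Rightarrow> real"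
  assumes e: "small_gradient e e'" and y: "norm y \<le> 1"
    and [measurable]: "h \<in> borel_measurable borel" and per: "lattice_periodic h"
  shows flow_integral: "(\<integral>x. (1 + e' x \<bullet> y) * h (x + e x *\<^sub>R y) \<partial>torus) = (\<integral>x. h x \<partial>torus)"
    and flow_integrable: "integrable torus h \<Longrightarrow> integrable torus (\<lambda>x. h (x + e x *\<^sub>R y))"
proof -
  note e1 = small_gradientD[OF e y]
  note [measurable] = C1_periodic_measurable[OF e1(1)]
  have nn: "AE x in torus. 0 \<le> 1 + e' x \<bullet> y"
    by (intro AE_I2 order_trans[OF _ e1(4)]) simp
  have "(\<integral>x. h x \<partial>torus) = (\<integral>x. h x \<partial>distr (density torus (\<lambda>x. 1 + e' x \<bullet> y)) borel (\<lambda>x. wrap (x + e x *\<^sub>R y)))"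
    by (simp only: flow_volume_measure[OF e y])
  also have "\<dots> = (\<integral>x. (1 + e' x \<bullet> y) * h (wrap (x + e x *\<^sub>R y)) \<partial>torus)"
    using nn by (subst integral_distr, simp, simp, subst integral_density) simp_all
  finally show "(\<integral>x. (1 + e' x \<bullet> y) * h (x + e x *\<^sub>R y) \<partial>torus) = (\<integral>x. h x \<partial>torus)"
    by (simp add: lattice_periodic_wrap[OF per])
  assume h: "integrable torus h"
  have per': "lattice_periodic (\<lambda>x. ennreal (norm (h x)))"
    using per by (simp add: lattice_periodic_def)
  have "(\<integral>\<^sup>+x. ennreal (norm (h (x + e x *\<^sub>R y))) \<partial>torus) \<le> 2 * (\<integral>\<^sup>+x. ennreal (norm (h x)) \<partial>torus)"
    by (rule flow_nn_integral_le[OF e y _ per']) simp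
  also have "\<dots> < \<infinity>" using h by (simp add: integrable_iff_bounded ennreal_mult_less_top)
  finally show "integrable torus (\<lambda>x. h (x + e x *\<^sub>R y))" by (simp add: integrable_iff_bounded)
qed

section \<open>The inverse displacement and weak convergence of displaced mollifications\<close>

lemma flow_inverse:
  assumes e: "small_gradient e e'" and y: "norm y \<le> 1"
  obtains \<theta> where "continuous_on UNIV \<theta>" "\<And>z. \<theta> z + e (\<theta> z) *\<^sub>R y = z" "\<And>x. \<theta> (x + e x *\<^sub>R y) = x"
    "\<And>z k. k \<in> int_lattice \<Longrightarrow> \<theta> (z + k) = \<theta> z + k"
proof -
  have e1: "C1_periodic e e'" using e by (simp add: small_gradient_def)
  define \<psi> where "\<psi> x = x + e x *\<^sub>R y" for x
  \<comment> \<open>The displacement changes \<open>x - x'\<close> by at most half its length. This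
    yields injectivity here and the Lipschitz constant \<open>2\<close> of the inverse
    below.\<close>
  have lower: "norm (x - x') \<le> 2 * norm (\<psi> x - \<psi> x')" for x x'
  proof -
    have "norm ((e x - e x') *\<^sub>R y) \<le> (1/2 * norm (x - x')) * 1"
      unfolding norm_scaleR using small_gradient_lipschitz[OF e, of x x'] y by (intro mult_mono) auto
    moreover have "x - x' = (\<psi> x - \<psi> x') - (e x - e x') *\<^sub>R y" by (simp add: \<psi>_def algebra_simps)
    ultimately show ?thesis
      using norm_triangle_ineq4[of "\<psi> x - \<psi> x'" "(e x - e x') *\<^sub>R y"] by simp
  qed
  have inj: "x = x'" if "\<psi> x = \<psi> x'" for x x' using lower[of x x'] that by simp
  have surj: "\<exists>x. \<psi> x = z" for z
  proof -
    \<comment> \<open>A preimage of \<open>z\<close> is a fixed point of the contraction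
      \<open>x \<mapsto> z - e x *\<^sub>R y\<close>.\<close>
    have "\<exists>!x. z - e x *\<^sub>R y = x"
    proof (rule banach_fix_type[of "1/2"])
      show "\<forall>x x'. dist (z - e x *\<^sub>R y) (z - e x' *\<^sub>R y) \<le> 1/2 * dist x x'"
      proof (intro allI)
        fix x x'
        have "norm ((e x' - e x) *\<^sub>R y) \<le> (1/2 * norm (x' - x)) * 1"
          unfolding norm_scaleR using small_gradient_lipschitz[OF e, of x' x] y by (intro mult_mono) auto
        then show "dist (z - e x *\<^sub>R y) (z - e x' *\<^sub>R y) \<le> 1/2 * dist x x'"
          by (simp add: dist_norm norm_minus_commute scaleR_diff_left)
      qed
    qed auto
    then obtain x where "z - e x *\<^sub>R y = x" by blast
    then have "\<psi> x = z" unfolding \<psi>_def by (metis diff_add_cancel)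
    then show ?thesis by blast
  qed
  define \<theta> where "\<theta> z = (SOME x. \<psi> x = z)" for z
  have \<theta>: "\<psi> (\<theta> z) = z" for z unfolding \<theta>_def by (rule someI_ex[OF surj])
  show thesis
  proof
    have "2-lipschitz_on UNIV \<theta>"
    proof (rule lipschitz_onI)
      show "dist (\<theta> a) (\<theta> b) \<le> 2 * dist a b" for a b
        using lower[of "\<theta> a" "\<theta> b"] by (simp add: \<theta> dist_norm)
    qed simp
    then show "continuous_on UNIV \<theta>" by (rule lipschitz_on_continuous_on)
    show "\<theta> z + e (\<theta> z) *\<^sub>R y = z" for z using \<theta>[of z] by (simp add: \<psi>_def)
    show "\<theta> (x + e x *\<^sub>R y) = x" for x
      unfolding \<psi>_def[symmetric] by (rule inj) (rule \<theta>)
    show "\<theta> (z + k) = \<theta> z + k" if k: "k \<in> int_lattice" for z k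
    proof (rule inj)
      have "\<psi> (\<theta> z + k) = \<psi> (\<theta> z) + k"
        using lattice_periodicD[OF C1_periodicD(1)[OF e1] k, of "\<theta> z"] by (simp add: \<psi>_def)
      then show "\<psi> (\<theta> (z + k)) = \<psi> (\<theta> z + k)" by (simp add: \<theta>)
    qed
  qed
qed

lemma torus_integrable_mult_bounded:
  fixes w b :: "real^'n \<Rightarrow> real"
  assumes w: "integrable torus w" and [measurable]: "w \<in> borel_measurable borel" "b \<in> borel_measurable borel"
    and B: "\<And>x. norm (b x) \<le> B"
  shows "integrable torus (\<lambda>x. w x * b x)"
proof (rule Bochner_Integration.integrable_bound)
  show "integrable torus (\<lambda>x. B * w x)" using w by simp
  have "\<bar>w x\<bar> * \<bar>b x\<bar> \<le> \<bar>w x\<bar> * \<bar>B\<bar>" for x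
    by (rule mult_left_mono[OF order_trans[OF B[unfolded real_norm_def] abs_ge_self]]) simp
  then show "AE x in torus. norm (w x * b x) \<le> norm (B * w x)"
    by (intro AE_I2) (simp only: real_norm_def abs_mult mult.commute)
qed simp

text \<open>Fubini and evenness of the kernel move the convolution from \<open>w\<close> to the
  continuous \<open>b\<close>, where it converges uniformly; pairing with an integrable
  \<open>w\<close> preserves this convergence.\<close>

lemma torus_kernel_weak_convergence:
  fixes w b :: "real^'n \<Rightarrow> real"
  assumes [measurable]: "w \<in> borel_measurable borel" and w: "integrable torus w"
    and bc: "continuous_on UNIV b" and bp: "lattice_periodic b"
  shows "(\<lambda>m. \<integral>x. (\<integral>z. torus_kernel m (x - z) * w z \<partial>torus) * b x \<partial>torus) \<longlonglongrightarrow> (\<integral>x. w x * b x \<partial>torus)"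
proof -
  obtain B where B: "B > 0" "\<And>x. norm (b x) \<le> B" using periodic_continuous_bounded[OF bc bp] by metis
  have [measurable]: "b \<in> borel_measurable borel" using bc by (rule borel_measurable_continuous_onI)
  interpret pair_sigma_finite "torus :: (real^'n) measure" "torus :: (real^'n) measure" ..
  have swap: "(\<integral>x. (\<integral>z. torus_kernel m (x - z) * w z \<partial>torus) * b x \<partial>torus)
      = (\<integral>z. w z * (\<integral>x. torus_kernel m (z - x) * b x \<partial>torus) \<partial>torus)" for m
  proof -
    obtain K' where K': "C1_periodic (torus_kernel m :: real^'n \<Rightarrow> real) K'" using torus_kernel_C1 by blast
    obtain A where A: "A > 0" "\<And>x :: real^'n. \<bar>torus_kernel m x\<bar> \<le> A" using C1_periodic_bounds[OF K'] by metis
    have "integrable (torus \<Otimes>\<^sub>M torus) (\<lambda>(x, z). torus_kernel m (x - z) * w z * b x)"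
    proof (rule Fubini_integrable)
      have iW: "integrable torus (\<lambda>z. A * B * \<bar>w z\<bar>)" using w by simp
      have bd: "norm (torus_kernel m (x - z) * w z * b x) \<le> A * B * \<bar>w z\<bar>" for x z
      proof -
        have "\<bar>torus_kernel m (x - z)\<bar> * \<bar>b x\<bar> * \<bar>w z\<bar> \<le> A * B * \<bar>w z\<bar>"
          using A(1) A(2)[of "x - z"] B(2)[of x] by (intro mult_right_mono mult_mono) auto
        then show ?thesis by (simp add: abs_mult mult_ac)
      qed
      have i0: "integrable torus (\<lambda>z. torus_kernel m (x - z) * w z * b x)" for x
        by (rule Bochner_Integration.integrable_bound[OF iW _ AE_I2[OF order_trans[OF bd]]]) simp_all
      then show "AE x in torus. integrable torus (\<lambda>z. case (x, z) of (x, z) \<Rightarrow> torus_kernel m (x - z) * w z * b x)"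
        by simp
      have i1: "(\<integral>z. norm (torus_kernel m (x - z) * w z * b x) \<partial>torus) \<le> (\<integral>z. A * B * \<bar>w z\<bar> \<partial>torus)" for x
        by (rule integral_mono[OF integrable_norm[OF i0] iW bd])
      have "integrable torus (\<lambda>x. \<integral>z. norm (torus_kernel m (x - z) * w z * b x) \<partial>torus)"
      proof (rule torus_integrable_bounded)
        show "norm (\<integral>z. norm (torus_kernel m (x - z) * w z * b x) \<partial>torus) \<le> (\<integral>z. A * B * \<bar>w z\<bar> \<partial>torus)" for x
          using i1[of x] by (subst real_norm_def, subst abs_of_nonneg) simp_all
      qed measurable
      then show "integrable torus (\<lambda>x. \<integral>z. norm (case (x, z) of (x, z) \<Rightarrow> torus_kernel m (x - z) * w z * b x) \<partial>torus)"
        by (simp only: prod.case)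
    qed measurable
    from Fubini_integral[OF this]
    have "(\<integral>z. \<integral>x. torus_kernel m (x - z) * w z * b x \<partial>torus \<partial>torus) = (\<integral>x. \<integral>z. torus_kernel m (x - z) * w z * b x \<partial>torus \<partial>torus)"
      by simp
    moreover have "(\<integral>x. torus_kernel m (x - z) * w z * b x \<partial>torus) = w z * (\<integral>x. torus_kernel m (z - x) * b x \<partial>torus)" for z
    proof -
      have "torus_kernel m (x - z) = torus_kernel m (z - x)" for x using torus_kernel_minus[of m "z - x"] by simp
      then have "(\<integral>x. torus_kernel m (x - z) * w z * b x \<partial>torus) = (\<integral>x. w z * (torus_kernel m (z - x) * b x) \<partial>torus)"
        by (simp add: mult_ac)
      then show ?thesis by simp
    qed
    ultimately show ?thesis by simp
  qed
  have wb: "integrable torus (\<lambda>x. w x * b x)"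
    by (rule torus_integrable_mult_bounded[OF w _ _ B(2)]) measurable
  show ?thesis
    unfolding swap
  proof (rule LIMSEQ_I)
    fix r :: real assume r: "r > 0"
    define I where "I = (\<integral>x. \<bar>w x\<bar> \<partial>torus)"
    have I: "I \<ge> 0" by (simp add: I_def)
    \<comment> \<open>With \<open>I + 1\<close> in place of \<open>I\<close> the quotient makes
      sense also for \<open>I = 0\<close>, and still \<open>d * I \<le> r / 2\<close>.\<close>
    define d where "d = r / (2 * (I + 1))"
    have d: "d > 0" using r I by (simp add: d_def)
    from torus_kernel_approximates[OF bc bp d] obtain M where
      M: "\<And>m x. m \<ge> M \<Longrightarrow> \<bar>(\<integral>z. torus_kernel m (x - z) * b z \<partial>torus) - b x\<bar> \<le> d"
      by (auto simp: eventually_sequentially)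
    show "\<exists>no. \<forall>n\<ge>no. norm ((\<integral>z. w z * (\<integral>x. torus_kernel n (z - x) * b x \<partial>torus) \<partial>torus) - (\<integral>x. w x * b x \<partial>torus)) < r"
    proof (intro exI allI impI)
      fix n assume n: "n \<ge> M"
      define c where "c z = (\<integral>x. torus_kernel n (z - x) * b x \<partial>torus)" for z
      have [measurable]: "c \<in> borel_measurable borel" unfolding c_def by measurable
      have cb: "\<bar>c z - b z\<bar> \<le> d" for z using M[OF n, of z] by (simp add: c_def)
      have cB: "\<bar>c z\<bar> \<le> B + d" for z using cb[of z] B(2)[of z] by (simp add: abs_le_iff)
      have wc: "integrable torus (\<lambda>x. w x * c x)"
        by (rule torus_integrable_mult_bounded[OF w, of _ "B + d"]) (measurable, simp add: cB)
      have "norm ((\<integral>z. w z * c z \<partial>torus) - (\<integral>x. w x * b x \<partial>torus)) = norm (\<integral>z. w z * c z - w z * b z \<partial>torus)"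
        by (simp only: Bochner_Integration.integral_diff[OF wc wb])
      also have "\<dots> \<le> (\<integral>z. norm (w z * c z - w z * b z) \<partial>torus)"
        by (rule integral_norm_bound)
      also have "\<dots> \<le> (\<integral>z. d * \<bar>w z\<bar> \<partial>torus)"
      proof (rule integral_mono)
        show "norm (w z * c z - w z * b z) \<le> d * \<bar>w z\<bar>" for z
          using mult_right_mono[OF cb[of z] abs_ge_zero[of "w z"]] by (simp add: abs_mult[symmetric] algebra_simps)
        show "integrable torus (\<lambda>z. d * \<bar>w z\<bar>)" using w by simp
      qed (intro integrable_norm Bochner_Integration.integrable_diff wb wc)
      also have "\<dots> = d * I" by (simp add: I_def)
      also have "\<dots> \<le> r / 2" using I r by (simp add: d_def field_simps)
      also have "\<dots> < r" using r by simp
      finally show "norm ((\<integral>z. w z * (\<integral>x. torus_kernel n (z - x) * b x \<partial>torus) \<partial>torus) - (\<integral>x. w x * b x \<partial>torus)) < r"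
        by (simp add: c_def)
    qed
  qed
qed

text \<open>The substitution \<open>z = x + e x *\<^sub>R y\<close> turns the test function
  \<open>a\<close> into \<open>b\<close>, the quotient of \<open>a\<close> by the Jacobian taken at
  the preimage \<open>\<theta> z\<close>. Since \<open>\<theta>\<close> is continuous and commutes
  with lattice translations, \<open>b\<close> is continuous and periodic, and the statement without
  displacement applies.\<close>

lemma flow_kernel_weak_convergence:
  fixes w a :: "real^'n \<Rightarrow> real"
  assumes e: "small_gradient e e'" and y: "norm y \<le> 1"
    and w_meas [measurable]: "w \<in> borel_measurable borel" and w: "integrable torus w" and wp: "lattice_periodic w"
    and ac: "continuous_on UNIV a" and ap: "lattice_periodic a"
  shows "(\<lambda>m. \<integral>x. (\<integral>z. torus_kernel m (x + e x *\<^sub>R y - z) * w z \<partial>torus) * a x \<partial>torus)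
      \<longlonglongrightarrow> (\<integral>x. w (x + e x *\<^sub>R y) * a x \<partial>torus)"
proof -
  note e1 = small_gradientD[OF e y]
  note [measurable] = C1_periodic_measurable[OF e1(1)]
  obtain \<theta> where \<theta>: "continuous_on UNIV \<theta>" "\<And>z. \<theta> z + e (\<theta> z) *\<^sub>R y = z" "\<And>x. \<theta> (x + e x *\<^sub>R y) = x"
    "\<And>z k. k \<in> int_lattice \<Longrightarrow> \<theta> (z + k) = \<theta> z + k"
    using flow_inverse[OF e y] by metis
  define b where "b z = a (\<theta> z) / (1 + e' (\<theta> z) \<bullet> y)" for z
  have ne: "1 + e' x \<bullet> y \<noteq> 0" for x using e1(4)[of x] by auto
  have bc: "continuous_on UNIV b"
    unfolding b_def
    by (intro continuous_intros continuous_on_compose2[OF ac \<theta>(1)] continuous_on_compose2[OF C1_periodicD(3)[OF e1(1)] \<theta>(1)]) (auto simp: ne)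
  have bp: "lattice_periodic b"
    by (intro lattice_periodicI)
       (simp add: b_def \<theta>(4) lattice_periodicD[OF ap] lattice_periodicD[OF C1_periodic_gradient_periodic[OF e1(1)]])
  have [measurable]: "b \<in> borel_measurable borel" using bc by (rule borel_measurable_continuous_onI)
  have tr: "(\<integral>x. g (x + e x *\<^sub>R y) * a x \<partial>torus) = (\<integral>x. g x * b x \<partial>torus)"
    if [measurable]: "g \<in> borel_measurable borel" and gp: "lattice_periodic g" for g
  proof -
    have "(\<integral>x. g x * b x \<partial>torus) = (\<integral>x. (1 + e' x \<bullet> y) * (g (x + e x *\<^sub>R y) * b (x + e x *\<^sub>R y)) \<partial>torus)"
      by (rule flow_integral[OF e y, symmetric])
         (auto intro!: lattice_periodicI simp: lattice_periodicD[OF gp] lattice_periodicD[OF bp])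
    also have "\<dots> = (\<integral>x. g (x + e x *\<^sub>R y) * a x \<partial>torus)"
      using ne by (simp add: b_def \<theta>(3))
    finally show ?thesis ..
  qed
  have gm: "(\<lambda>x. \<integral>z. torus_kernel m (x - z) * w z \<partial>torus) \<in> borel_measurable borel"
    "lattice_periodic (\<lambda>x. \<integral>z. torus_kernel m (x - z) * w z \<partial>torus)" for m
  proof -
    obtain K' where K': "C1_periodic (torus_kernel m :: real^'n \<Rightarrow> real) K'" using torus_kernel_C1 by blast
    note C = C1_periodic_convolution[OF K' w_meas w]
    show "(\<lambda>x. \<integral>z. torus_kernel m (x - z) * w z \<partial>torus) \<in> borel_measurable borel"
      by (rule C1_periodic_measurable(1)[OF C])
    show "lattice_periodic (\<lambda>x. \<integral>z. torus_kernel m (x - z) * w z \<partial>torus)"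
      by (rule C1_periodicD(1)[OF C])
  qed
  show ?thesis
    unfolding tr[OF gm] tr[OF w_meas wp]
    by (rule torus_kernel_weak_convergence[OF w_meas w bc bp])
qed

section \<open>Pullback and averaging of closed forms\<close>

text \<open>For \<open>j\<close> in \<open>J\<close> this is the sign produced by moving
  \<open>theta_j\<close> to the front of the wedge product over \<open>J\<close> taken in increasing
  order.\<close>

definition fsign :: "'n::{finite,linorder} \<Rightarrow> 'n set \<Rightarrow> real" where
  "fsign j J = (-1) ^ card {k\<in>J. k < j}"

lemma fsign_insert: "a \<notin> S \<Longrightarrow> fsign j (insert a S) = (if a < j then - fsign j S else fsign j S)"
proof -
  assume a: "a \<notin> S"
  have "{k \<in> insert a S. k < j} = (if a < j then insert a {k \<in> S. k < j} else {k \<in> S. k < j})" by auto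
  then show ?thesis using a by (simp add: fsign_def)
qed

lemma fsign_remove: "a \<in> S \<Longrightarrow> fsign j (S - {a}) = (if a < j then - fsign j S else fsign j S)"
  using fsign_insert[of a "S - {a}" j] by (simp add: insert_absorb)

lemma fsign_square: "fsign j J * fsign j J = 1"
  by (simp add: fsign_def flip: power_mult_distrib)

lemma fsign_abs: "\<bar>fsign j J\<bar> = 1"
  by (simp add: fsign_def power_abs)

text \<open>Anticommutativity of \<open>theta_j\<close> and \<open>theta_k\<close>: removing two
  indices in the two possible orders gives opposite signs. The cancellations of the kind
  \<open>d (d e) = 0\<close> below rest on this.\<close>

lemma fsign_swap:
  assumes "j \<in> J" "k \<in> J" "j \<noteq> k"
  shows "fsign j J * fsign k (J - {j}) = - (fsign k J * fsign j (J - {k}))"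
  using assms by (cases "j < k") (auto simp: fsign_remove)

text \<open>For distinct indices, wedging with \<open>theta_j\<close> anticommutes with contracting
  by the i-th basis vector; these are the two composite signs.\<close>

lemma fsign_exchange:
  assumes "j \<in> I" "i \<notin> I"
  shows "fsign j I * fsign i (insert i (I - {j})) = - (fsign i (insert i I) * fsign j (insert i I))"
  using assms by (cases "j < i") (auto simp: fsign_insert fsign_remove)

lemma sum_antisymmetric:
  fixes a :: "'n \<Rightarrow> 'n \<Rightarrow> real"
  assumes "finite J" "\<And>j k. j \<in> J \<Longrightarrow> k \<in> J \<Longrightarrow> j \<noteq> k \<Longrightarrow> a k j = - a j k"
  shows "(\<Sum>j\<in>J. \<Sum>k\<in>J - {j}. a j k) = 0"
proof -
  have "(\<Sum>j\<in>J. \<Sum>k\<in>J - {j}. a j k) = (\<Sum>j\<in>J. \<Sum>k\<in>{k. k \<in> J \<and> j \<noteq> k}. a j k)"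
    by (intro sum.cong) auto
  also have "\<dots> = (\<Sum>k\<in>J. \<Sum>j\<in>{j. j \<in> J \<and> j \<noteq> k}. a j k)"
    by (rule sum.swap_restrict) (use assms in auto)
  also have "\<dots> = (\<Sum>k\<in>J. \<Sum>j\<in>J - {k}. - a k j)"
    using assms by (intro sum.cong) auto
  also have "\<dots> = - (\<Sum>j\<in>J. \<Sum>k\<in>J - {j}. a j k)"
    by (simp add: sum_negf)
  finally show ?thesis by simp
qed

text \<open>Contraction into the first argument: \<open>fsign i (insert i I)\<close> brings
  \<open>theta_i\<close> to the front before it is evaluated on \<open>y\<close>.\<close>

definition interior_product :: "(real,'n) vec \<Rightarrow> ('n::{finite,linorder} set \<Rightarrow> real) \<Rightarrow> 'n set \<Rightarrow> real" where
  "interior_product y w I = (\<Sum>i\<in>- I. fsign i (insert i I) * y $ i * w (insert i I))"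

text \<open>The pullback of \<open>w\<close> under \<open>x \<mapsto> x + e x *\<^sub>R y\<close>. Since this map is a rank-one perturbation of the
  identity, the pullback is just \<open>w + de \<and> \<iota>\<^sub>y w\<close>, evaluated at the image point.\<close>

definition pull :: "((real,'n) vec \<Rightarrow> real) \<Rightarrow> ((real,'n) vec \<Rightarrow> (real,'n) vec) \<Rightarrow> (real,'n) vec \<Rightarrow> ((real,'n) vec \<Rightarrow> 'n::{finite,linorder} set \<Rightarrow> real)
    \<Rightarrow> (real,'n) vec \<Rightarrow> 'n set \<Rightarrow> real" where
  "pull e e' y w x K = w (x + e x *\<^sub>R y) K
     + (\<Sum>k\<in>K. fsign k K * e' x $ k * interior_product y (w (x + e x *\<^sub>R y)) (K - {k}))"

text \<open>\<open>D K\<close> stands for the gradient at one point of the coefficient with index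
  set \<open>K\<close>, so the hypothesis is \<open>dw = 0\<close> at that point. By Cartan's
  formula the derivative of \<open>w\<close> along the constant field \<open>y\<close> is the
  exterior derivative of the contraction plus the contraction of \<open>dw\<close>, and the latter
  vanishes.\<close>

lemma cartan_formula_at_point:
  fixes D :: "'n::{finite,linorder} set \<Rightarrow> (real,'n) vec"
  assumes closed: "\<And>J. card J = Suc r \<Longrightarrow> (\<Sum>j\<in>J. fsign j J * D (J - {j}) $ j) = 0"
    and I: "card I = r"
  shows "(\<Sum>j\<in>I. fsign j I * (\<Sum>i\<in>- (I - {j}). fsign i (insert i (I - {j})) * y $ i * D (insert i (I - {j})) $ j)) = D I \<bullet> y"
proof -
  have inner: "(\<Sum>i\<in>- (I - {j}). fsign i (insert i (I - {j})) * y $ i * D (insert i (I - {j})) $ j)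
     = fsign j I * y $ j * D I $ j + (\<Sum>i\<in>- I. fsign i (insert i (I - {j})) * y $ i * D (insert i (I - {j})) $ j)"
    if "j \<in> I" for j
  proof -
    have "- (I - {j}) = insert j (- I)" by auto
    then show ?thesis using that by (simp add: insert_absorb)
  qed
  have "(\<Sum>j\<in>I. fsign j I * (\<Sum>i\<in>- (I - {j}). fsign i (insert i (I - {j})) * y $ i * D (insert i (I - {j})) $ j))
     = (\<Sum>j\<in>I. fsign j I * (fsign j I * y $ j * D I $ j + (\<Sum>i\<in>- I. fsign i (insert i (I - {j})) * y $ i * D (insert i (I - {j})) $ j)))"
    by (intro sum.cong refl arg_cong2[where f="(*)"] inner)
  also have "\<dots> = (\<Sum>j\<in>I. fsign j I * fsign j I * (y $ j * D I $ j))
      + (\<Sum>j\<in>I. \<Sum>i\<in>- I. y $ i * ((fsign j I * fsign i (insert i (I - {j}))) * D (insert i (I - {j})) $ j))"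
    by (simp add: distrib_left sum.distrib sum_distrib_left mult_ac)
  also have "(\<Sum>j\<in>I. \<Sum>i\<in>- I. y $ i * ((fsign j I * fsign i (insert i (I - {j}))) * D (insert i (I - {j})) $ j))
     = (\<Sum>i\<in>- I. \<Sum>j\<in>I. y $ i * ((fsign j I * fsign i (insert i (I - {j}))) * D (insert i (I - {j})) $ j))"
    by (rule sum.swap)
  also have "\<dots> = (\<Sum>i\<in>- I. y $ i * D I $ i)"
  proof (rule sum.cong[OF refl])
    fix i assume i: "i \<in> - I"
    \<comment> \<open>Closedness on this index set trades the mixed terms over
      \<open>j \<in> I\<close> for the single derivative \<open>D I $ i\<close>.\<close>
    let ?J = "insert i I"
    have "(\<Sum>j\<in>?J. fsign j ?J * D (?J - {j}) $ j) = 0" using i I by (intro closed) simp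
    moreover have "?J - {i} = I" using i by auto
    ultimately have c: "(\<Sum>j\<in>I. fsign j ?J * D (?J - {j}) $ j) = - (fsign i ?J * D I $ i)"
      using i by simp
    have "(\<Sum>j\<in>I. y $ i * ((fsign j I * fsign i (insert i (I - {j}))) * D (insert i (I - {j})) $ j))
        = (\<Sum>j\<in>I. - (y $ i * fsign i ?J) * (fsign j ?J * D (?J - {j}) $ j))"
    proof (rule sum.cong[OF refl])
      fix j assume j: "j \<in> I"
      have "insert i (I - {j}) = ?J - {j}" using i j by auto
      then show "y $ i * ((fsign j I * fsign i (insert i (I - {j}))) * D (insert i (I - {j})) $ j)
          = - (y $ i * fsign i ?J) * (fsign j ?J * D (?J - {j}) $ j)"
        using fsign_exchange[OF j, of i] i by (simp add: mult_ac)
    qed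
    also have "\<dots> = - (y $ i * fsign i ?J) * (\<Sum>j\<in>I. fsign j ?J * D (?J - {j}) $ j)"
      by (simp only: sum_distrib_left)
    also have "\<dots> = (fsign i ?J * fsign i ?J) * (y $ i * D I $ i)" unfolding c by (simp add: mult_ac)
    finally show "(\<Sum>j\<in>I. y $ i * ((fsign j I * fsign i (insert i (I - {j}))) * D (insert i (I - {j})) $ j)) = y $ i * D I $ i"
      by (simp only: fsign_square mult_1)
  qed
  also have "(\<Sum>j\<in>I. fsign j I * fsign j I * (y $ j * D I $ j)) + (\<Sum>i\<in>- I. y $ i * D I $ i) = (\<Sum>i\<in>UNIV. y $ i * D I $ i)"
    using sum.union_disjoint[of I "- I" "\<lambda>i. y $ i * D I $ i"] by (simp add: fsign_square Compl_partition)
  finally show ?thesis by (simp add: inner_vec_def mult.commute)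
qed

text \<open>Here \<open>p\<close> plays the part of \<open>e' x\<close> and is treated as constant;
  the second derivatives of \<open>e\<close> are dealt with under the integral. The two sums come
  from differentiating the displaced \<open>w\<close> and the wedge product of \<open>p\<close> with
  its contraction. Terms quadratic in \<open>p\<close> contain \<open>p\<close> wedged with itself,
  the linear ones cancel by Cartan's formula, and those free of \<open>p\<close> vanish because
  \<open>w\<close> is closed.\<close>

lemma pull_exterior_derivative_at_point:
  fixes D :: "'n::{finite,linorder} set \<Rightarrow> (real,'n) vec"
  assumes closed: "\<And>J. card J = Suc r \<Longrightarrow> (\<Sum>j\<in>J. fsign j J * D (J - {j}) $ j) = 0"
    and J: "card J = Suc r"
  shows "(\<Sum>j\<in>J. fsign j J * (D (J - {j}) + (D (J - {j}) \<bullet> y) *\<^sub>R p) $ j)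
     + (\<Sum>j\<in>J. \<Sum>k\<in>J - {j}. fsign j J * fsign k (J - {j}) * (p $ k *
         (\<Sum>i\<in>- (J - {j} - {k}). fsign i (insert i (J - {j} - {k})) * y $ i *
            (D (insert i (J - {j} - {k})) + (D (insert i (J - {j} - {k})) \<bullet> y) *\<^sub>R p) $ j))) = 0"
proof -
  define G where "G I v = (\<Sum>i\<in>- I. fsign i (insert i I) * y $ i * (D (insert i I) \<bullet> v))" for I v
  have split: "(\<Sum>i\<in>- I. fsign i (insert i I) * y $ i * (D (insert i I) + (D (insert i I) \<bullet> y) *\<^sub>R p) $ j)
      = G I (axis j 1) + G I y * p $ j" for I j
    by (simp add: G_def distrib_left sum.distrib sum_distrib_right inner_axis mult.assoc)
  have JJ: "J - {k} - {j} = J - {j} - {k}" for j k by auto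
  have 1: "(\<Sum>j\<in>J. \<Sum>k\<in>J - {j}. fsign j J * fsign k (J - {j}) * (p $ k * (G (J - {j} - {k}) y * p $ j))) = 0"
  proof (rule sum_antisymmetric)
    fix j k assume "j \<in> J" "k \<in> J" "j \<noteq> k"
    then show "fsign k J * fsign j (J - {k}) * (p $ j * (G (J - {k} - {j}) y * p $ k))
        = - (fsign j J * fsign k (J - {j}) * (p $ k * (G (J - {j} - {k}) y * p $ j)))"
      using fsign_swap[of j J k] by (simp add: JJ[of k j] mult_ac)
  qed simp
  \<comment> \<open>Exchanging the roles of the two removed indices costs a sign and makes the inner
    sum the left side of Cartan's formula for \<open>J - {k}\<close>.\<close>
  have 2: "(\<Sum>j\<in>J. \<Sum>k\<in>J - {j}. fsign j J * fsign k (J - {j}) * (p $ k * G (J - {j} - {k}) (axis j 1)))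
      = - (\<Sum>k\<in>J. fsign k J * p $ k * (D (J - {k}) \<bullet> y))"
  proof -
    have "(\<Sum>j\<in>J. \<Sum>k\<in>J - {j}. fsign j J * fsign k (J - {j}) * (p $ k * G (J - {j} - {k}) (axis j 1)))
        = (\<Sum>j\<in>J. \<Sum>k\<in>{k. k \<in> J \<and> j \<noteq> k}. fsign j J * fsign k (J - {j}) * (p $ k * G (J - {j} - {k}) (axis j 1)))"
      by (intro sum.cong) auto
    also have "\<dots> = (\<Sum>k\<in>J. \<Sum>j\<in>{j. j \<in> J \<and> j \<noteq> k}. fsign j J * fsign k (J - {j}) * (p $ k * G (J - {j} - {k}) (axis j 1)))"
      by (rule sum.swap_restrict) auto
    also have "\<dots> = (\<Sum>k\<in>J. - (fsign k J * p $ k) * (\<Sum>j\<in>J - {k}. fsign j (J - {k}) * G (J - {k} - {j}) (axis j 1)))"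
      unfolding sum_distrib_left
    proof (intro sum.cong refl)
      fix k j assume "k \<in> J" "j \<in> J - {k}"
      then show "fsign j J * fsign k (J - {j}) * (p $ k * G (J - {j} - {k}) (axis j 1))
         = - (fsign k J * p $ k) * (fsign j (J - {k}) * G (J - {k} - {j}) (axis j 1))"
        using fsign_swap[of j J k] by (simp add: JJ[of k j] mult_ac)
    qed auto
    also have "\<dots> = (\<Sum>k\<in>J. - (fsign k J * p $ k) * (D (J - {k}) \<bullet> y))"
    proof (rule sum.cong[OF refl])
      fix k assume "k \<in> J"
      then have "card (J - {k}) = r" using J by simp
      from cartan_formula_at_point[OF closed this, of y]
      show "- (fsign k J * p $ k) * (\<Sum>j\<in>J - {k}. fsign j (J - {k}) * G (J - {k} - {j}) (axis j 1))
         = - (fsign k J * p $ k) * (D (J - {k}) \<bullet> y)"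
        by (simp add: G_def inner_axis)
    qed
    finally show ?thesis by (simp add: sum_negf)
  qed
  have 3: "(\<Sum>j\<in>J. fsign j J * (D (J - {j}) + (D (J - {j}) \<bullet> y) *\<^sub>R p) $ j)
      = (\<Sum>k\<in>J. fsign k J * p $ k * (D (J - {k}) \<bullet> y))"
    using closed[OF J] by (simp add: distrib_left sum.distrib mult_ac)
  show ?thesis
    unfolding split 3 using 1 2 by (simp add: distrib_left sum.distrib)
qed

text \<open>Partial integration would put a second derivative on \<open>e\<close>, which is only C1.
  Instead the product rule isolates \<open>E j k\<close>, the integral of \<open>e' x $ k\<close>
  against the j-th derivative of a C1 function. It is symmetric in \<open>j\<close> and
  \<open>k\<close>, so it drops out of the alternating sum, and the remaining integrands add up to
  \<open>\<phi>\<close> times the pointwise identity, hence to zero.\<close>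

lemma pull_closed_C1:
  fixes w :: "(real, 'n::{finite,linorder}) vec \<Rightarrow> 'n set \<Rightarrow> real"
  assumes w: "\<And>K. card K = r \<Longrightarrow> C1_periodic (\<lambda>x. w x K) (W K)"
    and closed: "\<And>J x. card J = Suc r \<Longrightarrow> (\<Sum>j\<in>J. fsign j J * W (J - {j}) x $ j) = 0"
    and e: "C1_periodic e e'" and \<phi>: "C1_periodic \<phi> \<phi>'" and J: "card J = Suc r"
  shows "(\<Sum>j\<in>J. fsign j J * (\<integral>x. pull e e' y w x (J - {j}) * \<phi>' x $ j \<partial>torus)) = 0"
proof -
  define P where "P x = x + e x *\<^sub>R y" for x
  define U where "U K x = W K (P x) + (W K (P x) \<bullet> y) *\<^sub>R e' x" for K x
  have u: "C1_periodic (\<lambda>x. w (P x) K) (U K)" if "card K = r" for K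
    unfolding U_def P_def by (rule C1_periodic_pullback[OF w[OF that] e])
  define g where "g I x = interior_product y (w (P x)) I" for I x
  define g' where "g' I x = (\<Sum>i\<in>- I. (fsign i (insert i I) * y $ i) *\<^sub>R U (insert i I) x)" for I x
  have cI: "card (insert i (J - {j} - {k})) = r" if "j \<in> J" "k \<in> J - {j}" "i \<in> - (J - {j} - {k})" for i j k
  proof -
    have "card (J - {j} - {k}) = r - 1" "r \<ge> 1"
      using that J card_gt_0_iff[of "J - {j}"] by (auto simp: card_Diff_singleton_if)
    then show ?thesis using that by (auto simp: card_insert_if)
  qed
  have g: "C1_periodic (g (J - {j} - {k})) (g' (J - {j} - {k}))" if "j \<in> J" "k \<in> J - {j}" for j k
    unfolding g_def g'_def interior_product_def
    by (intro C1_periodic_sum C1_periodic_scale u cI that) auto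
  have cK: "card (J - {j}) = r" if "j \<in> J" for j using J that by simp
  have cont: "continuous_on UNIV (\<lambda>x. f x $ i)" if "continuous_on UNIV f" for f :: "(real,'n) vec \<Rightarrow> (real,'n) vec" and i
    using that by (intro continuous_intros)
  have per: "lattice_periodic (\<lambda>x. f x $ i)" if "lattice_periodic f" for f :: "(real,'n) vec \<Rightarrow> (real,'n) vec" and i
    using that by (auto simp: lattice_periodic_def)
  note e'c = C1_periodicD(3)[OF e] and e'p = C1_periodic_gradient_periodic[OF e]
  note \<phi>c = C1_periodicD(4)[OF \<phi>] and \<phi>p = C1_periodicD(1)[OF \<phi>]
  note \<phi>'c = C1_periodicD(3)[OF \<phi>] and \<phi>'p = C1_periodic_gradient_periodic[OF \<phi>]
  have perm: "lattice_periodic (\<lambda>x. f x * h x)" if "lattice_periodic f" "lattice_periodic h" for f h :: "(real,'n) vec \<Rightarrow> real"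
    using that by (auto simp: lattice_periodic_def)
  have iu: "integrable torus (\<lambda>x. w (P x) (J - {j}) * \<phi>' x $ j)" if "j \<in> J" for j
    by (intro torus_integrable_continuous continuous_on_mult perm cont per \<phi>'c \<phi>'p C1_periodicD(1,4)[OF u[OF cK[OF that]]])
  have ig: "integrable torus (\<lambda>x. e' x $ k * g (J - {j} - {k}) x * \<phi>' x $ j)" if "j \<in> J" "k \<in> J - {j}" for j k
    by (intro torus_integrable_continuous continuous_on_mult perm cont per \<phi>'c \<phi>'p e'c e'p C1_periodicD(1,4)[OF g[OF that]])
  \<comment> \<open>The factor after \<open>e' x $ k\<close> is the j-th partial derivative of the
    product of \<open>\<phi>\<close> with the contraction for the index set without \<open>j\<close>
    and \<open>k\<close>.\<close>
  define E where "E j k = (\<integral>x. e' x $ k * (\<phi> x *\<^sub>R g' (J - {j} - {k}) x + g (J - {j} - {k}) x *\<^sub>R \<phi>' x) $ j \<partial>torus)" for j k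
  have parts: "(\<integral>x. e' x $ k * g (J - {j} - {k}) x * \<phi>' x $ j \<partial>torus)
     = E j k - (\<integral>x. \<phi> x * (e' x $ k * g' (J - {j} - {k}) x $ j) \<partial>torus)" if jk: "j \<in> J" "k \<in> J - {j}" for j k
  proof -
    have i2: "integrable torus (\<lambda>x. \<phi> x * (e' x $ k * g' (J - {j} - {k}) x $ j))"
      by (intro torus_integrable_continuous continuous_on_mult perm cont per \<phi>c \<phi>p e'c e'p
           C1_periodicD(3)[OF g[OF jk]] C1_periodic_gradient_periodic[OF g[OF jk]])
    have "E j k = (\<integral>x. e' x $ k * g (J - {j} - {k}) x * \<phi>' x $ j + \<phi> x * (e' x $ k * g' (J - {j} - {k}) x $ j) \<partial>torus)"
      unfolding E_def by (simp add: algebra_simps)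
    also have "\<dots> = (\<integral>x. e' x $ k * g (J - {j} - {k}) x * \<phi>' x $ j \<partial>torus) + (\<integral>x. \<phi> x * (e' x $ k * g' (J - {j} - {k}) x $ j) \<partial>torus)"
      by (rule Bochner_Integration.integral_add[OF ig[OF jk] i2])
    finally show ?thesis by simp
  qed
  have JJ: "J - {k} - {j} = J - {j} - {k}" for j k by auto
  have Esym: "E k j = E j k" if jk: "j \<in> J" "k \<in> J - {j}" for j k
    using torus_integral_gradients_symmetric[OF e C1_periodic_mult[OF \<phi> g[OF jk]], of "axis j 1" "axis k 1"]
    unfolding E_def JJ[of k j] by (simp add: inner_axis)
  have Esum: "(\<Sum>j\<in>J. \<Sum>k\<in>J - {j}. fsign j J * fsign k (J - {j}) * E j k) = 0"
  proof (rule sum_antisymmetric)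
    fix j k assume "j \<in> J" "k \<in> J" "j \<noteq> k"
    then show "fsign k J * fsign j (J - {k}) * E k j = - (fsign j J * fsign k (J - {j}) * E j k)"
      using fsign_swap[of j J k] Esym[of j k] by simp
  qed simp
  define S1 where "S1 j x = \<phi> x * U (J - {j}) x $ j" for j x
  define S2 where "S2 j k x = \<phi> x * (e' x $ k * g' (J - {j} - {k}) x $ j)" for j k x
  have iS1: "integrable torus (S1 j)" if "j \<in> J" for j
    unfolding S1_def by (intro torus_integrable_continuous continuous_on_mult perm cont per \<phi>c \<phi>p
        C1_periodicD(3)[OF u[OF cK[OF that]]] C1_periodic_gradient_periodic[OF u[OF cK[OF that]]])
  have iS2: "integrable torus (S2 j k)" if jk: "j \<in> J" "k \<in> J - {j}" for j k
    unfolding S2_def by (intro torus_integrable_continuous continuous_on_mult perm cont per \<phi>c \<phi>p e'c e'p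
           C1_periodicD(3)[OF g[OF jk]] C1_periodic_gradient_periodic[OF g[OF jk]])
  have summand: "(\<integral>x. pull e e' y w x (J - {j}) * \<phi>' x $ j \<partial>torus)
      = - (\<integral>x. S1 j x \<partial>torus) + (\<Sum>k\<in>J - {j}. fsign k (J - {j}) * (E j k - (\<integral>x. S2 j k x \<partial>torus)))" if j: "j \<in> J" for j
  proof -
    have "(\<integral>x. pull e e' y w x (J - {j}) * \<phi>' x $ j \<partial>torus)
        = (\<integral>x. w (P x) (J - {j}) * \<phi>' x $ j + (\<Sum>k\<in>J - {j}. fsign k (J - {j}) * (e' x $ k * g (J - {j} - {k}) x * \<phi>' x $ j)) \<partial>torus)"
      unfolding pull_def g_def P_def by (simp add: distrib_left sum_distrib_left mult_ac)
    also have "\<dots> = (\<integral>x. w (P x) (J - {j}) * \<phi>' x $ j \<partial>torus)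
        + (\<Sum>k\<in>J - {j}. fsign k (J - {j}) * (\<integral>x. e' x $ k * g (J - {j} - {k}) x * \<phi>' x $ j \<partial>torus))"
    proof -
      have *: "integrable torus (\<lambda>x. fsign k (J - {j}) * (e' x $ k * g (J - {j} - {k}) x * \<phi>' x $ j))" if "k \<in> J - {j}" for k
        by (intro integrable_mult_right ig j that)
      have "(\<integral>x. (\<Sum>k\<in>J - {j}. fsign k (J - {j}) * (e' x $ k * g (J - {j} - {k}) x * \<phi>' x $ j)) \<partial>torus)
         = (\<Sum>k\<in>J - {j}. \<integral>x. fsign k (J - {j}) * (e' x $ k * g (J - {j} - {k}) x * \<phi>' x $ j) \<partial>torus)"
        by (rule Bochner_Integration.integral_sum) (rule *)
      then show ?thesis
        by (subst Bochner_Integration.integral_add[OF iu[OF j] Bochner_Integration.integrable_sum[OF *]]) simp_all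
    qed
    also have "(\<integral>x. w (P x) (J - {j}) * \<phi>' x $ j \<partial>torus) = - (\<integral>x. S1 j x \<partial>torus)"
      using torus_integral_by_parts[OF u[OF cK[OF j]] \<phi>, of "axis j 1"]
      by (simp add: inner_axis S1_def mult.commute)
    finally show ?thesis using parts[OF j] by (simp add: S2_def)
  qed
  have "(\<Sum>j\<in>J. fsign j J * (\<integral>x. pull e e' y w x (J - {j}) * \<phi>' x $ j \<partial>torus))
      = (\<Sum>j\<in>J. fsign j J * (- (\<integral>x. S1 j x \<partial>torus) + (\<Sum>k\<in>J - {j}. fsign k (J - {j}) * (E j k - (\<integral>x. S2 j k x \<partial>torus)))))"
    by (intro sum.cong refl arg_cong2[where f="(*)"] summand)
  also have "\<dots> = (\<Sum>j\<in>J. \<Sum>k\<in>J - {j}. fsign j J * fsign k (J - {j}) * E j k)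
      - ((\<Sum>j\<in>J. fsign j J * (\<integral>x. S1 j x \<partial>torus)) + (\<Sum>j\<in>J. \<Sum>k\<in>J - {j}. fsign j J * fsign k (J - {j}) * (\<integral>x. S2 j k x \<partial>torus)))"
    by (simp add: distrib_left right_diff_distrib sum.distrib sum_subtractf sum_distrib_left sum_negf mult.assoc)
  also have "(\<Sum>j\<in>J. fsign j J * (\<integral>x. S1 j x \<partial>torus)) + (\<Sum>j\<in>J. \<Sum>k\<in>J - {j}. fsign j J * fsign k (J - {j}) * (\<integral>x. S2 j k x \<partial>torus))
     = (\<integral>x. (\<Sum>j\<in>J. fsign j J * S1 j x) + (\<Sum>j\<in>J. \<Sum>k\<in>J - {j}. fsign j J * fsign k (J - {j}) * S2 j k x) \<partial>torus)"
  proof -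
    have a: "(\<integral>x. (\<Sum>j\<in>J. fsign j J * S1 j x) \<partial>torus) = (\<Sum>j\<in>J. fsign j J * (\<integral>x. S1 j x \<partial>torus))"
      by (subst Bochner_Integration.integral_sum) (auto intro: integrable_mult_right iS1)
    have b: "(\<integral>x. (\<Sum>j\<in>J. \<Sum>k\<in>J - {j}. fsign j J * fsign k (J - {j}) * S2 j k x) \<partial>torus)
        = (\<Sum>j\<in>J. \<Sum>k\<in>J - {j}. fsign j J * fsign k (J - {j}) * (\<integral>x. S2 j k x \<partial>torus))"
    proof -
      have "(\<integral>x. (\<Sum>j\<in>J. \<Sum>k\<in>J - {j}. fsign j J * fsign k (J - {j}) * S2 j k x) \<partial>torus)
         = (\<Sum>j\<in>J. \<integral>x. (\<Sum>k\<in>J - {j}. fsign j J * fsign k (J - {j}) * S2 j k x) \<partial>torus)"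
        by (intro Bochner_Integration.integral_sum Bochner_Integration.integrable_sum integrable_mult_right iS2)
      also have "\<dots> = (\<Sum>j\<in>J. \<Sum>k\<in>J - {j}. \<integral>x. fsign j J * fsign k (J - {j}) * S2 j k x \<partial>torus)"
        by (intro sum.cong refl Bochner_Integration.integral_sum integrable_mult_right iS2)
      finally show ?thesis by simp
    qed
    show ?thesis
      unfolding a[symmetric] b[symmetric]
      by (intro Bochner_Integration.integral_add[symmetric] Bochner_Integration.integrable_sum integrable_mult_right iS1 iS2)
  qed
  also have "(\<lambda>x. (\<Sum>j\<in>J. fsign j J * S1 j x) + (\<Sum>j\<in>J. \<Sum>k\<in>J - {j}. fsign j J * fsign k (J - {j}) * S2 j k x)) = (\<lambda>x. 0)"
  proof
    fix x
    have comp: "g' I x $ j = (\<Sum>i\<in>- I. fsign i (insert i I) * y $ i * U (insert i I) x $ j)" for I j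
      by (simp add: g'_def)
    have "(\<Sum>j\<in>J. fsign j J * S1 j x) + (\<Sum>j\<in>J. \<Sum>k\<in>J - {j}. fsign j J * fsign k (J - {j}) * S2 j k x)
      = \<phi> x * ((\<Sum>j\<in>J. fsign j J * U (J - {j}) x $ j)
         + (\<Sum>j\<in>J. \<Sum>k\<in>J - {j}. fsign j J * fsign k (J - {j}) * (e' x $ k * g' (J - {j} - {k}) x $ j)))"
      unfolding S1_def S2_def by (simp add: distrib_left sum_distrib_left mult_ac)
    also have "\<dots> = 0"
      using pull_exterior_derivative_at_point[of r "\<lambda>K. W K (P x)", OF closed J, of y "e' x"]
      unfolding comp U_def by simp
    finally show "(\<Sum>j\<in>J. fsign j J * S1 j x) + (\<Sum>j\<in>J. \<Sum>k\<in>J - {j}. fsign j J * fsign k (J - {j}) * S2 j k x) = 0" .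
  qed
  finally show ?thesis using Esum by simp
qed


section \<open>Closedness of pullbacks of integrable forms\<close>

definition torus_closed :: "nat \<Rightarrow> ((real,'n::{finite,linorder}) vec \<Rightarrow> 'n set \<Rightarrow> real) \<Rightarrow> bool" where
  "torus_closed r w \<longleftrightarrow> (\<forall>J \<phi>. card J = Suc r \<and> smooth_fun \<phi> \<and> periodic_fun \<phi> \<longrightarrow>
     (\<Sum>j\<in>J. fsign j J * (\<integral>x. w x (J - {j}) * pderiv j \<phi> x \<partial>torus)) = 0)"

text \<open>Coefficients are Borel and periodic at every point rather than almost everywhere: the
  displaced form \<open>w (x + e x *\<^sub>R y)\<close> is then defined pointwise and measurable
  without attention to null sets.\<close>

definition periodic_L1_form :: "nat \<Rightarrow> ((real,'n::{finite,linorder}) vec \<Rightarrow> 'n set \<Rightarrow> real) \<Rightarrow> bool" where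
  "periodic_L1_form r w \<longleftrightarrow> (\<forall>K. card K = r \<longrightarrow>
     (\<lambda>x. w x K) \<in> borel_measurable borel \<and> integrable torus (\<lambda>x. w x K) \<and> lattice_periodic (\<lambda>x. w x K))"

lemma card_exchange:
  fixes K :: "'n::finite set"
  assumes "k \<in> K" "i \<in> - (K - {k})"
  shows "card (insert i (K - {k})) = card K"
proof -
  have "card (insert i (K - {k})) = Suc (card (K - {k}))" using assms by (intro card_insert_disjoint) auto
  also have "\<dots> = card K" using assms by (intro card_Suc_Diff1) auto
  finally show ?thesis .
qed

text \<open>Each displaced coefficient of \<open>w\<close> is separated from the factor
  \<open>e' x $ k * a\<close>; with continuous \<open>a\<close>, this is the shape in which
  integrability and weak convergence of displaced coefficients apply term by term.\<close>

lemma pull_mult_expand: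
  "pull e e' y w x K * a = w (x + e x *\<^sub>R y) K * a
    + (\<Sum>k\<in>K. \<Sum>i\<in>- (K - {k}). (fsign k K * fsign i (insert i (K - {k})) * y $ i)
         * (w (x + e x *\<^sub>R y) (insert i (K - {k})) * (e' x $ k * a)))"
  unfolding pull_def interior_product_def
  by (simp add: distrib_left sum_distrib_left mult_ac)

lemma
  fixes w :: "(real, 'n::{finite,linorder}) vec \<Rightarrow> 'n set \<Rightarrow> real"
  assumes e: "small_gradient e e'" and y: "norm y \<le> 1" and w: "periodic_L1_form r w"
    and ac: "continuous_on UNIV a" and ap: "lattice_periodic a" and K: "card K = r"
  shows pull_mult_integrable: "integrable torus (\<lambda>x. pull e e' y w x K * a x)"
    and pull_mult_integral: "(\<integral>x. pull e e' y w x K * a x \<partial>torus) = (\<integral>x. w (x + e x *\<^sub>R y) K * a x \<partial>torus)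
      + (\<Sum>k\<in>K. \<Sum>i\<in>- (K - {k}). (fsign k K * fsign i (insert i (K - {k})) * y $ i)
         * (\<integral>x. w (x + e x *\<^sub>R y) (insert i (K - {k})) * (e' x $ k * a x) \<partial>torus))"
proof -
  note e1 = small_gradientD[OF e y]
  note [measurable] = C1_periodic_measurable[OF e1(1)]
  have wI: "integrable torus (\<lambda>x. w (x + e x *\<^sub>R y) I * b x)"
    if I: "card I = r" and bc: "continuous_on UNIV b" and bp: "lattice_periodic b" for I b
  proof -
    have [measurable]: "(\<lambda>x. w x I) \<in> borel_measurable borel" using w I by (auto simp: periodic_L1_form_def)
    have [measurable]: "b \<in> borel_measurable borel" using bc by (rule borel_measurable_continuous_onI)
    obtain B where B: "\<And>x. norm (b x) \<le> B" using periodic_continuous_bounded[OF bc bp] by metis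
    have "integrable torus (\<lambda>x. w (x + e x *\<^sub>R y) I)"
      by (rule flow_integrable[OF e y]) (use w I in \<open>auto simp: periodic_L1_form_def\<close>)
    then show ?thesis by (rule torus_integrable_mult_bounded[OF _ _ _ B]) measurable
  qed
  have b: "continuous_on UNIV (\<lambda>x. e' x $ k * a x)" "lattice_periodic (\<lambda>x. e' x $ k * a x)" for k
  proof -
    show "continuous_on UNIV (\<lambda>x. e' x $ k * a x)" by (intro continuous_intros C1_periodicD(3)[OF e1(1)] ac)
    show "lattice_periodic (\<lambda>x. e' x $ k * a x)"
      by (intro lattice_periodicI) (simp add: lattice_periodicD[OF C1_periodic_gradient_periodic[OF e1(1)]] lattice_periodicD[OF ap])
  qed
  have I: "integrable torus (\<lambda>x. (fsign k K * fsign i (insert i (K - {k})) * y $ i)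
         * (w (x + e x *\<^sub>R y) (insert i (K - {k})) * (e' x $ k * a x)))" if "k \<in> K" "i \<in> - (K - {k})" for k i
    by (intro integrable_mult_right wI b) (simp only: card_exchange[OF that] K)
  have S: "integrable torus (\<lambda>x. \<Sum>k\<in>K. \<Sum>i\<in>- (K - {k}). (fsign k K * fsign i (insert i (K - {k})) * y $ i)
         * (w (x + e x *\<^sub>R y) (insert i (K - {k})) * (e' x $ k * a x)))"
    by (intro Bochner_Integration.integrable_sum I)
  show "integrable torus (\<lambda>x. pull e e' y w x K * a x)"
    unfolding pull_mult_expand by (intro Bochner_Integration.integrable_add wI K ac ap S)
  have "(\<integral>x. pull e e' y w x K * a x \<partial>torus) = (\<integral>x. w (x + e x *\<^sub>R y) K * a x \<partial>torus)
      + (\<integral>x. (\<Sum>k\<in>K. \<Sum>i\<in>- (K - {k}). (fsign k K * fsign i (insert i (K - {k})) * y $ i)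
         * (w (x + e x *\<^sub>R y) (insert i (K - {k})) * (e' x $ k * a x))) \<partial>torus)"
    unfolding pull_mult_expand by (intro Bochner_Integration.integral_add wI K ac ap S)
  also have "(\<integral>x. (\<Sum>k\<in>K. \<Sum>i\<in>- (K - {k}). (fsign k K * fsign i (insert i (K - {k})) * y $ i)
         * (w (x + e x *\<^sub>R y) (insert i (K - {k})) * (e' x $ k * a x))) \<partial>torus)
     = (\<Sum>k\<in>K. \<integral>x. (\<Sum>i\<in>- (K - {k}). (fsign k K * fsign i (insert i (K - {k})) * y $ i)
         * (w (x + e x *\<^sub>R y) (insert i (K - {k})) * (e' x $ k * a x))) \<partial>torus)"
    by (intro Bochner_Integration.integral_sum Bochner_Integration.integrable_sum I)
  also have "\<dots> = (\<Sum>k\<in>K. \<Sum>i\<in>- (K - {k}). \<integral>x. (fsign k K * fsign i (insert i (K - {k})) * y $ i)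
         * (w (x + e x *\<^sub>R y) (insert i (K - {k})) * (e' x $ k * a x)) \<partial>torus)"
    by (intro sum.cong refl Bochner_Integration.integral_sum I)
  finally show "(\<integral>x. pull e e' y w x K * a x \<partial>torus) = (\<integral>x. w (x + e x *\<^sub>R y) K * a x \<partial>torus)
      + (\<Sum>k\<in>K. \<Sum>i\<in>- (K - {k}). (fsign k K * fsign i (insert i (K - {k})) * y $ i)
         * (\<integral>x. w (x + e x *\<^sub>R y) (insert i (K - {k})) * (e' x $ k * a x) \<partial>torus))"
    by (simp only: integral_mult_right_zero)
qed

text \<open>The convolutions \<open>wm m\<close> have C1 coefficients and are closed at every point,
  because the reflected kernel is a test function for \<open>w\<close>; hence their pullbacks are
  closed. For a fixed test function the tested pullbacks of \<open>wm m\<close> converge to that of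
  \<open>w\<close>, term by term in the expansion of \<open>pull\<close>.\<close>

lemma pull_closed:
  fixes w :: "(real, 'n::{finite,linorder}) vec \<Rightarrow> 'n set \<Rightarrow> real"
  assumes e: "small_gradient e e'" and y: "norm y \<le> 1" and w: "periodic_L1_form r w"
    and closed: "torus_closed r w"
  shows "torus_closed r (pull e e' y w)"
  unfolding torus_closed_def
proof (intro allI impI)
  fix J :: "'n set" and \<phi> :: "(real,'n) vec \<Rightarrow> real" assume "card J = Suc r \<and> smooth_fun \<phi> \<and> periodic_fun \<phi>"
  then have J: "card J = Suc r" and \<phi>: "smooth_fun \<phi>" "periodic_fun \<phi>" by auto
  note e1 = small_gradientD[OF e y]
  define \<phi>' where "\<phi>' x = (\<chi> j. pderiv j \<phi> x)" for x
  have \<phi>C: "C1_periodic \<phi> \<phi>'" unfolding \<phi>'_def by (rule smooth_C1_periodic[OF \<phi>])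
  have comp: "pderiv j \<phi> x = \<phi>' x $ j" for j x by (simp add: \<phi>'_def)
  have wK: "(\<lambda>x. w x K) \<in> borel_measurable borel" "integrable torus (\<lambda>x. w x K)" "lattice_periodic (\<lambda>x. w x K)"
    if "card K = r" for K using w that by (auto simp: periodic_L1_form_def)
  define wm where "wm m x K = (\<integral>z. torus_kernel m (x - z) * w z K \<partial>torus)" for m x K
  have zero: "(\<Sum>j\<in>J. fsign j J * (\<integral>x. pull e e' y (wm m) x (J - {j}) * \<phi>' x $ j \<partial>torus)) = 0"
    and wmL: "periodic_L1_form r (wm m)" for m
  proof -
    obtain D where D: "C1_periodic (torus_kernel m :: (real,'n) vec \<Rightarrow> real) D" using torus_kernel_C1 by blast
    note [measurable] = C1_periodic_measurable[OF D]
    obtain B where B: "\<And>x. norm (D x) \<le> B" using C1_periodic_bounds[OF D] by metis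
    define W where "W K x = (\<integral>z. w z K *\<^sub>R D (x - z) \<partial>torus)" for K x
    have C: "C1_periodic (\<lambda>x. wm m x K) (W K)" if "card K = r" for K
      unfolding wm_def W_def by (rule C1_periodic_convolution[OF D wK(1,2)[OF that]])
    show "periodic_L1_form r (wm m)"
      unfolding periodic_L1_form_def
      using C1_periodic_measurable(1)[OF C] C1_periodicD(1)[OF C]
        torus_integrable_continuous[OF C1_periodicD(4)[OF C] C1_periodicD(1)[OF C]] by blast
    have cl: "(\<Sum>j\<in>J. fsign j J * W (J - {j}) x $ j) = 0" if J: "card J = Suc r" for J x
    proof -
      \<comment> \<open>Differentiating in \<open>z\<close> instead of \<open>x\<close> changes the
        sign; since the sign is the same for all \<open>j\<close>, it does not affect a vanishing
        sum.\<close>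
      have pd: "pderiv j (\<lambda>z. torus_kernel m (x - z)) z = - (D (x - z) $ j)" for j z
      proof -
        have "((\<lambda>z. x - z) has_derivative (\<lambda>h. - h)) (at z)" by (auto intro!: derivative_eq_intros)
        from pderiv_eq[OF has_derivative_compose[OF this C1_periodicD(2)[OF D]], of j]
        show ?thesis by (simp add: inner_axis)
      qed
      have "W (J - {j}) x $ j = - (\<integral>z. w z (J - {j}) * pderiv j (\<lambda>z. torus_kernel m (x - z)) z \<partial>torus)" if j: "j \<in> J" for j
      proof -
        have cJ: "card (J - {j}) = r" using J j by simp
        note [measurable] = wK(1)[OF cJ]
        have "integrable torus (\<lambda>z. w z (J - {j}) *\<^sub>R D (x - z))"
        proof (rule Bochner_Integration.integrable_bound)
          show "integrable torus (\<lambda>z. B * \<bar>w z (J - {j})\<bar>)" using wK(2)[OF cJ] by simp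
          have "\<bar>w z (J - {j})\<bar> * norm (D (x - z)) \<le> \<bar>w z (J - {j})\<bar> * B" for z
            by (rule mult_left_mono[OF B]) simp
          then show "AE z in torus. norm (w z (J - {j}) *\<^sub>R D (x - z)) \<le> norm (B * \<bar>w z (J - {j})\<bar>)"
            using order_trans[OF norm_ge_zero B] by (intro AE_I2) (simp add: mult.commute abs_mult)
        qed measurable
        then have "W (J - {j}) x \<bullet> axis j 1 = (\<integral>z. (w z (J - {j}) *\<^sub>R D (x - z)) \<bullet> axis j 1 \<partial>torus)"
          unfolding W_def by (intro integral_inner_left[symmetric]) simp
        then show ?thesis by (simp add: inner_axis pd)
      qed
      then have "(\<Sum>j\<in>J. fsign j J * W (J - {j}) x $ j)
          = - (\<Sum>j\<in>J. fsign j J * (\<integral>z. w z (J - {j}) * pderiv j (\<lambda>z. torus_kernel m (x - z)) z \<partial>torus))"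
        by (simp add: sum_negf)
      also have "\<dots> = 0"
        using closed J torus_kernel_reflected[of m x] unfolding torus_closed_def by simp
      finally show ?thesis .
    qed
    show "(\<Sum>j\<in>J. fsign j J * (\<integral>x. pull e e' y (wm m) x (J - {j}) * \<phi>' x $ j \<partial>torus)) = 0"
      by (rule pull_closed_C1[OF C cl e1(1) \<phi>C J])
  qed
  have aj: "continuous_on UNIV (\<lambda>x. \<phi>' x $ j)" "lattice_periodic (\<lambda>x. \<phi>' x $ j)" for j
  proof -
    show "continuous_on UNIV (\<lambda>x. \<phi>' x $ j)" by (intro continuous_intros C1_periodicD(3)[OF \<phi>C])
    show "lattice_periodic (\<lambda>x. \<phi>' x $ j)"
      by (intro lattice_periodicI) (simp add: lattice_periodicD[OF C1_periodic_gradient_periodic[OF \<phi>C]])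
  qed
  have ak: "continuous_on UNIV (\<lambda>x. e' x $ k * \<phi>' x $ j)" "lattice_periodic (\<lambda>x. e' x $ k * \<phi>' x $ j)" for j k
  proof -
    show "continuous_on UNIV (\<lambda>x. e' x $ k * \<phi>' x $ j)"
      by (intro continuous_intros C1_periodicD(3)[OF e1(1)] C1_periodicD(3)[OF \<phi>C])
    show "lattice_periodic (\<lambda>x. e' x $ k * \<phi>' x $ j)"
      by (intro lattice_periodicI) (simp add: lattice_periodicD[OF C1_periodic_gradient_periodic[OF \<phi>C]]
          lattice_periodicD[OF C1_periodic_gradient_periodic[OF e1(1)]])
  qed
  have conv: "(\<lambda>m. \<integral>x. wm m (x + e x *\<^sub>R y) I * b x \<partial>torus) \<longlonglongrightarrow> (\<integral>x. w (x + e x *\<^sub>R y) I * b x \<partial>torus)"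
    if "card I = r" "continuous_on UNIV b" "lattice_periodic b" for I b
    unfolding wm_def by (rule flow_kernel_weak_convergence[OF e y wK[OF that(1)] that(2,3)])
  have "(\<lambda>m. \<Sum>j\<in>J. fsign j J * (\<integral>x. pull e e' y (wm m) x (J - {j}) * \<phi>' x $ j \<partial>torus))
      \<longlonglongrightarrow> (\<Sum>j\<in>J. fsign j J * (\<integral>x. pull e e' y w x (J - {j}) * \<phi>' x $ j \<partial>torus))"
  proof (rule tendsto_sum)
    fix j assume j: "j \<in> J"
    have cK: "card (J - {j}) = r" using J j by simp
    show "(\<lambda>m. fsign j J * (\<integral>x. pull e e' y (wm m) x (J - {j}) * \<phi>' x $ j \<partial>torus))
      \<longlonglongrightarrow> fsign j J * (\<integral>x. pull e e' y w x (J - {j}) * \<phi>' x $ j \<partial>torus)"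
      unfolding pull_mult_integral[OF e y w aj cK] pull_mult_integral[OF e y wmL aj cK]
      by (intro tendsto_mult tendsto_add tendsto_sum tendsto_const conv cK aj ak)
         (simp only: card_exchange cK)
  qed
  then have "(\<lambda>m::nat. 0) \<longlonglongrightarrow> (\<Sum>j\<in>J. fsign j J * (\<integral>x. pull e e' y w x (J - {j}) * \<phi>' x $ j \<partial>torus))"
    by (simp only: zero)
  then show "(\<Sum>j\<in>J. fsign j J * (\<integral>x. pull e e' y w x (J - {j}) * pderiv j \<phi> x \<partial>torus)) = 0"
    unfolding comp by (simp add: LIMSEQ_const_iff)
qed

section \<open>Averaging over displacement vectors in the unit ball\<close>

definition unit_ball_measure :: "(real,'n::finite) vec measure" where
  "unit_ball_measure = uniform_measure lborel (cball 0 1)"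

lemma sets_unit_ball_measure [simp, measurable_cong]: "sets unit_ball_measure = sets borel"
  by (simp add: unit_ball_measure_def)

lemma space_unit_ball_measure [simp]: "space unit_ball_measure = UNIV"
  by (simp add: unit_ball_measure_def)

lemma emeasure_unit_cball: "emeasure lborel (cball (0::'a::euclidean_space) 1) \<noteq> 0" "emeasure lborel (cball (0::'a::euclidean_space) 1) \<noteq> \<infinity>"
proof -
  have "measure lborel (cball (0::'a) 1) > 0" by (rule content_cball_pos) simp
  then show "emeasure lborel (cball (0::'a) 1) \<noteq> 0" by (auto simp: measure_def)
  show "emeasure lborel (cball (0::'a) 1) \<noteq> \<infinity>" using emeasure_lborel_cball_finite[of "0::'a" 1] by simp
qed

lemma emeasure_unit_ball_measure_UNIV: "emeasure unit_ball_measure UNIV = 1"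
proof -
  have "emeasure lborel (cball (0::(real,'a) vec) 1 \<inter> UNIV) / emeasure lborel (cball (0::(real,'a) vec) 1) = 1"
    using emeasure_unit_cball[where 'a="(real,'a) vec"] by (simp add: ennreal_divide_self less_top zero_less_iff_neq_zero)
  then show ?thesis unfolding unit_ball_measure_def by (subst emeasure_uniform_measure) auto
qed

lemma finite_unit_ball_measure: "finite_measure (unit_ball_measure :: (real,'n::finite) vec measure)"
  by standard (simp add: emeasure_unit_ball_measure_UNIV)

interpretation unit_ball: finite_measure "unit_ball_measure :: (real,'n::finite) vec measure"
  by (rule finite_unit_ball_measure)

lemma measure_unit_ball_measure_UNIV [simp]: "measure (unit_ball_measure :: (real,'n::finite) vec measure) UNIV = 1"
  by (simp add: measure_def emeasure_unit_ball_measure_UNIV)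

lemma AE_unit_ball_measure: "AE y in unit_ball_measure. norm y \<le> 1"
  unfolding unit_ball_measure_def by (rule AE_uniform_measureI) auto

text \<open>Comparable to \<open>form_norm\<close> up to the number of index sets. It bounds single
  coefficients, and its integrals split over them without square roots.\<close>

definition form_l1 :: "nat \<Rightarrow> ('n::finite set \<Rightarrow> real) \<Rightarrow> real" where
  "form_l1 r a = (\<Sum>K\<in>{K. card K = r}. \<bar>a K\<bar>)"

lemma form_l1_nonneg: "0 \<le> form_l1 r a"
  by (simp add: form_l1_def sum_nonneg)

lemma abs_le_form_l1: "card K = r \<Longrightarrow> \<bar>a K\<bar> \<le> form_l1 r a"
  unfolding form_l1_def by (rule member_le_sum[of K _ "\<lambda>K. \<bar>a K\<bar>"]) auto

text \<open>There are at most \<open>CARD('n)\<close> indices \<open>k\<close> in \<open>K\<close>,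
  and for each of them at most \<open>CARD('n)\<close> indices \<open>i\<close> in the contraction;
  the components of \<open>e' x\<close> and \<open>y\<close> are at most \<open>1\<close> in
  absolute value.\<close>

lemma pull_bound:
  fixes w :: "(real, 'n::{finite,linorder}) vec \<Rightarrow> 'n set \<Rightarrow> real"
  assumes e: "norm (e' x) \<le> 1" and y: "norm y \<le> 1" and K: "card K = r"
  shows "\<bar>pull e e' y w x K\<bar> \<le> (1 + real CARD('n) * real CARD('n)) * form_l1 r (w (x + e x *\<^sub>R y))"
proof -
  let ?f = "w (x + e x *\<^sub>R y)" and ?F = "form_l1 r (w (x + e x *\<^sub>R y))"
  have c: "real (card S) \<le> CARD('n)" for S :: "'n set" by (simp add: card_mono)
  have ip: "\<bar>fsign k K * e' x $ k * interior_product y ?f (K - {k})\<bar> \<le> CARD('n) * ?F" if k: "k \<in> K" for k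
  proof -
    have "\<bar>interior_product y ?f (K - {k})\<bar> \<le> (\<Sum>i\<in>- (K - {k}). \<bar>fsign i (insert i (K - {k})) * y $ i * ?f (insert i (K - {k}))\<bar>)"
      unfolding interior_product_def by (rule sum_abs)
    also have "\<dots> \<le> (\<Sum>i\<in>- (K - {k}). ?F)"
    proof (rule sum_mono)
      fix i assume i: "i \<in> - (K - {k})"
      have "\<bar>y $ i\<bar> \<le> 1" using component_le_norm_cart[of y i] y by simp
      then have "\<bar>y $ i\<bar> * \<bar>?f (insert i (K - {k}))\<bar> \<le> 1 * ?F"
        using abs_le_form_l1[of "insert i (K - {k})" r ?f] card_exchange[OF k i] K by (intro mult_mono) auto
      then show "\<bar>fsign i (insert i (K - {k})) * y $ i * ?f (insert i (K - {k}))\<bar> \<le> ?F"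
        by (simp add: abs_mult fsign_abs)
    qed
    also have "\<dots> \<le> CARD('n) * ?F" using c[of "- (K - {k})"] form_l1_nonneg[of r ?f] by (simp add: mult_right_mono)
    finally have ip: "\<bar>interior_product y ?f (K - {k})\<bar> \<le> CARD('n) * ?F" .
    have "\<bar>e' x $ k\<bar> \<le> 1" using component_le_norm_cart[of "e' x" k] e by simp
    then have "\<bar>e' x $ k\<bar> * \<bar>interior_product y ?f (K - {k})\<bar> \<le> 1 * (CARD('n) * ?F)"
      by (intro mult_mono ip) auto
    then show ?thesis by (simp add: abs_mult fsign_abs)
  qed
  have "\<bar>pull e e' y w x K\<bar> \<le> \<bar>?f K\<bar> + (\<Sum>k\<in>K. \<bar>fsign k K * e' x $ k * interior_product y ?f (K - {k})\<bar>)"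
    unfolding pull_def by (rule order_trans[OF abs_triangle_ineq]) (intro add_mono order_refl sum_abs)
  also have "\<dots> \<le> ?F + (\<Sum>k\<in>K. CARD('n) * ?F)"
    by (intro add_mono sum_mono ip abs_le_form_l1 K)
  also have "\<dots> \<le> ?F + CARD('n) * (CARD('n) * ?F)"
    using c[of K] form_l1_nonneg[of r ?f] by (simp add: mult_right_mono)
  finally show ?thesis by (simp add: algebra_simps)
qed

definition smoothing :: "((real,'n) vec \<Rightarrow> real) \<Rightarrow> ((real,'n) vec \<Rightarrow> (real,'n) vec) \<Rightarrow> ((real,'n) vec \<Rightarrow> 'n::{finite,linorder} set \<Rightarrow> real)
    \<Rightarrow> (real,'n) vec \<Rightarrow> 'n set \<Rightarrow> real" where
  "smoothing e e' w x K = (\<integral>y. pull e e' y w x K \<partial>unit_ball_measure)"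

lemma form_l1_measurable:
  assumes "periodic_L1_form r w"
  shows "(\<lambda>x. form_l1 r (w x)) \<in> borel_measurable borel" "lattice_periodic (\<lambda>x. form_l1 r (w x))"
    "integrable torus (\<lambda>x. form_l1 r (w x))"
  using assms unfolding form_l1_def periodic_L1_form_def
  by (auto intro!: borel_measurable_sum borel_measurable_abs Bochner_Integration.integrable_sum integrable_abs
      simp: lattice_periodic_def)

lemma pull_measurable:
  fixes w :: "(real, 'n::{finite,linorder}) vec \<Rightarrow> 'n set \<Rightarrow> real"
  assumes e: "C1_periodic e e'" and w: "periodic_L1_form r w" and K: "card K = r"
  shows "(\<lambda>(x, y). pull e e' y w x K) \<in> borel_measurable (borel \<Otimes>\<^sub>M borel)"
proof -
  note [measurable] = C1_periodic_measurable[OF e]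
  have wI: "(\<lambda>p. w (fst p + e (fst p) *\<^sub>R snd p) I) \<in> borel_measurable (borel \<Otimes>\<^sub>M borel)" if "card I = r" for I
  proof -
    have [measurable]: "(\<lambda>x. w x I) \<in> borel_measurable borel" using w that by (auto simp: periodic_L1_form_def)
    show ?thesis by measurable
  qed
  have "(\<lambda>p. w (fst p + e (fst p) *\<^sub>R snd p) K
      + (\<Sum>k\<in>K. fsign k K * e' (fst p) $ k * (\<Sum>i\<in>- (K - {k}). fsign i (insert i (K - {k})) * snd p $ i
         * w (fst p + e (fst p) *\<^sub>R snd p) (insert i (K - {k}))))) \<in> borel_measurable (borel \<Otimes>\<^sub>M borel)"
    by (intro borel_measurable_add borel_measurable_sum borel_measurable_times borel_measurable_const wI K)
       (measurable, simp only: card_exchange K)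
  then show ?thesis by (simp add: pull_def interior_product_def case_prod_beta')
qed

lemma
  fixes w :: "(real, 'n::{finite,linorder}) vec \<Rightarrow> 'n set \<Rightarrow> real"
  assumes e: "small_gradient e e'" and w: "periodic_L1_form r w" and K: "card K = r"
  shows smoothing_measurable: "(\<lambda>x. smoothing e e' w x K) \<in> borel_measurable borel"
    and pull_pair_integrable: "integrable (unit_ball_measure \<Otimes>\<^sub>M torus) (\<lambda>(y, x). pull e e' y w x K)"
proof -
  have e1: "C1_periodic e e'" using e by (simp add: small_gradient_def)
  have e2: "norm (e' x) \<le> 1" for x
    by (rule order_trans[of _ "1/2"]) (use e in \<open>simp_all add: small_gradient_def\<close>)
  note [measurable] = C1_periodic_measurable[OF e1] pull_measurable[OF e1 w K] form_l1_measurable(1)[OF w]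
  interpret P: pair_sigma_finite "unit_ball_measure :: (real,'n) vec measure" "torus :: (real,'n) vec measure" ..
  show "(\<lambda>x. smoothing e e' w x K) \<in> borel_measurable borel"
    unfolding smoothing_def by measurable
  define C where "C = 1 + real CARD('n) * real CARD('n)"
  define I where "I = (\<integral>x. form_l1 r (w x) \<partial>torus)"
  have int: "integrable torus (\<lambda>x. pull e e' y w x K)" if "norm y \<le> 1" for y
    using pull_mult_integrable[OF e that w continuous_on_const[of UNIV 1] _ K] by (simp add: lattice_periodic_def)
  show "integrable (unit_ball_measure \<Otimes>\<^sub>M torus) (\<lambda>(y, x). pull e e' y w x K)"
  proof (rule P.Fubini_integrable)
    show "(\<lambda>(y, x). pull e e' y w x K) \<in> borel_measurable (unit_ball_measure \<Otimes>\<^sub>M torus)" by measurable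
    show "AE y in unit_ball_measure. integrable torus (\<lambda>x. case (y, x) of (y, x) \<Rightarrow> pull e e' y w x K)"
      using AE_unit_ball_measure by eventually_elim (simp add: int)
    \<comment> \<open>Uniform in \<open>y\<close>: \<open>C\<close> bounds the pullback by the
      displaced norm of \<open>w\<close>, and \<open>2\<close> is the price of removing the
      displacement under the integral.\<close>
    have bd: "(\<integral>x. \<bar>pull e e' y w x K\<bar> \<partial>torus) \<le> C * (2 * I)" if y: "norm y \<le> 1" for y
    proof -
      have if1: "integrable torus (\<lambda>x. form_l1 r (w (x + e x *\<^sub>R y)))"
        by (rule flow_integrable[OF e y form_l1_measurable[OF w]])
      have "(\<integral>x. \<bar>pull e e' y w x K\<bar> \<partial>torus) \<le> (\<integral>x. C * form_l1 r (w (x + e x *\<^sub>R y)) \<partial>torus)"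
        by (intro integral_mono integrable_abs int y integrable_mult_right if1)
           (simp add: C_def pull_bound[where e'=e', OF e2 y K])
      also have "\<dots> = C * (\<integral>x. form_l1 r (w (x + e x *\<^sub>R y)) \<partial>torus)" by simp
      also have "(\<integral>x. form_l1 r (w (x + e x *\<^sub>R y)) \<partial>torus) \<le> 2 * I"
      proof -
        have "ennreal (\<integral>x. form_l1 r (w (x + e x *\<^sub>R y)) \<partial>torus) = (\<integral>\<^sup>+x. ennreal (form_l1 r (w (x + e x *\<^sub>R y))) \<partial>torus)"
          by (rule nn_integral_eq_integral[symmetric, OF if1]) (simp add: form_l1_nonneg)
        also have "\<dots> \<le> 2 * (\<integral>\<^sup>+x. ennreal (form_l1 r (w x)) \<partial>torus)"
          by (rule flow_nn_integral_le[OF e y]) (use form_l1_measurable(2)[OF w] in \<open>auto simp: lattice_periodic_def\<close>)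
        also have "(\<integral>\<^sup>+x. ennreal (form_l1 r (w x)) \<partial>torus) = ennreal I"
          unfolding I_def by (rule nn_integral_eq_integral[OF form_l1_measurable(3)[OF w]]) (simp add: form_l1_nonneg)
        also have "2 * ennreal I = ennreal (2 * I)" by (simp add: ennreal_mult')
        finally show ?thesis by (subst (asm) ennreal_le_iff) (simp_all add: I_def form_l1_nonneg)
      qed
      finally show ?thesis by (simp add: C_def mult_left_mono)
    qed
    show "integrable unit_ball_measure (\<lambda>y. \<integral>x. norm (case (y, x) of (y, x) \<Rightarrow> pull e e' y w x K) \<partial>torus)"
    proof (rule unit_ball.integrable_const_bound)
      show "AE y in unit_ball_measure. norm (\<integral>x. norm (case (y, x) of (y, x) \<Rightarrow> pull e e' y w x K) \<partial>torus) \<le> C * (2 * I)"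
        using AE_unit_ball_measure by eventually_elim (simp add: bd)
    qed measurable
  qed
qed

text \<open>By Fubini the mean over \<open>y\<close> can be taken after testing. Almost every
  \<open>y\<close> for the ball measure satisfies \<open>norm y \<le> 1\<close>, so its displacement
  is admissible and the tested pullback vanishes.\<close>

lemma
  fixes w :: "(real, 'n::{finite,linorder}) vec \<Rightarrow> 'n set \<Rightarrow> real"
  assumes e: "small_gradient e e'" and w: "periodic_L1_form r w"
  shows smoothing_integrable: "card K = r \<Longrightarrow> integrable torus (\<lambda>x. smoothing e e' w x K)"
    and smoothing_closed: "torus_closed r w \<Longrightarrow> torus_closed r (smoothing e e' w)"
proof -
  interpret P: pair_sigma_finite "unit_ball_measure :: (real,'n) vec measure" "torus :: (real,'n) vec measure" ..
  show "integrable torus (\<lambda>x. smoothing e e' w x K)" if "card K = r"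
    unfolding smoothing_def by (rule P.integrable_snd[OF pull_pair_integrable[OF e w that]])
  assume closed: "torus_closed r w"
  show "torus_closed r (smoothing e e' w)"
    unfolding torus_closed_def
  proof (intro allI impI)
    fix J :: "'n set" and \<phi> :: "(real,'n) vec \<Rightarrow> real" assume A: "card J = Suc r \<and> smooth_fun \<phi> \<and> periodic_fun \<phi>"
    then have \<phi>C: "C1_periodic \<phi> (\<lambda>x. \<chi> j. pderiv j \<phi> x)" by (intro smooth_C1_periodic) auto
    obtain B where B: "\<And>x. norm (\<chi> j. pderiv j \<phi> x) \<le> B" using C1_periodic_bounds[OF \<phi>C] by metis
    have Bj: "\<bar>pderiv j \<phi> x\<bar> \<le> B" for j x
      using component_le_norm_cart[of "\<chi> j. pderiv j \<phi> x" j] B[of x] by simp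
    have [measurable]: "pderiv j \<phi> \<in> borel_measurable borel" for j
      using measurable_compose[OF C1_periodic_measurable(2)[OF \<phi>C] measurable_vec_nth[of j]] by simp
    have int: "integrable (unit_ball_measure \<Otimes>\<^sub>M torus) (\<lambda>(y, x). pull e e' y w x (J - {j}) * pderiv j \<phi> x)" if "j \<in> J" for j
    proof (rule Bochner_Integration.integrable_bound)
      have cJ: "card (J - {j}) = r" using A that by simp
      have [measurable]: "(\<lambda>(x, y). pull e e' y w x (J - {j})) \<in> borel_measurable (borel \<Otimes>\<^sub>M borel)"
        by (rule pull_measurable[OF _ w cJ]) (use e in \<open>simp add: small_gradient_def\<close>)
      show "integrable (unit_ball_measure \<Otimes>\<^sub>M torus) (\<lambda>p. B * (case p of (y, x) \<Rightarrow> pull e e' y w x (J - {j})))"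
        by (rule integrable_mult_right[OF pull_pair_integrable[OF e w cJ]])
      show "(\<lambda>(y, x). pull e e' y w x (J - {j}) * pderiv j \<phi> x) \<in> borel_measurable (unit_ball_measure \<Otimes>\<^sub>M torus)"
        by measurable
      have "\<bar>pull e e' y w x (J - {j})\<bar> * \<bar>pderiv j \<phi> x\<bar> \<le> \<bar>pull e e' y w x (J - {j})\<bar> * \<bar>B\<bar>" for x y
        by (rule mult_left_mono[OF order_trans[OF Bj abs_ge_self]]) simp
      then show "AE p in unit_ball_measure \<Otimes>\<^sub>M torus. norm (case p of (y, x) \<Rightarrow> pull e e' y w x (J - {j}) * pderiv j \<phi> x)
          \<le> norm (B * (case p of (y, x) \<Rightarrow> pull e e' y w x (J - {j})))"
        by (intro AE_I2) (auto simp: abs_mult mult.commute)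
    qed
    have "(\<Sum>j\<in>J. fsign j J * (\<integral>x. smoothing e e' w x (J - {j}) * pderiv j \<phi> x \<partial>torus))
       = (\<Sum>j\<in>J. fsign j J * (\<integral>y. (\<integral>x. pull e e' y w x (J - {j}) * pderiv j \<phi> x \<partial>torus) \<partial>unit_ball_measure))"
    proof (intro sum.cong refl arg_cong2[where f="(*)"])
      fix j assume j: "j \<in> J"
      have "(\<integral>x. smoothing e e' w x (J - {j}) * pderiv j \<phi> x \<partial>torus)
         = (\<integral>x. (\<integral>y. pull e e' y w x (J - {j}) * pderiv j \<phi> x \<partial>unit_ball_measure) \<partial>torus)"
        by (simp add: smoothing_def)
      also have "\<dots> = (\<integral>y. (\<integral>x. pull e e' y w x (J - {j}) * pderiv j \<phi> x \<partial>torus) \<partial>unit_ball_measure)"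
        using P.Fubini_integral[OF int[OF j]] by simp
      finally show "(\<integral>x. smoothing e e' w x (J - {j}) * pderiv j \<phi> x \<partial>torus)
         = (\<integral>y. (\<integral>x. pull e e' y w x (J - {j}) * pderiv j \<phi> x \<partial>torus) \<partial>unit_ball_measure)" .
    qed
    also have "\<dots> = (\<integral>y. (\<Sum>j\<in>J. fsign j J * (\<integral>x. pull e e' y w x (J - {j}) * pderiv j \<phi> x \<partial>torus)) \<partial>unit_ball_measure)"
      using P.integrable_fst[OF int] by (subst Bochner_Integration.integral_sum) auto
    also have "\<dots> = (\<integral>y. 0 \<partial>(unit_ball_measure :: (real,'n) vec measure))"
    proof (rule integral_cong_AE)
      show "AE y in unit_ball_measure. (\<Sum>j\<in>J. fsign j J * (\<integral>x. pull e e' y w x (J - {j}) * pderiv j \<phi> x \<partial>torus)) = 0"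
        using AE_unit_ball_measure
      proof eventually_elim
        case (elim y)
        from pull_closed[OF e elim w closed] A show ?case unfolding torus_closed_def by blast
      qed
      show "(\<lambda>y. \<Sum>j\<in>J. fsign j J * (\<integral>x. pull e e' y w x (J - {j}) * pderiv j \<phi> x \<partial>torus)) \<in> borel_measurable unit_ball_measure"
        by (intro borel_measurable_sum borel_measurable_times borel_measurable_const borel_measurable_integrable[OF P.integrable_fst[OF int, simplified]])
    qed simp
    finally show "(\<Sum>j\<in>J. fsign j J * (\<integral>x. smoothing e e' w x (J - {j}) * pderiv j \<phi> x \<partial>torus)) = 0" by simp
  qed
qed

section \<open>Regularised distance and passage to the limit\<close>

definition pos_sq :: "real \<Rightarrow> real" where
  "pos_sq s = (max 0 s)\<^sup>2"

lemma pos_sq_deriv: "(pos_sq has_real_derivative 2 * max 0 s) (at s)"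
proof (cases s "0::real" rule: linorder_cases)
  case less
  have "((\<lambda>_. 0::real) has_real_derivative 0) (at s)" by simp
  then have "(pos_sq has_real_derivative 0) (at s)"
    by (rule has_field_derivative_transform_within_open[of _ _ _ "{..<0}"]) (use less in \<open>auto simp: pos_sq_def\<close>)
  then show ?thesis using less by simp
next
  case greater
  have "((\<lambda>s. s\<^sup>2) has_real_derivative 2 * s) (at s)" by (auto intro!: derivative_eq_intros)
  then have "(pos_sq has_real_derivative 2 * s) (at s)"
    by (rule has_field_derivative_transform_within_open[of _ _ _ "{0<..}"]) (use greater in \<open>auto simp: pos_sq_def\<close>)
  then show ?thesis using greater by simp
next
  case equal
  have "((\<lambda>h. (pos_sq (0 + h) - pos_sq 0) / h) \<longlongrightarrow> 0) (at 0)"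
  proof (rule Lim_null_comparison)
    show "((\<lambda>h::real. \<bar>h\<bar>) \<longlongrightarrow> 0) (at 0)" using tendsto_rabs_zero[OF tendsto_ident_at] by blast
    have "norm ((pos_sq (0 + h) - pos_sq 0) / h) \<le> \<bar>h\<bar>" for h :: real
      by (cases "h > 0") (auto simp: pos_sq_def power2_eq_square max_def)
    then show "\<forall>\<^sub>F h in at 0. norm ((pos_sq (0 + h) - pos_sq 0) / h) \<le> \<bar>h\<bar>" by simp
  qed
  then show ?thesis using equal by (simp add: DERIV_def)
qed

text \<open>A C1 step from \<open>0\<close> to \<open>1\<close> made of two squared positive parts:
  the inner one makes it constant for \<open>s \<ge> 1\<close>, the outer one for
  \<open>s \<le> 0\<close>. Its slope is at most \<open>4\<close>.\<close>

definition cstep :: "real \<Rightarrow> real" where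
  "cstep s = pos_sq (1 - pos_sq (1 - s))"

definition cstep' :: "real \<Rightarrow> real" where
  "cstep' s = 4 * max 0 (1 - pos_sq (1 - s)) * max 0 (1 - s)"

lemma cstep_deriv: "(cstep has_real_derivative cstep' s) (at s)"
proof -
  have "((\<lambda>s. 1 - pos_sq (1 - s)) has_real_derivative - (2 * max 0 (1 - s) * (-1))) (at s)"
    by (rule derivative_eq_intros DERIV_chain2[OF pos_sq_deriv] refl | simp)+
  from DERIV_chain2[OF pos_sq_deriv this] show ?thesis
    unfolding cstep_def cstep'_def by (simp add: mult_ac)
qed

lemma cstep_low: "s \<le> 0 \<Longrightarrow> cstep s = 0" "s \<le> 0 \<Longrightarrow> cstep' s = 0"
proof -
  assume "s \<le> 0"
  then have "1 \<le> pos_sq (1 - s)" by (simp add: pos_sq_def max_def)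
  then show "cstep s = 0" "cstep' s = 0" unfolding cstep_def cstep'_def by (simp_all add: pos_sq_def max_def)
qed

lemma cstep_high: "1 \<le> s \<Longrightarrow> cstep s = 1" "1 \<le> s \<Longrightarrow> cstep' s = 0"
  by (simp_all add: cstep_def cstep'_def pos_sq_def)

lemma cstep_bounds: "0 \<le> cstep s" "cstep s \<le> 1" "\<bar>cstep' s\<bar> \<le> 4"
proof -
  have q: "0 \<le> pos_sq (1 - s)" by (simp add: pos_sq_def)
  then have m: "0 \<le> max 0 (1 - pos_sq (1 - s))" "max 0 (1 - pos_sq (1 - s)) \<le> 1" by auto
  show "0 \<le> cstep s" by (simp add: cstep_def pos_sq_def)
  show "cstep s \<le> 1" unfolding cstep_def using power_le_one[OF m, of 2] by (subst pos_sq_def)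
  show "\<bar>cstep' s\<bar> \<le> 4"
  proof (cases "s \<le> 0")
    case False
    then have "max 0 (1 - s) \<le> 1" by simp
    then have "max 0 (1 - pos_sq (1 - s)) * max 0 (1 - s) \<le> 1 * 1" using m by (intro mult_mono) auto
    then show ?thesis unfolding cstep'_def using m by (simp add: abs_mult)
  qed (simp add: cstep_low)
qed

lemma cstep'_continuous: "continuous_on UNIV cstep'"
  unfolding cstep'_def pos_sq_def by (intro continuous_intros)

lemma C1_periodic_compose_real:
  assumes h: "\<And>s. (h has_real_derivative h' s) (at s)" "continuous_on UNIV h'" and f: "C1_periodic f f'"
  shows "C1_periodic (\<lambda>x. h (f x)) (\<lambda>x. h' (f x) *\<^sub>R f' x)"
  unfolding C1_periodic_def
proof (intro conjI allI)
  show "lattice_periodic (\<lambda>x. h (f x))"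
    by (intro lattice_periodicI) (simp add: lattice_periodicD[OF C1_periodicD(1)[OF f]])
  show "((\<lambda>x. h (f x)) has_derivative (\<lambda>v. (h' (f x) *\<^sub>R f' x) \<bullet> v)) (at x)" for x
    using has_derivative_compose[OF C1_periodicD(2)[OF f, of x] h(1)[unfolded has_field_derivative_def]] by simp
  show "continuous_on UNIV (\<lambda>x. h' (f x) *\<^sub>R f' x)"
    by (intro continuous_intros C1_periodicD(3)[OF f] continuous_on_compose2[OF h(2) C1_periodicD(4)[OF f]]) simp
qed

text \<open>The derivative along \<open>g\<close> itself is \<open>(norm g)\<^sup>2\<close>, while
  the difference quotients in that direction are at most \<open>norm g\<close>.\<close>

lemma gradient_le_lipschitz:
  fixes f :: "'a::real_inner \<Rightarrow> real"
  assumes d: "(f has_derivative (\<lambda>h. g \<bullet> h)) (at x)" and lip: "\<And>y. \<bar>f y - f x\<bar> \<le> norm (y - x)"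
  shows "norm g \<le> 1"
proof (cases "g = 0")
  case False
  have "((\<lambda>t. x + t *\<^sub>R g) has_derivative (\<lambda>t. t *\<^sub>R g)) (at 0)" by (auto intro!: derivative_eq_intros)
  then have "((\<lambda>t. f (x + t *\<^sub>R g)) has_derivative (\<lambda>t. g \<bullet> (t *\<^sub>R g))) (at 0)"
    by (rule has_derivative_compose) (use d in simp)
  then have "((\<lambda>t. f (x + t *\<^sub>R g)) has_real_derivative (norm g)\<^sup>2) (at 0)"
    by (simp add: has_field_derivative_def power2_norm_eq_inner mult_commute_abs)
  then have lim: "((\<lambda>t. (f (x + t *\<^sub>R g) - f x) / t) \<longlongrightarrow> (norm g)\<^sup>2) (at 0)" by (simp add: DERIV_def)
  have "(norm g)\<^sup>2 \<le> norm g"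
  proof (rule tendsto_upperbound[OF lim])
    have "(f (x + t *\<^sub>R g) - f x) / t \<le> norm g" if "t \<noteq> 0" for t
    proof -
      have "\<bar>(f (x + t *\<^sub>R g) - f x) / t\<bar> \<le> norm g"
        using lip[of "x + t *\<^sub>R g"] that by (simp add: divide_le_eq mult.commute)
      then show ?thesis by linarith
    qed
    then show "\<forall>\<^sub>F t in at 0. (f (x + t *\<^sub>R g) - f x) / t \<le> norm g"
      by (auto simp: eventually_at_filter)
  qed simp
  then show ?thesis using False by (simp add: power2_eq_square)
qed simp

text \<open>Convolution with a nonnegative kernel of mass \<open>1\<close> keeps the Lipschitz
  constant, so the approximation has gradient at most \<open>1\<close>.\<close>

lemma torus_mollify_lipschitz:
  fixes \<delta> :: "real^'n \<Rightarrow> real"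
  assumes lip: "\<And>x y. \<bar>\<delta> x - \<delta> y\<bar> \<le> norm (x - y)" and per: "lattice_periodic \<delta>" and t: "t > 0"
  obtains d d' where "C1_periodic d d'" "\<And>x. \<bar>d x - \<delta> x\<bar> \<le> t" "\<And>x. norm (d' x) \<le> 1"
proof -
  have "1-lipschitz_on UNIV \<delta>" using lip by (intro lipschitz_onI) (auto simp: dist_norm)
  then have cont: "continuous_on UNIV \<delta>" by (rule lipschitz_on_continuous_on)
  then have [measurable]: "\<delta> \<in> borel_measurable borel" by (rule borel_measurable_continuous_onI)
  obtain m where m: "\<And>x. \<bar>(\<integral>z. torus_kernel m (x - z) * \<delta> z \<partial>torus) - \<delta> x\<bar> \<le> t"
    using torus_kernel_approximates[OF cont per t] by (auto simp: eventually_sequentially)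
  obtain K' where K': "C1_periodic (torus_kernel m :: real^'n \<Rightarrow> real) K'" using torus_kernel_C1 by blast
  define d where "d x = (\<integral>z. torus_kernel m (x - z) * \<delta> z \<partial>torus)" for x
  obtain d' where d: "C1_periodic d d'"
    using C1_periodic_convolution[OF K' _ torus_integrable_continuous[OF cont per]] unfolding d_def by auto
  obtain B where B: "\<And>x. norm (\<delta> x) \<le> B" using periodic_continuous_bounded[OF cont per] by metis
  have int: "integrable torus (\<lambda>z. torus_kernel m z * \<delta> (x + z))" for x
    by (rule torus_integrable_mult_bounded[OF torus_kernel_integrable _ _ B]) measurable
  have "\<bar>d x - d y\<bar> \<le> norm (x - y)" for x y
  proof -
    have "d x - d y = (\<integral>z. torus_kernel m z * \<delta> (x + z) - torus_kernel m z * \<delta> (y + z) \<partial>torus)"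
      unfolding d_def by (simp add: torus_convolution_shift[OF per] Bochner_Integration.integral_diff[OF int int])
    then have "\<bar>d x - d y\<bar> = \<bar>\<integral>z. torus_kernel m z * \<delta> (x + z) - torus_kernel m z * \<delta> (y + z) \<partial>torus\<bar>" by simp
    also have "\<dots> \<le> (\<integral>z. \<bar>torus_kernel m z * \<delta> (x + z) - torus_kernel m z * \<delta> (y + z)\<bar> \<partial>torus)"
      by (rule integral_abs_bound)
    also have "\<dots> \<le> (\<integral>z. torus_kernel m z * norm (x - y) \<partial>(torus :: (real^'n) measure))"
    proof (rule integral_mono)
      fix z :: "real^'n"
      have "torus_kernel m z * \<bar>\<delta> (x + z) - \<delta> (y + z)\<bar> \<le> torus_kernel m z * norm (x - y)"
        using lip[of "x + z" "y + z"] by (intro mult_left_mono torus_kernel_nonneg) simp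
      then show "\<bar>torus_kernel m z * \<delta> (x + z) - torus_kernel m z * \<delta> (y + z)\<bar> \<le> torus_kernel m z * norm (x - y)"
        by (simp only: right_diff_distrib[symmetric] abs_mult abs_of_nonneg[OF torus_kernel_nonneg])
    qed (intro integrable_abs Bochner_Integration.integrable_diff int integrable_mult_left torus_kernel_integrable)+
    also have "\<dots> = norm (x - y)" using torus_kernel_mass[of m, where 'n='n] by simp
    finally show ?thesis .
  qed
  then have "norm (d' x) \<le> 1" for x by (rule gradient_le_lipschitz[OF C1_periodicD(2)[OF d]])
  then show thesis using m d by (intro that[of d d']) (auto simp: d_def)
qed

text \<open>A distance need not be differentiable, so a mollified copy is fed into
  \<open>cstep\<close>. An error of a quarter of the scale leaves room for the exact values
  \<open>0\<close> and \<open>1\<close> outside the transition zone of \<open>\<delta>\<close>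
  itself.\<close>

lemma dyadic_cutoff:
  fixes \<delta> :: "real^'n \<Rightarrow> real"
  assumes lip: "\<And>x y. \<bar>\<delta> x - \<delta> y\<bar> \<le> norm (x - y)" and per: "lattice_periodic \<delta>"
  obtains g g' where "C1_periodic g g'" "\<And>x. 0 \<le> g x" "\<And>x. g x \<le> 1" "\<And>x. norm (g' x) \<le> 8 * 2 ^ n"
    "\<And>x. \<delta> x \<le> (1/2)^n \<Longrightarrow> g x = 0 \<and> g' x = 0" "\<And>x. 2 * (1/2)^n \<le> \<delta> x \<Longrightarrow> g x = 1 \<and> g' x = 0"
proof -
  define q :: real where "q = 2 ^ n"
  have q: "q > 0" "(1/2)^n = 1 / q" by (simp_all add: q_def power_divide)
  obtain d d' where d: "C1_periodic d d'" "\<And>x. \<bar>d x - \<delta> x\<bar> \<le> 1 / (4 * q)" "\<And>x. norm (d' x) \<le> 1"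
    using torus_mollify_lipschitz[OF lip per, of "1 / (4 * q)"] q by auto
  have qd: "\<bar>q * d x - q * \<delta> x\<bar> \<le> 1/4" for x
  proof -
    have "q * \<bar>d x - \<delta> x\<bar> \<le> q * (1 / (4 * q))" using d(2)[of x] q by (intro mult_left_mono) auto
    then show ?thesis using q by (simp add: right_diff_distrib[symmetric] abs_mult)
  qed
  \<comment> \<open>If \<open>q * \<delta> x \<le> 1\<close>, then \<open>q * d x \<le> 5/4\<close>
    and \<open>a x \<le> 0\<close>; if \<open>q * \<delta> x \<ge> 2\<close>, then
    \<open>q * d x \<ge> 7/4\<close> and \<open>a x \<ge> 1\<close>. The factor \<open>2\<close>
    here and the slope \<open>4\<close> of \<open>cstep\<close> make up the \<open>8\<close> in the
    gradient bound.\<close>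
  define a where "a x = - (5/2) + 2 * q * d x" for x
  have a: "C1_periodic a (\<lambda>x. 0 + (2 * q) *\<^sub>R d' x)"
    unfolding a_def by (intro C1_periodic_add C1_periodic_const C1_periodic_scale d(1))
  define g where "g x = cstep (a x)" for x
  define g' where "g' x = cstep' (a x) *\<^sub>R (0 + (2 * q) *\<^sub>R d' x)" for x
  show thesis
  proof
    show "C1_periodic g g'"
      unfolding g_def g'_def by (rule C1_periodic_compose_real[OF cstep_deriv cstep'_continuous a])
    show "0 \<le> g x" "g x \<le> 1" for x by (simp_all add: g_def cstep_bounds)
    show "norm (g' x) \<le> 8 * 2 ^ n" for x
    proof -
      have "\<bar>cstep' (a x)\<bar> * (2 * q * norm (d' x)) \<le> 4 * (2 * q * 1)"
        using q d(3)[of x] by (intro mult_mono cstep_bounds) auto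
      moreover have "norm (g' x) = \<bar>cstep' (a x)\<bar> * (2 * q * norm (d' x))" using q(1) by (simp add: g'_def abs_mult)
      ultimately show ?thesis by (simp add: q_def)
    qed
    fix x
    show "g x = 0 \<and> g' x = 0" if "\<delta> x \<le> (1/2)^n"
    proof -
      have "q * \<delta> x \<le> 1" using that q by (simp add: field_simps)
      then have "a x \<le> 0" using qd[of x] unfolding a_def by linarith
      then show ?thesis by (simp add: g_def g'_def cstep_low)
    qed
    show "g x = 1 \<and> g' x = 0" if "2 * (1/2)^n \<le> \<delta> x"
    proof -
      have "2 \<le> q * \<delta> x" using that q by (simp add: field_simps)
      then have "1 \<le> a x" using qd[of x] unfolding a_def by linarith
      then show ?thesis by (simp add: g_def g'_def cstep_high)
    qed
  qed
qed

text \<open>Summing the recursion by parts, \<open>16 * \<epsilon> k x\<close> is the sum of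
  \<open>(1/2)^(n+1) * g n x\<close> over \<open>n < k\<close> plus \<open>(1/2)^k * g k x\<close>.
  Near a given point only cutoffs at the scale of \<open>\<delta> x\<close> vary, so the gradient
  does not grow with \<open>k\<close>: the factor \<open>(1/16) * (1/2)^n\<close> against the cutoff
  gradient \<open>8 * 2 ^ n\<close> gives exactly the admissible \<open>1/2\<close>.\<close>

lemma regularised_distance:
  fixes \<delta> :: "real^'n \<Rightarrow> real"
  assumes lip: "\<And>x y. \<bar>\<delta> x - \<delta> y\<bar> \<le> norm (x - y)" and per: "lattice_periodic \<delta>"
    and bounds: "\<And>x. 0 \<le> \<delta> x" "\<And>x. \<delta> x \<le> 1"
  obtains \<epsilon> \<epsilon>' where "\<And>k. small_gradient (\<epsilon> k) (\<epsilon>' k)" "\<And>k x. 0 \<le> \<epsilon> k x" "\<And>k x. \<epsilon> k x \<le> \<delta> x / 16"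
    "\<And>k x. \<delta> x = 0 \<Longrightarrow> \<epsilon> k x = 0 \<and> \<epsilon>' k x = 0"
    "\<And>k x. 2 * (1/2)^k \<le> \<delta> x \<Longrightarrow> \<delta> x / 64 \<le> \<epsilon> k x \<and> \<epsilon> (Suc k) x = \<epsilon> k x \<and> \<epsilon>' (Suc k) x = \<epsilon>' k x"
proof -
  have "\<forall>n. \<exists>g g'. C1_periodic g g' \<and> (\<forall>x. 0 \<le> g x) \<and> (\<forall>x. g x \<le> 1) \<and> (\<forall>x. norm (g' x) \<le> 8 * 2 ^ n) \<and>
    (\<forall>x. \<delta> x \<le> (1/2)^n \<longrightarrow> g x = 0 \<and> g' x = 0) \<and> (\<forall>x. 2 * (1/2)^n \<le> \<delta> x \<longrightarrow> g x = 1 \<and> g' x = 0)"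
  proof
    fix n
    show "\<exists>g g'. C1_periodic g g' \<and> (\<forall>x. 0 \<le> g x) \<and> (\<forall>x. g x \<le> 1) \<and> (\<forall>x. norm (g' x) \<le> 8 * 2 ^ n) \<and>
    (\<forall>x. \<delta> x \<le> (1/2)^n \<longrightarrow> g x = 0 \<and> g' x = 0) \<and> (\<forall>x. 2 * (1/2)^n \<le> \<delta> x \<longrightarrow> g x = 1 \<and> g' x = 0)"
      by (rule dyadic_cutoff[OF lip per, of n]) blast
  qed
  then obtain g g' where g: "\<And>n. C1_periodic (g n) (g' n)" "\<And>n x. 0 \<le> g n x" "\<And>n x. g n x \<le> 1" "\<And>n x. norm (g' n x) \<le> 8 * 2 ^ n"
    "\<And>n x. \<delta> x \<le> (1/2)^n \<Longrightarrow> g n x = 0 \<and> g' n x = 0" "\<And>n x. 2 * (1/2)^n \<le> \<delta> x \<Longrightarrow> g n x = 1 \<and> g' n x = 0"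
    by metis
  define \<epsilon> where "\<epsilon> = rec_nat (\<lambda>x. 1/16 * g 0 x) (\<lambda>k f x. f x + (1/16 * (1/2)^Suc k) * (g (Suc k) x + (-1) * g k x))"
  define \<epsilon>' where "\<epsilon>' = rec_nat (\<lambda>x. (1/16) *\<^sub>R g' 0 x) (\<lambda>k f x. f x + (1/16 * (1/2)^Suc k) *\<^sub>R (g' (Suc k) x + (-1) *\<^sub>R g' k x))"
  have e0: "\<epsilon> 0 = (\<lambda>x. 1/16 * g 0 x)" "\<epsilon>' 0 = (\<lambda>x. (1/16) *\<^sub>R g' 0 x)" by (simp_all add: \<epsilon>_def \<epsilon>'_def)
  have eS: "\<epsilon> (Suc k) = (\<lambda>x. \<epsilon> k x + (1/16 * (1/2)^Suc k) * (g (Suc k) x + (-1) * g k x))"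
     "\<epsilon>' (Suc k) = (\<lambda>x. \<epsilon>' k x + (1/16 * (1/2)^Suc k) *\<^sub>R (g' (Suc k) x + (-1) *\<^sub>R g' k x))" for k
    by (simp_all add: \<epsilon>_def \<epsilon>'_def)
  have C: "C1_periodic (\<epsilon> k) (\<epsilon>' k)" for k
  proof (induction k)
    case 0 show ?case unfolding e0 by (intro C1_periodic_scale g(1))
  next
    case (Suc k) then show ?case unfolding eS by (intro C1_periodic_add C1_periodic_scale g(1))
  qed
  have stable: "\<epsilon> (Suc k) x = \<epsilon> k x \<and> \<epsilon>' (Suc k) x = \<epsilon>' k x" if "2 * (1/2)^k \<le> \<delta> x" for k x
  proof -
    have "2 * (1/2)^Suc k \<le> (2 * (1/2)^k :: real)" by simp
    then have "2 * (1/2)^Suc k \<le> \<delta> x" using that by (rule order_trans)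
    then show ?thesis using g(6)[OF that] g(6)[of "Suc k" x] by (auto simp: eS)
  qed
  \<comment> \<open>On this strip every cutoff with index \<open>n < k\<close> vanishes, since
    \<open>2 * (1/2)^k \<le> (1/2)^n\<close>.\<close>
  have near: "\<epsilon> k x = 1/16 * (1/2)^k * g k x \<and> \<epsilon>' k x = (1/16 * (1/2)^k) *\<^sub>R g' k x" if "\<delta> x \<le> 2 * (1/2)^k" for k x
    using that
  proof (induction k)
    case 0 show ?case by (simp add: e0)
  next
    case (Suc k)
    then have le: "\<delta> x \<le> (1/2)^k" by simp
    then have "\<delta> x \<le> 2 * (1/2)^k" using zero_le_power[of "1/2::real" k] by linarith
    then have "\<epsilon> k x = 1/16 * (1/2)^k * g k x \<and> \<epsilon>' k x = (1/16 * (1/2)^k) *\<^sub>R g' k x" by (rule Suc.IH)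
    with g(5)[OF le] show ?case by (simp add: eS)
  qed
  have far: "\<delta> x / 64 \<le> \<epsilon> k x \<and> \<epsilon> k x \<le> \<delta> x / 16 \<and> norm (\<epsilon>' k x) \<le> 1/2" if "2 * (1/2)^k \<le> \<delta> x" for k x
    using that
  proof (induction k)
    \<comment> \<open>Vacuous: the condition would force \<open>\<delta> x \<ge> 2\<close>.\<close>
    case 0 then show ?case using bounds(2)[of x] by simp
  next
    case (Suc k)
    show ?case
    proof (cases "2 * (1/2)^k \<le> \<delta> x")
      case True
      then show ?thesis using Suc.IH stable[OF True] by simp
    next
      case False
      define h :: real where "h = (1/2)^k"
      have h: "h > 0" "h * 2^k = 1" by (simp_all add: h_def power_divide)
      have dl: "h \<le> \<delta> x" "\<delta> x < 2 * h" using Suc.prems False by (simp_all add: h_def)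
      have g1: "g (Suc k) x = 1" "g' (Suc k) x = 0" using g(6)[OF Suc.prems] by auto
      have nk: "\<epsilon> k x = 1/16 * h * g k x" "\<epsilon>' k x = (1/16 * h) *\<^sub>R g' k x"
        using near[of x k] False by (auto simp: h_def)
      \<comment> \<open>Since \<open>0 \<le> g k x \<le> 1\<close>, the value lies between
        \<open>h / 32\<close> and \<open>h / 16\<close>; with
        \<open>h \<le> \<delta> x < 2 * h\<close> this explains the constants \<open>1/64\<close>
        and \<open>1/16\<close>.\<close>
      have e1: "\<epsilon> (Suc k) x = 1/32 * h * (g k x + 1)"
        by (simp only: eS nk g1 power_Suc h_def[symmetric]) (simp add: field_simps)
      have e2: "\<epsilon>' (Suc k) x = (1/32 * h) *\<^sub>R g' k x"
        by (simp only: eS nk g1 power_Suc h_def[symmetric]) (simp add: scaleR_diff_left[symmetric])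
      have "norm (\<epsilon>' (Suc k) x) \<le> 1/32 * h * (8 * 2^k)"
        unfolding e2 norm_scaleR using g(4)[of k x] h by (intro mult_mono) auto
      also have "\<dots> = 1/4" using h(2) by simp
      finally have n: "norm (\<epsilon>' (Suc k) x) \<le> 1/2" by simp
      have "h * 1 \<le> h * (g k x + 1)" "h * (g k x + 1) \<le> h * 2"
        using h g(2,3)[of k x] by (intro mult_left_mono; simp)+
      then show ?thesis using n dl unfolding e1 by (intro conjI) linarith+
    qed
  qed
  have both: "0 \<le> \<epsilon> k x \<and> \<epsilon> k x \<le> \<delta> x / 16 \<and> norm (\<epsilon>' k x) \<le> 1/2" for k x
  proof (cases "2 * (1/2)^k \<le> \<delta> x")
    case True
    then show ?thesis using far[OF True] bounds(1)[of x] by simp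
  next
    case False
    define h :: real where "h = (1/2)^k"
    have h: "h > 0" "h * 2^k = 1" by (simp_all add: h_def power_divide)
    have nk: "\<epsilon> k x = 1/16 * h * g k x" "\<epsilon>' k x = (1/16 * h) *\<^sub>R g' k x"
      using near[of x k] False by (auto simp: h_def)
    have "norm (\<epsilon>' k x) \<le> 1/16 * h * (8 * 2^k)"
      unfolding nk norm_scaleR using g(4)[of k x] h by (intro mult_mono) auto
    also have "\<dots> = 1/2" using h(2) by simp
    finally have n: "norm (\<epsilon>' k x) \<le> 1/2" .
    have "h * g k x \<le> \<delta> x"
    proof (cases "\<delta> x \<le> h")
      case True then show ?thesis using g(5)[of x k] bounds(1)[of x] by (simp add: h_def)
    next
      case False
      have "h * g k x \<le> h * 1" using h g(3)[of k x] by (intro mult_left_mono) auto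
      then show ?thesis using False by simp
    qed
    then show ?thesis using n h g(2)[of k x] unfolding nk(1) by simp
  qed
  show thesis
  proof
    show "small_gradient (\<epsilon> k) (\<epsilon>' k)" for k using C both by (simp add: small_gradient_def)
    show "0 \<le> \<epsilon> k x" "\<epsilon> k x \<le> \<delta> x / 16" for k x using both by auto
    show "\<epsilon> k x = 0 \<and> \<epsilon>' k x = 0" if "\<delta> x = 0" for k x
      using near[of x k] g(5)[of x k] that by simp
    show "\<delta> x / 64 \<le> \<epsilon> k x \<and> \<epsilon> (Suc k) x = \<epsilon> k x \<and> \<epsilon>' (Suc k) x = \<epsilon>' k x" if "2 * (1/2)^k \<le> \<delta> x" for k x
      using far[OF that] stable[OF that] by simp
  qed
qed


section \<open>The limit of the smoothed forms\<close>

lemma smoothing_cong: "e x = f x \<Longrightarrow> e' x = f' x \<Longrightarrow> smoothing e e' w x K = smoothing f f' w x K"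
  by (simp add: smoothing_def pull_def)

lemma smoothing_trivial: "e x = 0 \<Longrightarrow> e' x = 0 \<Longrightarrow> smoothing e e' w x K = w x K"
  by (simp add: smoothing_def pull_def)

text \<open>Where the integrand is not integrable, the Bochner integral is \<open>0\<close> by
  convention and the estimate is trivial; the bound therefore holds at every
  \<open>x\<close>.\<close>

lemma ennreal_smoothing_le:
  fixes w :: "(real, 'n::{finite,linorder}) vec \<Rightarrow> 'n set \<Rightarrow> real"
  assumes e: "norm (e' x) \<le> 1" and K: "card K = r"
  shows "ennreal \<bar>smoothing e e' w x K\<bar> \<le> (\<integral>\<^sup>+y. ennreal ((1 + real CARD('n) * real CARD('n)) * form_l1 r (w (x + e x *\<^sub>R y))) \<partial>unit_ball_measure)"
proof (cases "integrable unit_ball_measure (\<lambda>y. pull e e' y w x K)")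
  case True
  have "ennreal (norm (smoothing e e' w x K)) \<le> (\<integral>\<^sup>+y. ennreal (norm (pull e e' y w x K)) \<partial>unit_ball_measure)"
    unfolding smoothing_def by (rule integral_norm_bound_ennreal[OF True])
  also have "\<dots> \<le> (\<integral>\<^sup>+y. ennreal ((1 + real CARD('n) * real CARD('n)) * form_l1 r (w (x + e x *\<^sub>R y))) \<partial>unit_ball_measure)"
  proof (rule nn_integral_mono_AE, use AE_unit_ball_measure in eventually_elim)
    case (elim y)
    then show ?case by (intro ennreal_leI) (use pull_bound[of e' x y K r e w, OF e elim K] in simp)
  qed
  finally show ?thesis by simp
next
  case False
  then show ?thesis by (simp add: smoothing_def not_integrable_integral_eq)
qed

text \<open>Where \<open>\<delta> x > 0\<close> the sequence \<open>V k x K\<close> is eventually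
  constant, and on the zero set it equals \<open>w\<close> for every \<open>k\<close>; so
  \<open>v\<close> is a pointwise limit. Closedness asks for convergence in L1, and this is in
  question on the strip \<open>0 < \<delta> x < 2 * (1/2)^k\<close>, where
  \<open>\<epsilon> k\<close> may not have stabilised and may be too small for \<open>avg\<close> to
  apply.\<close>

lemma truncation_limit:
  fixes w :: "(real, 'n::{finite,linorder}) vec \<Rightarrow> 'n set \<Rightarrow> real" and \<delta> :: "(real,'n) vec \<Rightarrow> real"
  defines "C \<equiv> 1 + real CARD('n) * real CARD('n)"
  assumes w: "periodic_L1_form r w" and closed: "torus_closed r w"
    and lip: "\<And>x y. \<bar>\<delta> x - \<delta> y\<bar> \<le> norm (x - y)" and per: "lattice_periodic \<delta>"
    and bounds: "\<And>x. 0 \<le> \<delta> x" "\<And>x. \<delta> x \<le> 1" and M: "0 \<le> M"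
    and avg: "\<And>x s. 0 < \<delta> x \<Longrightarrow> \<delta> x / 64 \<le> s \<Longrightarrow> s \<le> \<delta> x \<Longrightarrow>
      (\<integral>\<^sup>+y. ennreal (form_l1 r (w (x + s *\<^sub>R y))) \<partial>unit_ball_measure) \<le> ennreal M"
  obtains v where "\<And>K. card K = r \<Longrightarrow> (\<lambda>x. v x K) \<in> borel_measurable borel"
    "\<And>x K. \<delta> x = 0 \<Longrightarrow> v x K = w x K"
    "\<And>x K. card K = r \<Longrightarrow> 0 < \<delta> x \<Longrightarrow> \<bar>v x K\<bar> \<le> C * M"
    "torus_closed r v"
proof -
  obtain \<epsilon> \<epsilon>' where eps: "\<And>k. small_gradient (\<epsilon> k) (\<epsilon>' k)" "\<And>k x. 0 \<le> \<epsilon> k x" "\<And>k x. \<epsilon> k x \<le> \<delta> x / 16"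
    "\<And>k x. \<delta> x = 0 \<Longrightarrow> \<epsilon> k x = 0 \<and> \<epsilon>' k x = 0"
    "\<And>k x. 2 * (1/2)^k \<le> \<delta> x \<Longrightarrow> \<delta> x / 64 \<le> \<epsilon> k x \<and> \<epsilon> (Suc k) x = \<epsilon> k x \<and> \<epsilon>' (Suc k) x = \<epsilon>' k x"
    using regularised_distance[OF lip per bounds] by metis
  have C: "C \<ge> 1" by (simp add: C_def)
  define F where "F x = form_l1 r (w x)" for x
  have F [measurable]: "F \<in> borel_measurable borel" "lattice_periodic F" "integrable torus F"
    unfolding F_def by (rule form_l1_measurable[OF w])+
  have F0: "0 \<le> F x" for x by (simp add: F_def form_l1_nonneg)
  have "1-lipschitz_on UNIV \<delta>" using lip by (intro lipschitz_onI) (auto simp: dist_norm)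
  then have "continuous_on UNIV \<delta>" by (rule lipschitz_on_continuous_on)
  then have [measurable]: "\<delta> \<in> borel_measurable borel" by (rule borel_measurable_continuous_onI)
  have e1: "norm (\<epsilon>' k x) \<le> 1" for k x
    by (rule order_trans[of _ "1/2"]) (use eps(1)[of k] in \<open>simp_all add: small_gradient_def\<close>)
  define V where "V k x K = smoothing (\<epsilon> k) (\<epsilon>' k) w x K" for k x K
  define v where "v x K = lim (\<lambda>k. V k x K)" for x K
  have V0: "V k x K = w x K" if "\<delta> x = 0" for k x K
    unfolding V_def using eps(4)[OF that, of k] by (intro smoothing_trivial) auto
  have Vst: "\<epsilon> l x = \<epsilon> k x \<and> \<epsilon>' l x = \<epsilon>' k x" if "2 * (1/2)^k \<le> \<delta> x" "k \<le> l" for k l x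
    using that(2)
  proof (induction l rule: dec_induct)
    case (step l)
    have "(1/2::real)^l \<le> (1/2)^k" using step.hyps by (intro power_decreasing) auto
    then have "2 * (1/2)^l \<le> \<delta> x" using that(1) by linarith
    then show ?case using eps(5)[of l x] step.IH by simp
  qed simp
  have lim_far: "(\<lambda>l. V l x K) \<longlonglongrightarrow> V k x K" if "2 * (1/2)^k \<le> \<delta> x" for k x K
  proof (rule tendsto_eventually)
    have "V l x K = V k x K" if "l \<ge> k" for l
      unfolding V_def
      by (rule smoothing_cong) (use Vst[OF \<open>2 * (1/2)^k \<le> \<delta> x\<close> that] in \<open>simp_all only:\<close>)
    then show "\<forall>\<^sub>F l in sequentially. V l x K = V k x K"
      unfolding eventually_sequentially by blast
  qed
  have v_far: "v x K = V k x K" if "2 * (1/2)^k \<le> \<delta> x" for k x K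
    unfolding v_def by (rule limI[OF lim_far[OF that]])
  have v0: "v x K = w x K" if "\<delta> x = 0" for x K
    unfolding v_def by (rule limI) (simp add: V0[OF that])
  have ex_k: "\<exists>k. 2 * (1/2)^k \<le> \<delta> x" if pos: "0 < \<delta> x" for x
  proof -
    obtain k where "(1/2::real)^k < \<delta> x / 2" using real_arch_pow_inv[of "\<delta> x / 2" "1/2"] pos by auto
    then show ?thesis by (intro exI[of _ k]) simp
  qed
  have lim_v: "(\<lambda>l. V l x K) \<longlonglongrightarrow> v x K" for x K
  proof (cases "\<delta> x = 0")
    case True then show ?thesis by (simp add: V0 v0)
  next
    case False
    then have "0 < \<delta> x" using bounds(1)[of x] by simp
    then obtain k where k: "2 * (1/2)^k \<le> \<delta> x" using ex_k by blast
    show ?thesis unfolding v_far[OF k] by (rule lim_far[OF k])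
  qed
  have Vm [measurable]: "(\<lambda>x. V k x K) \<in> borel_measurable borel" if "card K = r" for k K
    unfolding V_def by (rule smoothing_measurable[OF eps(1) w that])
  have vm: "(\<lambda>x. v x K) \<in> borel_measurable borel" if "card K = r" for K
    by (rule borel_measurable_LIMSEQ_real[OF lim_v Vm[OF that]])
  have v_bound: "\<bar>v x K\<bar> \<le> C * M" if K: "card K = r" and pos: "0 < \<delta> x" for x K
  proof -
    obtain k where k: "2 * (1/2)^k \<le> \<delta> x" using ex_k[OF pos] by blast
    have s: "\<delta> x / 64 \<le> \<epsilon> k x" "\<epsilon> k x \<le> \<delta> x" using eps(5)[OF k] eps(3)[of k x] pos by auto
    have "ennreal \<bar>V k x K\<bar> \<le> (\<integral>\<^sup>+y. ennreal (C * F (x + \<epsilon> k x *\<^sub>R y)) \<partial>unit_ball_measure)"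
      unfolding V_def C_def F_def by (rule ennreal_smoothing_le[of "\<epsilon>' k" x, OF e1 K])
    also have "\<dots> = (\<integral>\<^sup>+y. ennreal C * ennreal (F (x + \<epsilon> k x *\<^sub>R y)) \<partial>unit_ball_measure)"
      using C F0 by (intro nn_integral_cong ennreal_mult) auto
    also have "\<dots> = ennreal C * (\<integral>\<^sup>+y. ennreal (F (x + \<epsilon> k x *\<^sub>R y)) \<partial>unit_ball_measure)"
      by (rule nn_integral_cmult) measurable
    also have "\<dots> \<le> ennreal C * ennreal M"
      using avg[OF pos s] by (intro mult_left_mono) (auto simp: F_def)
    also have "\<dots> = ennreal (C * M)" using C M by (simp add: ennreal_mult)
    finally have "\<bar>V k x K\<bar> \<le> C * M" using C M by (subst (asm) ennreal_le_iff) auto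
    then show ?thesis by (simp add: v_far[OF k])
  qed
  \<comment> \<open>After averaging over displacements, \<open>C * h k\<close> dominates both
    \<open>V k\<close> and \<open>v\<close> on the unstable strip. The strip is taken twice as wide
    so that it contains the displaced points too; \<open>h k\<close> tends to \<open>0\<close>
    pointwise because points with \<open>\<delta> x = 0\<close> are excluded.\<close>
  define h where "h k x = (if 0 < \<delta> x \<and> \<delta> x < 4 * (1/2)^k then F x + M else 0)" for k x
  have hm [measurable]: "h k \<in> borel_measurable borel" for k unfolding h_def by measurable
  have h0: "0 \<le> h k x" for k x using F0 M by (simp add: h_def)
  have hper: "lattice_periodic (\<lambda>x. ennreal (h k x))" for k
    by (intro lattice_periodicI) (simp add: h_def lattice_periodicD[OF per] lattice_periodicD[OF F(2)])
  have h_int: "integrable torus (\<lambda>x. F x + M)" using F(3) by simp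
  have h_lim: "(\<lambda>k. \<integral>\<^sup>+x. ennreal (h k x) \<partial>torus) \<longlonglongrightarrow> 0"
  proof -
    have hmT: "h k \<in> borel_measurable torus" for k by measurable
    have hi: "integrable torus (h k)" for k
      by (rule Bochner_Integration.integrable_bound[OF h_int hmT]) (use F0 M in \<open>auto simp: h_def\<close>)
    have "(\<lambda>k. \<integral>x. h k x \<partial>torus) \<longlonglongrightarrow> (\<integral>x. 0 \<partial>(torus :: (real,'n) vec measure))"
    proof (rule integral_dominated_convergence[OF _ _ h_int])
      show "AE x in torus. (\<lambda>k. h k x) \<longlonglongrightarrow> 0"
      proof (rule AE_I2)
        fix x
        show "(\<lambda>k. h k x) \<longlonglongrightarrow> 0"
        proof (cases "0 < \<delta> x")
          case True
          then obtain k0 where k0: "(1/2::real)^k0 < \<delta> x / 4" using real_arch_pow_inv[of "\<delta> x / 4" "1/2"] by auto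
          have "h k x = 0" if "k \<ge> k0" for k
          proof -
            have "(1/2::real)^k \<le> (1/2)^k0" using that by (intro power_decreasing) auto
            then have "\<not> \<delta> x < 4 * (1/2)^k" using k0 by linarith
            then show ?thesis by (simp add: h_def)
          qed
          then show ?thesis by (intro tendsto_eventually) (auto simp: eventually_sequentially)
        qed (simp add: h_def)
      qed
      show "AE x in torus. norm (h k x) \<le> F x + M" for k
        using F0 M by (intro AE_I2) (simp add: h_def)
    qed simp_all
    then have "(\<lambda>k. ennreal (\<integral>x. h k x \<partial>torus)) \<longlonglongrightarrow> ennreal 0" by (intro tendsto_ennrealI) simp
    then show ?thesis using nn_integral_eq_integral[OF hi] h0 by simp
  qed
  interpret P: pair_sigma_finite "unit_ball_measure :: (real,'n) vec measure" "torus :: (real,'n) vec measure" ..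
  have diff: "(\<integral>\<^sup>+x. ennreal \<bar>V k x K - v x K\<bar> \<partial>torus) \<le> ennreal (2 * C) * (\<integral>\<^sup>+x. ennreal (h k x) \<partial>torus)"
    if K: "card K = r" for k K
  proof -
    note [measurable] = C1_periodic_measurable[OF small_gradientD(1)[OF eps(1), of 0 k, simplified]]
    have "(\<integral>\<^sup>+x. ennreal \<bar>V k x K - v x K\<bar> \<partial>torus)
       \<le> (\<integral>\<^sup>+x. (\<integral>\<^sup>+y. ennreal C * ennreal (h k (x + \<epsilon> k x *\<^sub>R y)) \<partial>unit_ball_measure) \<partial>torus)"
    proof (rule nn_integral_mono)
      fix x
      consider "\<delta> x = 0" | "2 * (1/2)^k \<le> \<delta> x" | "0 < \<delta> x" "\<delta> x < 2 * (1/2)^k"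
        using bounds(1)[of x] by linarith
      then show "ennreal \<bar>V k x K - v x K\<bar> \<le> (\<integral>\<^sup>+y. ennreal C * ennreal (h k (x + \<epsilon> k x *\<^sub>R y)) \<partial>unit_ball_measure)"
      proof cases
        case 3
        have "ennreal \<bar>V k x K - v x K\<bar> \<le> ennreal (\<bar>V k x K\<bar> + C * M)"
          using v_bound[OF K 3(1)] by (intro ennreal_leI) linarith
        also have "\<dots> = ennreal \<bar>V k x K\<bar> + ennreal (C * M)" using C M by (intro ennreal_plus) auto
        also have "\<dots> \<le> (\<integral>\<^sup>+y. ennreal (C * F (x + \<epsilon> k x *\<^sub>R y)) \<partial>unit_ball_measure) + (\<integral>\<^sup>+y. ennreal (C * M) \<partial>(unit_ball_measure :: (real,'n) vec measure))"
        proof (rule add_mono)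
          show "ennreal \<bar>V k x K\<bar> \<le> (\<integral>\<^sup>+y. ennreal (C * F (x + \<epsilon> k x *\<^sub>R y)) \<partial>unit_ball_measure)"
            unfolding V_def C_def F_def by (rule ennreal_smoothing_le[of "\<epsilon>' k" x, OF e1 K])
          show "ennreal (C * M) \<le> (\<integral>\<^sup>+y. ennreal (C * M) \<partial>(unit_ball_measure :: (real,'n) vec measure))"
            by (simp add: emeasure_unit_ball_measure_UNIV)
        qed
        also have "\<dots> = (\<integral>\<^sup>+y. ennreal (C * F (x + \<epsilon> k x *\<^sub>R y)) + ennreal (C * M) \<partial>unit_ball_measure)"
          by (rule nn_integral_add[symmetric]) measurable
        also have "\<dots> \<le> (\<integral>\<^sup>+y. ennreal C * ennreal (h k (x + \<epsilon> k x *\<^sub>R y)) \<partial>unit_ball_measure)"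
        proof (rule nn_integral_mono_AE, use AE_unit_ball_measure in eventually_elim)
          case (elim y)
          \<comment> \<open>The displacement changes \<open>\<delta>\<close> by at most a sixteenth
            of its value, so the image stays where \<open>\<delta>\<close> is positive and below
            \<open>4 * (1/2)^k\<close>.\<close>
          have "norm (\<epsilon> k x *\<^sub>R y) \<le> \<delta> x / 16 * 1"
            unfolding norm_scaleR using elim eps(2,3)[of k x] by (intro mult_mono) auto
          then have "\<bar>\<delta> (x + \<epsilon> k x *\<^sub>R y) - \<delta> x\<bar> \<le> \<delta> x / 16" using lip[of "x + \<epsilon> k x *\<^sub>R y" x] by simp
          then have "h k (x + \<epsilon> k x *\<^sub>R y) = F (x + \<epsilon> k x *\<^sub>R y) + M" using 3 unfolding h_def by auto
          then have "ennreal C * ennreal (h k (x + \<epsilon> k x *\<^sub>R y)) = ennreal (C * F (x + \<epsilon> k x *\<^sub>R y) + C * M)"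
            using C F0 M by (simp add: ennreal_mult[symmetric] distrib_left)
          also have "\<dots> = ennreal (C * F (x + \<epsilon> k x *\<^sub>R y)) + ennreal (C * M)"
            using C F0 M by (intro ennreal_plus) auto
          finally show ?case by simp
        qed
        finally show ?thesis .
      qed (simp_all add: V0 v0 v_far)
    qed
    also have "\<dots> = (\<integral>\<^sup>+y. (\<integral>\<^sup>+x. ennreal C * ennreal (h k (x + \<epsilon> k x *\<^sub>R y)) \<partial>torus) \<partial>unit_ball_measure)"
      by (rule P.Fubini') measurable
    also have "\<dots> \<le> (\<integral>\<^sup>+y. ennreal (2 * C) * (\<integral>\<^sup>+x. ennreal (h k x) \<partial>torus) \<partial>(unit_ball_measure :: (real,'n) vec measure))"
    proof (rule nn_integral_mono_AE, use AE_unit_ball_measure in eventually_elim)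
      case (elim y)
      have "(\<integral>\<^sup>+x. ennreal C * ennreal (h k (x + \<epsilon> k x *\<^sub>R y)) \<partial>torus) = ennreal C * (\<integral>\<^sup>+x. ennreal (h k (x + \<epsilon> k x *\<^sub>R y)) \<partial>torus)"
        by (rule nn_integral_cmult) measurable
      also have "\<dots> \<le> ennreal C * (2 * (\<integral>\<^sup>+x. ennreal (h k x) \<partial>torus))"
        by (intro mult_left_mono flow_nn_integral_le[OF eps(1) elim _ hper]) auto
      also have "\<dots> = ennreal (2 * C) * (\<integral>\<^sup>+x. ennreal (h k x) \<partial>torus)"
        using C by (simp add: ennreal_mult mult_ac)
      finally show ?case .
    qed
    also have "\<dots> = ennreal (2 * C) * (\<integral>\<^sup>+x. ennreal (h k x) \<partial>torus)"
      by (simp add: emeasure_unit_ball_measure_UNIV)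
    finally show ?thesis .
  qed
  have lim0: "(\<lambda>k. \<integral>\<^sup>+x. ennreal \<bar>V k x K - v x K\<bar> \<partial>torus) \<longlonglongrightarrow> 0" if K: "card K = r" for K
  proof (rule tendsto_sandwich[OF always_eventually always_eventually tendsto_const])
    show "\<forall>k. (\<integral>\<^sup>+x. ennreal \<bar>V k x K - v x K\<bar> \<partial>torus) \<le> ennreal (2 * C) * (\<integral>\<^sup>+x. ennreal (h k x) \<partial>torus)"
      using diff[OF K] by blast
    show "(\<lambda>k. ennreal (2 * C) * (\<integral>\<^sup>+x. ennreal (h k x) \<partial>torus)) \<longlonglongrightarrow> 0"
      using ennreal_tendsto_cmult[OF _ h_lim, of "ennreal (2 * C)"] by simp
  qed simp
  have Vi: "integrable torus (\<lambda>x. V k x K)" if "card K = r" for k K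
    unfolding V_def by (rule smoothing_integrable[OF eps(1) w that])
  have vi: "integrable torus (\<lambda>x. v x K)" if K: "card K = r" for K
  proof -
    note [measurable] = vm[OF K] Vm[OF K]
    have "\<forall>\<^sub>F k in sequentially. (\<integral>\<^sup>+x. ennreal \<bar>V k x K - v x K\<bar> \<partial>torus) < 1"
      by (rule order_tendstoD(2)[OF lim0[OF K]]) simp
    then obtain k where "(\<integral>\<^sup>+x. ennreal \<bar>V k x K - v x K\<bar> \<partial>torus) < 1" by (auto simp: eventually_sequentially)
    then have "(\<integral>\<^sup>+x. ennreal \<bar>V k x K - v x K\<bar> \<partial>torus) < \<infinity>"
      using less_trans[OF _ ennreal_one_less_top] by simp
    then have "integrable torus (\<lambda>x. V k x K - v x K)" by (simp add: integrable_iff_bounded)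
    from Bochner_Integration.integrable_diff[OF Vi[OF K, of k] this] show ?thesis by simp
  qed
  have "torus_closed r v"
    unfolding torus_closed_def
  proof (intro allI impI)
    fix J :: "'n set" and \<phi> :: "(real,'n) vec \<Rightarrow> real" assume A: "card J = Suc r \<and> smooth_fun \<phi> \<and> periodic_fun \<phi>"
    then have \<phi>C: "C1_periodic \<phi> (\<lambda>x. \<chi> j. pderiv j \<phi> x)" by (intro smooth_C1_periodic) auto
    obtain B where B: "B > 0" "\<And>x. norm (\<chi> j. pderiv j \<phi> x) \<le> B" using C1_periodic_bounds[OF \<phi>C] by metis
    have Bj: "\<bar>pderiv j \<phi> x\<bar> \<le> B" for j x
      using component_le_norm_cart[of "\<chi> j. pderiv j \<phi> x" j] B(2)[of x] by simp
    have [measurable]: "pderiv j \<phi> \<in> borel_measurable borel" for j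
      using measurable_compose[OF C1_periodic_measurable(2)[OF \<phi>C] measurable_vec_nth[of j]] by simp
    have "(\<lambda>k. \<Sum>j\<in>J. fsign j J * (\<integral>x. V k x (J - {j}) * pderiv j \<phi> x \<partial>torus))
       \<longlonglongrightarrow> (\<Sum>j\<in>J. fsign j J * (\<integral>x. v x (J - {j}) * pderiv j \<phi> x \<partial>torus))"
    proof (intro tendsto_sum tendsto_mult tendsto_const)
      fix j assume "j \<in> J"
      then have K: "card (J - {j}) = r" using A by simp
      note [measurable] = vm[OF K] Vm[OF K]
      show "(\<lambda>k. \<integral>x. V k x (J - {j}) * pderiv j \<phi> x \<partial>torus) \<longlonglongrightarrow> (\<integral>x. v x (J - {j}) * pderiv j \<phi> x \<partial>torus)"
      proof (rule tendsto_L1_int)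
        show "integrable torus (\<lambda>x. V k x (J - {j}) * pderiv j \<phi> x)" for k
          by (rule torus_integrable_mult_bounded[OF Vi[OF K] _ _ Bj[folded real_norm_def]]) measurable
        show "integrable torus (\<lambda>x. v x (J - {j}) * pderiv j \<phi> x)"
          by (rule torus_integrable_mult_bounded[OF vi[OF K] _ _ Bj[folded real_norm_def]]) measurable
        show "(\<lambda>k. \<integral>\<^sup>+x. ennreal (norm (V k x (J - {j}) * pderiv j \<phi> x - v x (J - {j}) * pderiv j \<phi> x)) \<partial>torus) \<longlonglongrightarrow> 0"
        proof (rule tendsto_sandwich[OF always_eventually always_eventually tendsto_const])
          show "\<forall>k. (\<integral>\<^sup>+x. ennreal (norm (V k x (J - {j}) * pderiv j \<phi> x - v x (J - {j}) * pderiv j \<phi> x)) \<partial>torus)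
             \<le> ennreal B * (\<integral>\<^sup>+x. ennreal \<bar>V k x (J - {j}) - v x (J - {j})\<bar> \<partial>torus)"
          proof
            fix k
            have "(\<integral>\<^sup>+x. ennreal (norm (V k x (J - {j}) * pderiv j \<phi> x - v x (J - {j}) * pderiv j \<phi> x)) \<partial>torus)
              \<le> (\<integral>\<^sup>+x. ennreal B * ennreal \<bar>V k x (J - {j}) - v x (J - {j})\<bar> \<partial>torus)"
            proof (rule nn_integral_mono)
              fix x
              have "norm (V k x (J - {j}) * pderiv j \<phi> x - v x (J - {j}) * pderiv j \<phi> x) \<le> B * \<bar>V k x (J - {j}) - v x (J - {j})\<bar>"
                using mult_right_mono[OF Bj[of j x] abs_ge_zero[of "V k x (J - {j}) - v x (J - {j})"]]
                by (simp only: left_diff_distrib[symmetric] real_norm_def abs_mult mult.commute[of _ "\<bar>pderiv j \<phi> x\<bar>"])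
              then show "ennreal (norm (V k x (J - {j}) * pderiv j \<phi> x - v x (J - {j}) * pderiv j \<phi> x))
                 \<le> ennreal B * ennreal \<bar>V k x (J - {j}) - v x (J - {j})\<bar>"
                using B(1) by (subst ennreal_mult[symmetric]) (auto intro: ennreal_leI)
            qed
            also have "\<dots> = ennreal B * (\<integral>\<^sup>+x. ennreal \<bar>V k x (J - {j}) - v x (J - {j})\<bar> \<partial>torus)"
              by (rule nn_integral_cmult) measurable
            finally show "(\<integral>\<^sup>+x. ennreal (norm (V k x (J - {j}) * pderiv j \<phi> x - v x (J - {j}) * pderiv j \<phi> x)) \<partial>torus)
             \<le> ennreal B * (\<integral>\<^sup>+x. ennreal \<bar>V k x (J - {j}) - v x (J - {j})\<bar> \<partial>torus)" .
          qed
          show "(\<lambda>k. ennreal B * (\<integral>\<^sup>+x. ennreal \<bar>V k x (J - {j}) - v x (J - {j})\<bar> \<partial>torus)) \<longlonglongrightarrow> 0"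
            using ennreal_tendsto_cmult[OF _ lim0[OF K], of "ennreal B"] by simp
        qed simp
      qed
    qed
    moreover have "(\<Sum>j\<in>J. fsign j J * (\<integral>x. V k x (J - {j}) * pderiv j \<phi> x \<partial>torus)) = 0" for k
      using smoothing_closed[OF eps(1) w closed, of k] A unfolding torus_closed_def V_def by blast
    ultimately show "(\<Sum>j\<in>J. fsign j J * (\<integral>x. v x (J - {j}) * pderiv j \<phi> x \<partial>torus)) = 0"
      by (simp add: LIMSEQ_const_iff)
  qed
  then show thesis using vm v0 v_bound by (intro that[of v])
qed

section \<open>The bad set and the truncation\<close>

lemma nn_integral_scaled_ball:
  fixes h :: "(real,'n::finite) vec \<Rightarrow> ennreal"
  assumes [measurable]: "h \<in> borel_measurable borel" and s: "s > 0"
  shows "(\<integral>\<^sup>+z\<in>cball x s. h z \<partial>lborel) = ennreal (s ^ CARD('n)) * (\<integral>\<^sup>+y\<in>cball 0 1. h (x + s *\<^sub>R y) \<partial>lborel)"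
proof -
  have [measurable]: "cball x s \<in> sets borel" "cball (0::(real,'n) vec) 1 \<in> sets borel" by (simp_all add: borel_closed)
  have "(\<integral>\<^sup>+z\<in>cball x s. h z \<partial>lborel)
     = (\<integral>\<^sup>+z. h z * indicator (cball x s) z \<partial>density (distr lborel borel (\<lambda>y. x + s *\<^sub>R y)) (\<lambda>_. \<bar>s\<bar> ^ DIM((real,'n) vec)))"
    using lborel_affine[of s x] s by simp
  also have "\<dots> = (\<integral>\<^sup>+z. ennreal (s ^ CARD('n)) * (h z * indicator (cball x s) z) \<partial>distr lborel borel (\<lambda>y. x + s *\<^sub>R y))"
    using s by (subst nn_integral_density) auto
  also have "\<dots> = (\<integral>\<^sup>+y. ennreal (s ^ CARD('n)) * (h (x + s *\<^sub>R y) * indicator (cball x s) (x + s *\<^sub>R y)) \<partial>lborel)"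
    by (subst nn_integral_distr) auto
  also have "\<dots> = (\<integral>\<^sup>+y. ennreal (s ^ CARD('n)) * (h (x + s *\<^sub>R y) * indicator (cball 0 1) y) \<partial>lborel)"
    using s by (intro nn_integral_cong) (auto split: split_indicator simp: dist_norm)
  also have "\<dots> = ennreal (s ^ CARD('n)) * (\<integral>\<^sup>+y\<in>cball 0 1. h (x + s *\<^sub>R y) \<partial>lborel)"
    by (rule nn_integral_cmult) simp
  finally show ?thesis .
qed

lemma emeasure_cball_scale:
  fixes x :: "(real,'n::finite) vec"
  assumes "s > 0"
  shows "emeasure lborel (cball x s) = ennreal (s ^ CARD('n)) * emeasure lborel (cball (0 :: (real,'n) vec) 1)"
  using nn_integral_scaled_ball[of "\<lambda>_. 1" s x] assms by simp

text \<open>Passing from the ball of radius \<open>s\<close> to the surrounding one of radius at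
  most \<open>\<kappa> * s\<close> costs the ratio of the volumes, at most \<open>\<kappa>\<close>
  to the power of the dimension.\<close>

lemma ball_average_le:
  fixes h :: "(real,'n::finite) vec \<Rightarrow> ennreal"
  assumes [measurable]: "h \<in> borel_measurable borel" and s: "s > 0" and T: "T \<ge> 0"
    and sub: "cball x s \<subseteq> cball p \<rho>" and \<rho>: "0 < \<rho>" "\<rho> \<le> \<kappa> * s"
    and bound: "(\<integral>\<^sup>+z\<in>cball p \<rho>. h z \<partial>lborel) \<le> ennreal T * emeasure lborel (cball p \<rho>)"
  shows "(\<integral>\<^sup>+y. h (x + s *\<^sub>R y) \<partial>unit_ball_measure) \<le> ennreal (T * \<kappa> ^ CARD('n))"
proof -
  let ?\<beta> = "emeasure lborel (cball (0 :: (real,'n) vec) 1)" and ?N = "CARD('n)"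
  have \<beta>: "?\<beta> \<noteq> 0" "?\<beta> \<noteq> \<infinity>" by (rule emeasure_unit_cball)+
  define A where "A = (\<integral>\<^sup>+y\<in>cball 0 1. h (x + s *\<^sub>R y) \<partial>lborel)"
  have \<kappa>: "\<kappa> > 0" using \<rho> s by (metis less_le_trans zero_less_mult_pos2)
  have "ennreal (s ^ ?N) * A = (\<integral>\<^sup>+z\<in>cball x s. h z \<partial>lborel)"
    unfolding A_def by (rule nn_integral_scaled_ball[OF _ s, symmetric]) simp
  also have "\<dots> \<le> (\<integral>\<^sup>+z\<in>cball p \<rho>. h z \<partial>lborel)"
    using sub by (intro nn_integral_mono) (auto split: split_indicator)
  also have "\<dots> \<le> ennreal T * (ennreal (\<rho> ^ ?N) * ?\<beta>)" using bound by (simp add: emeasure_cball_scale[OF \<rho>(1)])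
  also have "\<dots> \<le> ennreal T * (ennreal ((\<kappa> * s) ^ ?N) * ?\<beta>)"
    using \<rho> by (intro mult_left_mono mult_right_mono ennreal_leI power_mono) auto
  also have "\<dots> = ennreal (s ^ ?N) * (ennreal (T * \<kappa> ^ ?N) * ?\<beta>)"
    using s \<kappa> T by (simp add: power_mult_distrib ennreal_mult mult_ac)
  finally have "A \<le> ennreal (T * \<kappa> ^ ?N) * ?\<beta>"
    using s by (subst (asm) ennreal_mult_le_mult_iff) auto
  then have "A / ?\<beta> \<le> ennreal (T * \<kappa> ^ ?N) * ?\<beta> / ?\<beta>" by (rule divide_right_mono_ennreal)
  also have "\<dots> = ennreal (T * \<kappa> ^ ?N)" using \<beta> by (simp add: ennreal_mult_divide_eq)
  finally have "A / ?\<beta> \<le> ennreal (T * \<kappa> ^ ?N)" .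
  moreover have "(\<integral>\<^sup>+y. h (x + s *\<^sub>R y) \<partial>unit_ball_measure) = A / ?\<beta>"
  proof -
    have [measurable]: "cball (0::(real,'n) vec) 1 \<in> sets borel" by (simp add: borel_closed)
    have "(\<integral>\<^sup>+y. h (x + s *\<^sub>R y) \<partial>unit_ball_measure) = (\<integral>\<^sup>+y. (h (x + s *\<^sub>R y) * indicator (cball 0 1) y) / ?\<beta> \<partial>lborel)"
      unfolding unit_ball_measure_def uniform_measure_def
      by (subst nn_integral_density) (simp_all add: divide_ennreal_def mult_ac)
    also have "\<dots> = A / ?\<beta>" unfolding A_def by (rule nn_integral_divide) simp
    finally show ?thesis .
  qed
  ultimately show ?thesis by simp
qed

section \<open>Open periodic sets and the maximal function\<close>

lemma lattice_hull_open:
  assumes "open G0" shows "open {x :: (real,'n::finite) vec. \<exists>k\<in>int_lattice. x + k \<in> G0}"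
proof -
  have "{x. \<exists>k\<in>int_lattice. x + k \<in> G0} = (\<Union>k\<in>int_lattice. (\<lambda>x. x + k) -` G0)" by auto
  moreover have "open ((\<lambda>x. x + k) -` G0)" for k
    by (intro open_vimage assms continuous_intros)
  ultimately show ?thesis by auto
qed

lemma lattice_hull_invariant:
  assumes "k \<in> int_lattice" "x \<in> {x. \<exists>k\<in>int_lattice. x + k \<in> G0}"
  shows "x + k \<in> {x. \<exists>k\<in>int_lattice. x + k \<in> G0}"
proof -
  obtain l where l: "l \<in> int_lattice" "x + l \<in> G0" using assms by auto
  then show ?thesis using assms(1) int_lattice_add[of l "- k"]
    by (intro CollectI bexI[of _ "l - k"]) (auto simp: algebra_simps)
qed

lemma emeasure_UN_le_count_space:
  assumes "countable C" "\<And>i. i \<in> C \<Longrightarrow> B i \<in> sets M"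
  shows "emeasure M (\<Union>i\<in>C. B i) \<le> (\<integral>\<^sup>+i. emeasure M (B i) \<partial>count_space C)"
proof -
  have [measurable]: "(\<Union>i\<in>C. B i) \<in> sets M" using assms by (intro sets.countable_UN') auto
  have "emeasure M (\<Union>i\<in>C. B i) = (\<integral>\<^sup>+x. indicator (\<Union>i\<in>C. B i) x \<partial>M)" by simp
  also have "\<dots> \<le> (\<integral>\<^sup>+x. (\<integral>\<^sup>+i. indicator (B i) x \<partial>count_space C) \<partial>M)"
  proof (rule nn_integral_mono)
    fix x
    show "indicator (\<Union>i\<in>C. B i) x \<le> (\<integral>\<^sup>+i. (indicator (B i) x :: ennreal) \<partial>count_space C)"
    proof (cases "x \<in> (\<Union>i\<in>C. B i)")
      case True
      then obtain j where j: "j \<in> C" "x \<in> B j" by auto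
      have "(1::ennreal) = (\<integral>\<^sup>+i. indicator {j} i \<partial>count_space C)"
        using j by (simp add: nn_integral_indicator emeasure_count_space)
      also have "\<dots> \<le> (\<integral>\<^sup>+i. (indicator (B i) x :: ennreal) \<partial>count_space C)"
        using j by (intro nn_integral_mono) (auto split: split_indicator)
      finally show ?thesis using True by simp
    qed simp
  qed
  also have "\<dots> = (\<integral>\<^sup>+i. (\<integral>\<^sup>+x. indicator (B i) x \<partial>M) \<partial>count_space C)"
    using assms by (intro nn_integral_count_space_nn_integral) auto
  also have "\<dots> = (\<integral>\<^sup>+i. emeasure M (B i) \<partial>count_space C)"
    using assms by (intro nn_integral_cong) auto
  finally show ?thesis .
qed

text \<open>The weak-type estimate for the maximal function with radii at most \<open>R0\<close>.
  \<open>G\<close> is not the superlevel set itself but the lattice hull of the fivefold Vitali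
  balls, which contains it and is open. Bounded radii serve the covering lemma and confine all balls
  centred in the cell to one fixed ball.\<close>

lemma maximal_function_bad_set:
  fixes R0 :: real
  assumes R0: "R0 > 0"
  obtains A where "A \<ge> 0" "\<And>(f :: (real,'n::finite) vec \<Rightarrow> ennreal) L. f \<in> borel_measurable borel \<Longrightarrow> lattice_periodic f \<Longrightarrow> L > 0 \<Longrightarrow>
    \<exists>G. open G \<and> (\<forall>x k. k \<in> int_lattice \<longrightarrow> x \<in> G \<longrightarrow> x + k \<in> G) \<and>
      emeasure torus G \<le> ennreal (A / L) * (\<integral>\<^sup>+x. f x \<partial>torus) \<and>
      (\<forall>p \<rho>. p \<notin> G \<longrightarrow> 0 < \<rho> \<longrightarrow> \<rho> \<le> R0 \<longrightarrow> (\<integral>\<^sup>+z\<in>cball p \<rho>. f z \<partial>lborel) \<le> ennreal L * emeasure lborel (cball p \<rho>))"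
proof -
  let ?N = "CARD('n)"
  have "\<exists>M. \<forall>f :: (real,'n) vec \<Rightarrow> ennreal. f \<in> borel_measurable borel \<longrightarrow> lattice_periodic f \<longrightarrow>
     (\<integral>\<^sup>+x\<in>cball 0 (?N + R0). f x \<partial>lborel) \<le> of_nat M * (\<integral>\<^sup>+x. f x \<partial>torus)"
    by (rule nn_integral_bounded_le_torus[of "?N + R0", where 'n='n]) blast
  then obtain M where M: "\<And>f :: (real,'n) vec \<Rightarrow> ennreal. f \<in> borel_measurable borel \<Longrightarrow> lattice_periodic f \<Longrightarrow>
     (\<integral>\<^sup>+x\<in>cball 0 (?N + R0). f x \<partial>lborel) \<le> of_nat M * (\<integral>\<^sup>+x. f x \<partial>torus)"
    by blast
  show thesis
  \<comment> \<open>\<open>5 ^ ?N\<close> is the volume ratio of the enlarged balls, and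
    \<open>M\<close> is the price of passing from the ball of radius \<open>?N + R0\<close> to the
    torus.\<close>
  proof (rule that[of "5 ^ ?N * real M"])
    show "0 \<le> 5 ^ ?N * real M" by simp
    fix f :: "(real,'n) vec \<Rightarrow> ennreal" and L :: real
    assume fm [measurable]: "f \<in> borel_measurable borel" and per: "lattice_periodic f" and L: "L > 0"
    define bad where "bad p \<rho> \<longleftrightarrow> 0 < \<rho> \<and> \<rho> \<le> R0 \<and> ennreal L * emeasure lborel (cball p \<rho>) < (\<integral>\<^sup>+z\<in>cball p \<rho>. f z \<partial>lborel)" for p \<rho>
    define F where "F = {p \<in> unit_cell. \<exists>\<rho>. bad p \<rho>}"
    define \<rho> where "\<rho> p = (SOME \<rho>. bad p \<rho>)" for p
    have \<rho>: "bad p (\<rho> p)" if "p \<in> F" for p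
      using that someI_ex[of "bad p"] by (auto simp: F_def \<rho>_def)
    have r: "0 < \<rho> p \<and> \<rho> p \<le> R0" if "p \<in> F" for p using \<rho>[OF that] by (simp add: bad_def)
    obtain C where C: "countable C" "C \<subseteq> F" "pairwise (\<lambda>i j. disjnt (cball i (\<rho> i)) (cball j (\<rho> j))) C"
      "\<And>i. i \<in> F \<Longrightarrow> \<exists>j. j \<in> C \<and> \<not> disjnt (cball i (\<rho> i)) (cball j (\<rho> j)) \<and> cball i (\<rho> i) \<subseteq> ball j (5 * \<rho> j)"
      by (rule Vitali_covering_lemma_cballs_balls[OF r, where a="\<lambda>i. i"]) (blast intro: that)+
    define G0 where "G0 = (\<Union>j\<in>C. ball j (5 * \<rho> j))"
    define G where "G = {x. \<exists>k\<in>int_lattice. x + k \<in> G0}"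
    have oG0: "open G0" by (simp add: G0_def open_UN)
    have FG0: "p \<in> G0" if pF: "p \<in> F" for p
    proof -
      obtain j where "j \<in> C" "cball p (\<rho> p) \<subseteq> ball j (5 * \<rho> j)" using C(4)[OF pF] by blast
      moreover have "p \<in> cball p (\<rho> p)" using \<rho>[OF pF] by (simp add: bad_def)
      ultimately show ?thesis unfolding G0_def by blast
    qed
    have "emeasure torus G \<le> emeasure lborel G0"
      unfolding G_def using oG0 by (intro emeasure_torus_lattice_hull) simp
    also have "\<dots> \<le> (\<integral>\<^sup>+j. emeasure lborel (ball j (5 * \<rho> j)) \<partial>count_space C)"
      unfolding G0_def using C(1) by (intro emeasure_UN_le_count_space) auto
    also have "\<dots> \<le> (\<integral>\<^sup>+j. ennreal (5 ^ ?N / L) * (\<integral>\<^sup>+z\<in>cball j (\<rho> j). f z \<partial>lborel) \<partial>count_space C)"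
    proof (rule nn_integral_mono)
      fix j assume "j \<in> space (count_space C)"
      then have b: "bad j (\<rho> j)" using C(2) \<rho> by auto
      then have pos: "0 < \<rho> j" by (simp add: bad_def)
      have "emeasure lborel (ball j (5 * \<rho> j)) \<le> emeasure lborel (cball j (5 * \<rho> j))"
        by (intro emeasure_mono) auto
      also have "\<dots> = ennreal (5 ^ ?N) * emeasure lborel (cball j (\<rho> j))"
        using pos emeasure_cball_scale[of "5 * \<rho> j" j] emeasure_cball_scale[of "\<rho> j" j]
        by (simp add: power_mult_distrib ennreal_mult mult.assoc)
      also have "\<dots> = ennreal (5 ^ ?N / L) * (ennreal L * emeasure lborel (cball j (\<rho> j)))"
        using L by (simp add: mult.assoc[symmetric] ennreal_mult[symmetric])
      also have "\<dots> \<le> ennreal (5 ^ ?N / L) * (\<integral>\<^sup>+z\<in>cball j (\<rho> j). f z \<partial>lborel)"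
        using b by (intro mult_left_mono) (auto simp: bad_def)
      finally show "emeasure lborel (ball j (5 * \<rho> j)) \<le> ennreal (5 ^ ?N / L) * (\<integral>\<^sup>+z\<in>cball j (\<rho> j). f z \<partial>lborel)" .
    qed
    also have "\<dots> = ennreal (5 ^ ?N / L) * (\<integral>\<^sup>+j. (\<integral>\<^sup>+z\<in>cball j (\<rho> j). f z \<partial>lborel) \<partial>count_space C)"
      by (rule nn_integral_cmult) simp
    also have "(\<integral>\<^sup>+j. (\<integral>\<^sup>+z\<in>cball j (\<rho> j). f z \<partial>lborel) \<partial>count_space C)
        = (\<integral>\<^sup>+z. (\<integral>\<^sup>+j. f z * indicator (cball j (\<rho> j)) z \<partial>count_space C) \<partial>lborel)"
      using C(1) by (intro nn_integral_count_space_nn_integral[symmetric] borel_measurable_times_ennreal borel_measurable_indicator)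
        (simp_all add: borel_closed)
    \<comment> \<open>The selected balls are disjoint, so at most one summand is nonzero at each
      \<open>z\<close>; their centres lie in the cell and their radii are at most
      \<open>R0\<close>.\<close>
    also have "\<dots> \<le> (\<integral>\<^sup>+z\<in>cball 0 (?N + R0). f z \<partial>lborel)"
    proof (rule nn_integral_mono)
      fix z :: "(real,'n) vec"
      show "(\<integral>\<^sup>+j. f z * indicator (cball j (\<rho> j)) z \<partial>count_space C) \<le> f z * indicator (cball 0 (?N + R0)) z"
      proof (cases "\<exists>j\<in>C. z \<in> cball j (\<rho> j)")
        case False
        then have "(\<integral>\<^sup>+j. f z * indicator (cball j (\<rho> j)) z \<partial>count_space C) = (\<integral>\<^sup>+j. 0 \<partial>count_space C)"
          by (intro nn_integral_cong) (auto split: split_indicator)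
        then show ?thesis by simp
      next
        case True
        then obtain j where j: "j \<in> C" "z \<in> cball j (\<rho> j)" by blast
        have uniq: "i = j" if "i \<in> C" "z \<in> cball i (\<rho> i)" for i
          using C(3) that j unfolding pairwise_def disjnt_def by blast
        have "(\<integral>\<^sup>+i. f z * indicator (cball i (\<rho> i)) z \<partial>count_space C) = (\<integral>\<^sup>+i. f z * indicator {j} i \<partial>count_space C)"
        proof (rule nn_integral_cong)
          fix i assume "i \<in> space (count_space C)"
          then have "z \<in> cball i (\<rho> i) \<longleftrightarrow> i \<in> {j}" using uniq[of i] j by auto
          then show "f z * indicator (cball i (\<rho> i)) z = f z * indicator {j} i"
            by (simp only: indicator_def)
        qed
        also have "\<dots> = f z" using j by (simp add: nn_integral_cmult nn_integral_indicator emeasure_count_space)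
        finally have eq: "(\<integral>\<^sup>+i. f z * indicator (cball i (\<rho> i)) z \<partial>count_space C) = f z" .
        have "j \<in> F" using j C(2) by blast
        then have "norm j \<le> ?N" "\<rho> j \<le> R0" using \<rho>[of j] norm_unit_cell_le[of j] by (auto simp: F_def bad_def)
        moreover have "norm (z - j) \<le> \<rho> j" using j(2) by (simp add: dist_norm norm_minus_commute)
        ultimately have "norm z \<le> ?N + R0" using norm_triangle_sub[of z j] by linarith
        then show ?thesis unfolding eq by simp
      qed
    qed
    also have "\<dots> \<le> of_nat M * (\<integral>\<^sup>+x. f x \<partial>torus)" by (rule M[OF fm per])
    finally have "emeasure torus G \<le> ennreal (5 ^ ?N / L) * (of_nat M * (\<integral>\<^sup>+x. f x \<partial>torus))"
      by (simp add: mult_left_mono)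
    also have "\<dots> = ennreal (5 ^ ?N * real M / L) * (\<integral>\<^sup>+x. f x \<partial>torus)"
      using L by (simp add: ennreal_of_nat_eq_real_of_nat mult.assoc[symmetric] ennreal_mult[symmetric])
    finally have m: "emeasure torus G \<le> ennreal (5 ^ ?N * real M / L) * (\<integral>\<^sup>+x. f x \<partial>torus)" .
    have good: "(\<integral>\<^sup>+z\<in>cball p r. f z \<partial>lborel) \<le> ennreal L * emeasure lborel (cball p r)"
      if p: "p \<notin> G" and r: "0 < r" "r \<le> R0" for p r
    proof (rule ccontr)
      assume n: "\<not> ?thesis"
      \<comment> \<open>A failure at \<open>p\<close> is moved into the cell by periodicity, where
        \<open>p + k\<close> belongs to \<open>F\<close>.\<close>
      define k where "k = wrap p - p"
      have k: "k \<in> int_lattice" by (simp add: k_def wrap_diff_int_lattice)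
      have [measurable]: "cball (p + k) r \<in> sets borel" by (simp add: borel_closed)
      have "(\<integral>\<^sup>+z\<in>cball (p + k) r. f z \<partial>lborel) = (\<integral>\<^sup>+z. f (z + k) * indicator (cball (p + k) r) (z + k) \<partial>lborel)"
        by (rule lborel_nn_integral_translate[symmetric]) simp
      also have "\<dots> = (\<integral>\<^sup>+z\<in>cball p r. f z \<partial>lborel)"
        by (intro nn_integral_cong) (simp add: lattice_periodicD[OF per k] dist_norm indicator_def)
      finally have "bad (p + k) r"
        using n r unfolding bad_def not_le emeasure_cball_scale[OF r(1)] by simp
      then have "p + k \<in> F" using wrap_in_unit_cell[of p] by (auto simp: F_def k_def)
      then have "p \<in> G" unfolding G_def using FG0 k by blast
      then show False using p by simp
    qed
    show "\<exists>G. open G \<and> (\<forall>x k. k \<in> int_lattice \<longrightarrow> x \<in> G \<longrightarrow> x + k \<in> G) \<and>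
      emeasure torus G \<le> ennreal (5 ^ ?N * real M / L) * (\<integral>\<^sup>+x. f x \<partial>torus) \<and>
      (\<forall>p \<rho>. p \<notin> G \<longrightarrow> 0 < \<rho> \<longrightarrow> \<rho> \<le> R0 \<longrightarrow> (\<integral>\<^sup>+z\<in>cball p \<rho>. f z \<partial>lborel) \<le> ennreal L * emeasure lborel (cball p \<rho>))"
    proof (intro exI[of _ G] conjI allI impI)
      show "open G" unfolding G_def by (rule lattice_hull_open[OF oG0])
      show "x + k \<in> G" if "k \<in> int_lattice" "x \<in> G" for x k
        using lattice_hull_invariant[of k x G0] that unfolding G_def by blast
      show "emeasure torus G \<le> ennreal (5 ^ ?N * real M / L) * (\<integral>\<^sup>+x. f x \<partial>torus)" by (rule m)
      show "(\<integral>\<^sup>+z\<in>cball p r. f z \<partial>lborel) \<le> ennreal L * emeasure lborel (cball p r)"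
        if "p \<notin> G" "0 < r" "r \<le> R0" for p r by (rule good[OF that])
    qed
  qed
qed


section \<open>Norms of forms and the construction of the truncation\<close>

lemma form_norm_L2: "form_norm r a = L2_set a {K. card K = r}"
  by (simp add: form_norm_def L2_set_def)

lemma form_norm_nonneg: "0 \<le> form_norm r a"
  by (simp add: form_norm_def sum_nonneg)

lemma form_norm_cong: "(\<And>K. card K = r \<Longrightarrow> a K = b K) \<Longrightarrow> form_norm r a = form_norm r b"
  by (simp add: form_norm_def)

lemma form_norm_le_l1: "form_norm r a \<le> form_l1 r (a :: 'n::finite set \<Rightarrow> real)"
  unfolding form_norm_L2 form_l1_def by (rule L2_set_le_sum_abs)

lemma form_l1_le_norm: "form_l1 r a \<le> real (card {K :: 'n set. card K = r}) * form_norm r (a :: 'n::finite set \<Rightarrow> real)"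
  unfolding form_l1_def
proof (rule sum_bounded_above)
  fix K :: "'n set" assume "K \<in> {K. card K = r}"
  then have "\<bar>a K\<bar> \<le> L2_set (\<lambda>K. \<bar>a K\<bar>) {K. card K = r}" by (intro member_le_L2_set) auto
  then show "\<bar>a K\<bar> \<le> form_norm r a" by (simp add: form_norm_L2 L2_set_def)
qed

lemma torus_form_norm:
  assumes "periodic_L1_form r w"
  shows "(\<lambda>x. form_norm r (w x)) \<in> borel_measurable borel" "lattice_periodic (\<lambda>x. form_norm r (w x))"
    "integrable torus (\<lambda>x. form_norm r (w x))"
proof -
  show m: "(\<lambda>x. form_norm r (w x)) \<in> borel_measurable borel"
    using assms unfolding form_norm_def periodic_L1_form_def
    by (intro borel_measurable_sqrt[THEN measurable_compose[rotated]] borel_measurable_sum borel_measurable_power) auto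
  show "lattice_periodic (\<lambda>x. form_norm r (w x))"
    using assms unfolding form_norm_def periodic_L1_form_def by (auto simp: lattice_periodic_def)
  show "integrable torus (\<lambda>x. form_norm r (w x))"
  proof (rule Bochner_Integration.integrable_bound[OF form_l1_measurable(3)[OF assms]])
    show "AE x in torus. norm (form_norm r (w x)) \<le> norm (form_l1 r (w x))"
      by (intro AE_I2) (simp add: form_norm_nonneg form_l1_nonneg form_norm_le_l1)
  qed (use m in measurable)
qed

text \<open>Chebyshev's inequality bounds the set of large values in the cell by
  \<open>I / L\<close>, and outer regularity encloses it in an open set at the price of another
  \<open>I / L\<close>; positivity of \<open>I\<close> leaves this room.\<close>

lemma torus_excess_open_superset:
  fixes g :: "(real,'n::finite) vec \<Rightarrow> real"
  assumes gm [measurable]: "g \<in> borel_measurable borel" and per: "lattice_periodic g" and L: "L > 0" and I: "I > 0"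
    and gI: "(\<integral>\<^sup>+x. ennreal (if L < g x then g x else 0) \<partial>torus) \<le> ennreal I"
  obtains H where "open H" "\<And>x k. k \<in> int_lattice \<Longrightarrow> x \<in> H \<Longrightarrow> x + k \<in> H" "\<And>x. x \<notin> H \<Longrightarrow> g x \<le> L"
    "emeasure torus H \<le> ennreal (2 * I / L)"
proof -
  define E where "E = {x \<in> unit_cell. L < g x}"
  have "E = unit_cell \<inter> {x \<in> space borel. L < g x}" by (auto simp: E_def)
  then have E [measurable]: "E \<in> sets borel" by simp
  have "ennreal L * emeasure lborel E = (\<integral>\<^sup>+x. ennreal L * indicator E x \<partial>lborel)"
    by (simp add: nn_integral_cmult)
  also have "\<dots> \<le> (\<integral>\<^sup>+x. ennreal (if L < g x then g x else 0) * indicator unit_cell x \<partial>lborel)"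
    by (intro nn_integral_mono) (simp add: E_def indicator_def ennreal_leI)
  also have "\<dots> = (\<integral>\<^sup>+x. ennreal (if L < g x then g x else 0) \<partial>torus)"
    by (rule nn_integral_torus[symmetric]) measurable
  also note gI
  finally have "ennreal L * emeasure lborel E \<le> ennreal L * ennreal (I / L)"
    using L I by (simp add: ennreal_mult[symmetric])
  then have mE: "emeasure lborel E \<le> ennreal (I / L)" using L by (subst (asm) ennreal_mult_le_mult_iff) auto
  have "E \<in> sets lebesgue" "I / L > 0" using E L I by simp_all
  then obtain O0 where O0: "open O0" "E \<subseteq> O0" "emeasure lebesgue (O0 - E) < ennreal (I / L)"
    by (rule sets_lebesgue_outer_open) (rule that)
  have [measurable]: "O0 \<in> sets borel" using O0(1) by simp
  have "emeasure lborel O0 \<le> emeasure lborel E + emeasure lborel (O0 - E)"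
    using emeasure_subadditive[of E lborel "O0 - E"] O0(2) by (simp add: Un_absorb1)
  also have "\<dots> \<le> ennreal (I / L) + ennreal (I / L)"
    using O0(3) mE by (intro add_mono) (auto simp: less_imp_le)
  also have "\<dots> = ennreal (2 * I / L)" using I L by (simp flip: ennreal_plus)
  finally have mO: "emeasure lborel O0 \<le> ennreal (2 * I / L)" .
  let ?H = "{x. \<exists>k\<in>int_lattice. x + k \<in> O0}"
  show thesis
  proof
    show "open ?H" by (rule lattice_hull_open[OF O0(1)])
    show "x + k \<in> ?H" if "k \<in> int_lattice" "x \<in> ?H" for x k by (rule lattice_hull_invariant[OF that])
    show "g x \<le> L" if "x \<notin> ?H" for x
    proof (rule ccontr)
      assume "\<not> g x \<le> L"
      then have "wrap x \<in> E" by (simp add: E_def wrap_in_unit_cell lattice_periodic_wrap[OF per])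
      then have "x + (wrap x - x) \<in> O0" using subsetD[OF O0(2)] by simp
      then have "x \<in> ?H" by (intro CollectI bexI[OF _ wrap_diff_int_lattice])
      then show False using that by simp
    qed
    show "emeasure torus ?H \<le> ennreal (2 * I / L)"
      by (rule order_trans[OF emeasure_torus_lattice_hull mO]) simp
  qed
qed

lemma truncate_off_closed_set:
  fixes w :: "(real, 'n::{finite,linorder}) vec \<Rightarrow> 'n set \<Rightarrow> real"
  defines "n \<equiv> real CARD('n)"
  assumes w: "periodic_L1_form r w" and cl: "torus_closed r w" and T: "T \<ge> 0"
    and X: "closed X" and Xper: "\<And>x k. k \<in> int_lattice \<Longrightarrow> x \<in> X \<Longrightarrow> x + k \<in> X"
    and avg: "\<And>p \<rho>. p \<in> X \<Longrightarrow> 0 < \<rho> \<Longrightarrow> \<rho> \<le> n + 1 \<Longrightarrow>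
      (\<integral>\<^sup>+z\<in>cball p \<rho>. ennreal (form_l1 r (w z)) \<partial>lborel) \<le> ennreal T * emeasure lborel (cball p \<rho>)"
  obtains v where "\<And>K. card K = r \<Longrightarrow> (\<lambda>x. v x K) \<in> borel_measurable borel" "torus_closed r v"
    "\<And>x K. x \<in> X \<Longrightarrow> v x K = w x K"
    "\<And>x K. card K = r \<Longrightarrow> x \<notin> X \<Longrightarrow> \<bar>v x K\<bar> \<le> (1 + n * n) * (T * (64 * (n + 1)) ^ CARD('n))"
proof (cases "X = {}")
  \<comment> \<open>There is no meaningful distance to an empty \<open>X\<close>, where
    \<open>infdist\<close> is \<open>0\<close> by convention; the zero form meets all
    requirements.\<close>
  case True
  have n0: "0 \<le> n" by (simp add: n_def)
  show thesis
  proof (rule that[of "\<lambda>x K. 0"])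
    show "\<bar>0::real\<bar> \<le> (1 + n * n) * (T * (64 * (n + 1)) ^ CARD('n))"
      using T n0 by (intro order_trans[OF eq_refl[OF abs_zero]] mult_nonneg_nonneg) auto
  qed (use True in \<open>auto simp: torus_closed_def\<close>)
next
  case False
  have n: "1 \<le> n" by (simp add: n_def Suc_leI)
  \<comment> \<open>Every point is within \<open>n\<close> of a lattice translate of a given point
    of \<open>X\<close>, so dividing by \<open>n\<close> yields
    \<open>\<delta> x \<le> 1\<close>.\<close>
  define \<delta> where "\<delta> x = infdist x X / n" for x
  have nX: "infdist x X = n * \<delta> x" for x using n by (simp add: \<delta>_def)
  have lip: "\<bar>\<delta> x - \<delta> y\<bar> \<le> norm (x - y)" for x y
  proof -
    have "\<bar>infdist x X - infdist y X\<bar> \<le> dist x y" by (rule infdist_triangle_abs)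
    also have "\<dots> \<le> n * norm (x - y)" using n mult_right_mono[of 1 n "norm (x - y)"] by (simp add: dist_norm)
    finally have "\<bar>infdist x X - infdist y X\<bar> / n \<le> norm (x - y)" using n by (simp add: divide_le_eq mult.commute)
    then show ?thesis using n by (simp add: \<delta>_def diff_divide_distrib[symmetric] abs_divide)
  qed
  have per: "lattice_periodic \<delta>"
    using infdist_lattice_invariant[of X, OF Xper] unfolding \<delta>_def lattice_periodic_def by simp
  have b0: "0 \<le> \<delta> x" for x using n by (simp add: \<delta>_def infdist_nonneg)
  have b1: "\<delta> x \<le> 1" for x
  proof -
    obtain p where p: "p \<in> X" using False by blast
    define k where "k = wrap (x - p) - (x - p)"
    have k: "- k \<in> int_lattice" unfolding k_def int_lattice_uminus by (rule wrap_diff_int_lattice)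
    have "infdist x X \<le> dist x (p + - k)" by (rule infdist_le[OF Xper[OF k p]])
    also have "\<dots> = norm (wrap (x - p))" by (simp add: dist_norm k_def)
    also have "\<dots> \<le> n" unfolding n_def by (rule norm_unit_cell_le[OF wrap_in_unit_cell])
    finally show ?thesis using n by (simp add: \<delta>_def)
  qed
  have av: "(\<integral>\<^sup>+y. ennreal (form_l1 r (w (x + s *\<^sub>R y))) \<partial>unit_ball_measure) \<le> ennreal (T * (64 * (n + 1)) ^ CARD('n))"
    if pos: "0 < \<delta> x" and s1: "\<delta> x / 64 \<le> s" and s2: "s \<le> \<delta> x" for x s
  proof -
    obtain p where p: "p \<in> X" "infdist x X = dist x p" using infdist_attains_inf[OF X False] by blast
    show ?thesis
    \<comment> \<open>The nearest point \<open>p\<close> is at distance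
      \<open>n * \<delta> x\<close> and \<open>s \<le> \<delta> x\<close>, which explains the
      radius. It is at most \<open>64 * (n + 1) * s\<close> because
      \<open>\<delta> x / 64 \<le> s\<close>, and at most \<open>n + 1\<close> because
      \<open>\<delta> x \<le> 1\<close>.\<close>
    proof (rule ball_average_le[where p=p and \<rho>="(n + 1) * \<delta> x"])
      show "(\<lambda>x. ennreal (form_l1 r (w x))) \<in> borel_measurable borel"
        using form_l1_measurable(1)[OF w] by measurable
      show "0 < s" using pos s1 by simp
      show r0: "0 < (n + 1) * \<delta> x" using pos n by simp
      have "(n + 1) * \<delta> x \<le> (n + 1) * (64 * s)" using s1 n by (intro mult_left_mono) auto
      then show "(n + 1) * \<delta> x \<le> 64 * (n + 1) * s" by (simp add: mult_ac)
      have "dist p x + s \<le> (n + 1) * \<delta> x" using p(2) s2 nX[of x] by (simp add: dist_commute algebra_simps)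
      then show "cball x s \<subseteq> cball p ((n + 1) * \<delta> x)"
        by (simp add: cball_subset_cball_iff dist_commute)
      have "(n + 1) * \<delta> x \<le> (n + 1) * 1" using b1[of x] n by (intro mult_left_mono) auto
      then show "(\<integral>\<^sup>+z\<in>cball p ((n + 1) * \<delta> x). ennreal (form_l1 r (w z)) \<partial>lborel)
          \<le> ennreal T * emeasure lborel (cball p ((n + 1) * \<delta> x))"
        by (intro avg p r0) simp
    qed (use T in simp_all)
  qed
  have M0: "0 \<le> T * (64 * (n + 1)) ^ CARD('n)" using T n by simp
  have dX: "\<delta> x = 0 \<longleftrightarrow> x \<in> X" for x
    using in_closed_iff_infdist_zero[OF X False, of x] n by (simp add: \<delta>_def)
  obtain v where v: "\<And>K. card K = r \<Longrightarrow> (\<lambda>x. v x K) \<in> borel_measurable borel"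
    "\<And>x K. \<delta> x = 0 \<Longrightarrow> v x K = w x K"
    "\<And>x K. card K = r \<Longrightarrow> 0 < \<delta> x \<Longrightarrow> \<bar>v x K\<bar> \<le> (1 + real CARD('n) * real CARD('n)) * (T * (64 * (n + 1)) ^ CARD('n))"
    "torus_closed r v"
    by (rule truncation_limit[OF w cl lip per b0 b1 M0 av]) (blast intro: that)+
  show thesis
  proof (rule that[of v])
    show "(\<lambda>x. v x K) \<in> borel_measurable borel" if "card K = r" for K by (rule v(1)[OF that])
    show "torus_closed r v" by (rule v(4))
    show "v x K = w x K" if "x \<in> X" for x K by (rule v(2)) (simp add: dX that)
    show "\<bar>v x K\<bar> \<le> (1 + n * n) * (T * (64 * (n + 1)) ^ CARD('n))" if "card K = r" "x \<notin> X" for x K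
    proof -
      have "0 < \<delta> x" using dX[of x] b0[of x] that(2) by linarith
      from v(3)[OF that(1) this] show ?thesis by (simp only: n_def)
    qed
  qed
qed

lemma torus_truncation:
  fixes r :: nat
  shows "\<exists>C1 C2 :: real. C1 > 0 \<and> C2 > 0 \<and>
    (\<forall>(w :: (real, 'n::{finite,linorder}) vec \<Rightarrow> 'n set \<Rightarrow> real) L. periodic_L1_form r w \<and> torus_closed r w \<and> L > 0 \<longrightarrow>
      (\<exists>v. (\<forall>K. card K = r \<longrightarrow> (\<lambda>x. v x K) \<in> borel_measurable borel) \<and> torus_closed r v \<and>
        (AE x in torus. form_norm r (v x) \<le> C1 * L) \<and>
        measure torus {x. form_neq r (v x) (w x)} \<le> C2 / L * (\<integral>x. (if L < form_norm r (w x) then form_norm r (w x) else 0) \<partial>torus) \<and>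
        (\<integral>x. form_norm r (\<lambda>K. v x K - w x K) \<partial>torus) \<le> C2 * (\<integral>x. (if L < form_norm r (w x) then form_norm r (w x) else 0) \<partial>torus)))"
proof -
  define n where "n = real CARD('n)"
  define m where "m = real (card {K :: 'n set. card K = r})"
  have n1: "1 \<le> n" by (simp add: n_def Suc_leI)
  have m0: "0 \<le> m" by (simp add: m_def)
  have "n + 1 > 0" using n1 by simp
  have "\<exists>A\<ge>0. \<forall>(f :: (real,'n) vec \<Rightarrow> ennreal) L. f \<in> borel_measurable borel \<longrightarrow> lattice_periodic f \<longrightarrow> L > 0 \<longrightarrow>
    (\<exists>G. open G \<and> (\<forall>x k. k \<in> int_lattice \<longrightarrow> x \<in> G \<longrightarrow> x + k \<in> G) \<and>
      emeasure torus G \<le> ennreal (A / L) * (\<integral>\<^sup>+x. f x \<partial>torus) \<and>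
      (\<forall>p \<rho>. p \<notin> G \<longrightarrow> 0 < \<rho> \<longrightarrow> \<rho> \<le> n + 1 \<longrightarrow> (\<integral>\<^sup>+z\<in>cball p \<rho>. f z \<partial>lborel) \<le> ennreal L * emeasure lborel (cball p \<rho>)))"
    by (rule maximal_function_bad_set[OF \<open>n + 1 > 0\<close>, where 'n='n]) blast
  then obtain A where A0: "A \<ge> 0" and A: "\<And>(f :: (real,'n) vec \<Rightarrow> ennreal) L. f \<in> borel_measurable borel \<Longrightarrow> lattice_periodic f \<Longrightarrow> L > 0 \<Longrightarrow>
    (\<exists>G. open G \<and> (\<forall>x k. k \<in> int_lattice \<longrightarrow> x \<in> G \<longrightarrow> x + k \<in> G) \<and>
      emeasure torus G \<le> ennreal (A / L) * (\<integral>\<^sup>+x. f x \<partial>torus) \<and>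
      (\<forall>p \<rho>. p \<notin> G \<longrightarrow> 0 < \<rho> \<longrightarrow> \<rho> \<le> n + 1 \<longrightarrow> (\<integral>\<^sup>+z\<in>cball p \<rho>. f z \<partial>lborel) \<le> ennreal L * emeasure lborel (cball p \<rho>)))"
    by blast
  \<comment> \<open>The factor \<open>2 * m\<close> comes from the bound \<open>2 * m * L\<close>
    for means of \<open>form_l1\<close> about good points: the norm is at most \<open>L\<close> plus
    its excess, the excess has means at most \<open>L\<close> there, and \<open>m\<close> converts
    to \<open>form_l1\<close>.\<close>
  define D where "D = (1 + n * n) * (2 * m * (64 * (n + 1)) ^ CARD('n))"
  have D0: "0 \<le> D" using n1 m0 by (simp add: D_def)
  \<comment> \<open>\<open>m * D\<close> sums the coefficient bounds on the bad set; the
    \<open>1\<close> covers the good set, where \<open>v\<close> agrees with \<open>w\<close> and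
    has norm at most \<open>L\<close>.\<close>
  define C1 where "C1 = 1 + m * D"
  \<comment> \<open>\<open>A + 2\<close> bounds the measure of the bad set in units of
    \<open>I / L\<close>: \<open>A\<close> from the maximal function, \<open>2\<close> from the
    neighbourhood of the large values. On that set \<open>v - w\<close> has norm at most
    \<open>(C1 + m) * L\<close> plus \<open>m\<close> times the excess.\<close>
  define C2 where "C2 = (C1 + m) * (A + 2) + m + 1"
  have C1: "C1 \<ge> 1" using m0 D0 by (simp add: C1_def)
  have C2: "A + 2 \<le> C2" "C2 > 0" "(C1 + m) * (A + 2) + m \<le> C2"
  proof -
    define P where "P = (C1 + m) * (A + 2)"
    have "1 * (A + 2) \<le> P" unfolding P_def using C1 m0 A0 by (intro mult_right_mono) auto
    moreover have "P \<le> P + (m + 1)" using m0 by simp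
    ultimately show "A + 2 \<le> C2" unfolding C2_def P_def[symmetric] by (simp add: add.assoc)
    then show "C2 > 0" using A0 by linarith
    show "(C1 + m) * (A + 2) + m \<le> C2" by (simp add: C2_def)
  qed
  have main: "\<exists>v. (\<forall>K. card K = r \<longrightarrow> (\<lambda>x. v x K) \<in> borel_measurable borel) \<and> torus_closed r v \<and>
        (AE x in torus. form_norm r (v x) \<le> C1 * L) \<and>
        measure torus {x. form_neq r (v x) (w x)} \<le> C2 / L * (\<integral>x. (if L < form_norm r (w x) then form_norm r (w x) else 0) \<partial>torus) \<and>
        (\<integral>x. form_norm r (\<lambda>K. v x K - w x K) \<partial>torus) \<le> C2 * (\<integral>x. (if L < form_norm r (w x) then form_norm r (w x) else 0) \<partial>torus)"
    if w: "periodic_L1_form r w" and cl: "torus_closed r w" and L: "L > 0"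
    for w :: "(real, 'n) vec \<Rightarrow> 'n set \<Rightarrow> real" and L
  proof -
    define g where "g x = form_norm r (w x)" for x
    define f where "f x = (if L < g x then g x else 0)" for x
    define I where "I = (\<integral>x. f x \<partial>torus)"
    have g [measurable]: "g \<in> borel_measurable borel" "lattice_periodic g" "integrable torus g"
      unfolding g_def by (rule torus_form_norm[OF w])+
    have g0: "0 \<le> g x" for x by (simp add: g_def form_norm_nonneg)
    have fm [measurable]: "f \<in> borel_measurable borel" unfolding f_def by measurable
    have f0: "0 \<le> f x" for x using g0 by (simp add: f_def)
    have fper: "lattice_periodic (\<lambda>x. ennreal (f x))"
      by (intro lattice_periodicI) (simp add: f_def lattice_periodicD[OF g(2)])
    have fi: "integrable torus f"
      by (rule Bochner_Integration.integrable_bound[OF g(3)]) (use g0 in \<open>auto simp: f_def\<close>)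
    have I0: "0 \<le> I" unfolding I_def using f0 by simp
    have fI: "(\<integral>\<^sup>+x. ennreal (f x) \<partial>torus) = ennreal I"
      unfolding I_def by (rule nn_integral_eq_integral[OF fi]) (simp add: f0)
    have gf: "g x \<le> L + f x" for x using L by (simp add: f_def)
    have form0: "form_norm r (\<lambda>K :: 'n set. 0) = 0" by (simp add: form_norm_def)
    show ?thesis
      unfolding g_def[symmetric] f_def[symmetric] I_def[symmetric]
    \<comment> \<open>Without excess \<open>w\<close> is itself bounded by \<open>L\<close> almost
      everywhere and serves as \<open>v\<close>; the open neighbourhood used otherwise needs
      \<open>I > 0\<close>.\<close>
    proof (cases "I = 0")
      case True
      have "AE x in torus. f x = 0"
        using integral_nonneg_eq_0_iff_AE[OF fi] f0 True by (simp add: I_def)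
      then have "AE x in torus. form_norm r (w x) \<le> C1 * L"
      proof eventually_elim
        case (elim x)
        have "g x \<le> 1 * L" using elim gf[of x] by simp
        also have "\<dots> \<le> C1 * L" using C1 L by (intro mult_right_mono) auto
        finally show ?case by (simp add: g_def)
      qed
      then show "\<exists>v. (\<forall>K. card K = r \<longrightarrow> (\<lambda>x. v x K) \<in> borel_measurable borel) \<and> torus_closed r v \<and>
        (AE x in torus. form_norm r (v x) \<le> C1 * L) \<and>
        measure torus {x. form_neq r (v x) (w x)} \<le> C2 / L * I \<and>
        (\<integral>x. form_norm r (\<lambda>K. v x K - w x K) \<partial>torus) \<le> C2 * I"
        using w cl True by (intro exI[of _ w]) (auto simp: periodic_L1_form_def form_neq_def form0)
    next
      case False
      then have I: "I > 0" using I0 by simp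
      obtain G where G: "open G" "\<And>x k. k \<in> int_lattice \<Longrightarrow> x \<in> G \<Longrightarrow> x + k \<in> G"
        "emeasure torus G \<le> ennreal (A / L) * ennreal I"
        "\<And>p \<rho>. p \<notin> G \<Longrightarrow> 0 < \<rho> \<Longrightarrow> \<rho> \<le> n + 1 \<Longrightarrow> (\<integral>\<^sup>+z\<in>cball p \<rho>. ennreal (f z) \<partial>lborel) \<le> ennreal L * emeasure lborel (cball p \<rho>)"
        using A[of "\<lambda>x. ennreal (f x)" L, OF _ fper L] unfolding fI by auto
      obtain H where H: "open H" "\<And>x k. k \<in> int_lattice \<Longrightarrow> x \<in> H \<Longrightarrow> x + k \<in> H" "\<And>x. x \<notin> H \<Longrightarrow> g x \<le> L"
        "emeasure torus H \<le> ennreal (2 * I / L)"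
        by (rule torus_excess_open_superset[OF g(1,2) L I]) (use fI in \<open>auto simp: f_def\<close>)
      define B where "B = G \<union> H"
      have B [measurable]: "B \<in> sets borel" using G(1) H(1) by (simp add: B_def)
      have mB: "measure torus B \<le> (A + 2) / L * I"
      proof -
        have "emeasure torus B \<le> emeasure torus G + emeasure torus H"
          unfolding B_def using G(1) H(1) by (intro emeasure_subadditive) auto
        also have "\<dots> \<le> ennreal (A / L * I) + ennreal (2 * I / L)"
          using G(3) H(4) A0 I L by (intro add_mono) (simp_all add: ennreal_mult[symmetric])
        also have "\<dots> = ennreal ((A + 2) / L * I)"
          using A0 I L by (simp add: add_divide_distrib distrib_right flip: ennreal_plus)
        finally show ?thesis using A0 I L by (simp add: torus.emeasure_eq_measure)
      qed
      define X where "X = - B"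
      have Xc: "closed X" unfolding X_def B_def by (intro closed_Compl open_Un G(1) H(1))
      have Xp: "x + k \<in> X" if k: "k \<in> int_lattice" and x: "x \<in> X" for x k
      proof (rule ccontr)
        assume "x + k \<notin> X"
        then have "(x + k) + - k \<in> B" using G(2)[of "- k" "x + k"] H(2)[of "- k" "x + k"] k unfolding X_def B_def by auto
        then show False using x by (simp add: X_def)
      qed
      have T0: "0 \<le> m * (2 * L)" using m0 L by simp
      have avg: "(\<integral>\<^sup>+z\<in>cball p \<rho>. ennreal (form_l1 r (w z)) \<partial>lborel) \<le> ennreal (m * (2 * L)) * emeasure lborel (cball p \<rho>)"
        if "p \<in> X" "0 < \<rho>" "\<rho> \<le> real CARD('n) + 1" for p \<rho>
      proof -
        have [measurable]: "cball p \<rho> \<in> sets borel" by (simp add: borel_closed)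
        have "(\<integral>\<^sup>+z\<in>cball p \<rho>. ennreal (form_l1 r (w z)) \<partial>lborel)
          \<le> (\<integral>\<^sup>+z. ennreal m * (ennreal L * indicator (cball p \<rho>) z + ennreal (f z) * indicator (cball p \<rho>) z) \<partial>lborel)"
        proof (intro nn_integral_mono)
          fix z
          have "form_l1 r (w z) \<le> m * (L + f z)"
            using form_l1_le_norm[of r "w z"] mult_left_mono[OF gf[of z] m0] by (simp add: m_def g_def)
          then have "ennreal (form_l1 r (w z)) \<le> ennreal m * (ennreal L + ennreal (f z))"
            using m0 L f0[of z] by (simp add: ennreal_leI flip: ennreal_plus ennreal_mult)
          then show "ennreal (form_l1 r (w z)) * indicator (cball p \<rho>) z
             \<le> ennreal m * (ennreal L * indicator (cball p \<rho>) z + ennreal (f z) * indicator (cball p \<rho>) z)"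
            by (auto split: split_indicator)
        qed
        also have "\<dots> = ennreal m * (\<integral>\<^sup>+z. (ennreal L * indicator (cball p \<rho>) z + ennreal (f z) * indicator (cball p \<rho>) z) \<partial>lborel)"
          by (rule nn_integral_cmult) measurable
        also have "\<dots> = ennreal m * ((\<integral>\<^sup>+z. ennreal L * indicator (cball p \<rho>) z \<partial>lborel) + (\<integral>\<^sup>+z\<in>cball p \<rho>. ennreal (f z) \<partial>lborel))"
          by (subst nn_integral_add) measurable
        also have "(\<integral>\<^sup>+z. ennreal L * indicator (cball p \<rho>) z \<partial>lborel) = ennreal L * emeasure lborel (cball p \<rho>)"
          by (simp add: nn_integral_cmult_indicator)
        also have "(\<integral>\<^sup>+z\<in>cball p \<rho>. ennreal (f z) \<partial>lborel) \<le> ennreal L * emeasure lborel (cball p \<rho>)"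
          using that by (intro G(4)) (auto simp: X_def B_def n_def)
        finally have "(\<integral>\<^sup>+z\<in>cball p \<rho>. ennreal (form_l1 r (w z)) \<partial>lborel)
            \<le> ennreal m * (ennreal L * emeasure lborel (cball p \<rho>) + ennreal L * emeasure lborel (cball p \<rho>))"
          by (simp add: mult_left_mono add_left_mono)
        also have "\<dots> = ennreal (m * (2 * L)) * emeasure lborel (cball p \<rho>)"
          using m0 L by (simp add: ennreal_mult distrib_right[symmetric] mult.assoc[symmetric] mult_2[symmetric] flip: ennreal_plus)
        finally show ?thesis .
      qed
      obtain v where v: "\<And>K. card K = r \<Longrightarrow> (\<lambda>x. v x K) \<in> borel_measurable borel" "torus_closed r v"
        "\<And>x K. x \<in> X \<Longrightarrow> v x K = w x K"
        "\<And>x K. card K = r \<Longrightarrow> x \<notin> X \<Longrightarrow> \<bar>v x K\<bar> \<le> (1 + real CARD('n) * real CARD('n)) * (m * (2 * L) * (64 * (real CARD('n) + 1)) ^ CARD('n))"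
        by (rule truncate_off_closed_set[OF w cl T0 Xc Xp avg]) (blast intro: that)+
      have vD: "\<bar>v x K\<bar> \<le> D * L" if "card K = r" "x \<in> B" for x K
        using v(4)[OF that(1), of x] that(2) by (simp add: X_def D_def n_def mult_ac)
      have l1v: "form_l1 r (v x) \<le> C1 * L" if "x \<in> B" for x
      proof -
        have "form_l1 r (v x) \<le> m * (D * L)"
          unfolding form_l1_def m_def using vD[OF _ that] by (intro sum_bounded_above) auto
        then show ?thesis using L by (simp add: C1_def algebra_simps)
      qed
      show "\<exists>v. (\<forall>K. card K = r \<longrightarrow> (\<lambda>x. v x K) \<in> borel_measurable borel) \<and> torus_closed r v \<and>
        (AE x in torus. form_norm r (v x) \<le> C1 * L) \<and>
        measure torus {x. form_neq r (v x) (w x)} \<le> C2 / L * I \<and>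
        (\<integral>x. form_norm r (\<lambda>K. v x K - w x K) \<partial>torus) \<le> C2 * I"
      proof (intro exI[of _ v] conjI allI impI AE_I2)
        fix x
        show "form_norm r (v x) \<le> C1 * L"
        proof (cases "x \<in> B")
          case True
          then show ?thesis using form_norm_le_l1[of r "v x"] l1v[OF True] by simp
        next
          case False
          then have "form_norm r (v x) = g x" unfolding g_def using v(3) by (intro form_norm_cong) (auto simp: X_def)
          also have "\<dots> \<le> 1 * L" using H(3)[of x] False by (simp add: B_def)
          also have "\<dots> \<le> C1 * L" using C1 L by (intro mult_right_mono) auto
          finally show ?thesis .
        qed
      next
        have "measure torus {x. form_neq r (v x) (w x)} \<le> measure torus B"
          using v(3) by (intro torus.finite_measure_mono) (auto simp: form_neq_def X_def)
        also have "\<dots> \<le> (A + 2) / L * I" by (rule mB)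
        also have "\<dots> \<le> C2 / L * I" using C2(1) L I by (intro mult_right_mono divide_right_mono) auto
        finally show "measure torus {x. form_neq r (v x) (w x)} \<le> C2 / L * I" .
      next
        have "(\<integral>x. form_norm r (\<lambda>K. v x K - w x K) \<partial>torus) \<le> (\<integral>x. ((C1 + m) * L) * indicator B x + m * f x \<partial>torus)"
        proof (rule integral_mono')
          show "integrable torus (\<lambda>x. ((C1 + m) * L) * indicator B x + m * f x)"
            using fi by (intro Bochner_Integration.integrable_add integrable_mult_right) (auto simp: torus.emeasure_finite less_top[symmetric])
          fix x
          show "0 \<le> ((C1 + m) * L) * indicator B x + m * f x"
            using C1 m0 L f0[of x] by (intro add_nonneg_nonneg mult_nonneg_nonneg) auto
          show "form_norm r (\<lambda>K. v x K - w x K) \<le> ((C1 + m) * L) * indicator B x + m * f x"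
          proof (cases "x \<in> B")
            case True
            have "form_norm r (\<lambda>K. v x K - w x K) \<le> form_l1 r (\<lambda>K. v x K - w x K)" by (rule form_norm_le_l1)
            also have "\<dots> \<le> form_l1 r (v x) + form_l1 r (w x)"
              unfolding form_l1_def sum.distrib[symmetric] by (intro sum_mono abs_triangle_ineq4)
            also have "\<dots> \<le> C1 * L + m * (L + f x)"
              using l1v[OF True] form_l1_le_norm[of r "w x"] mult_left_mono[OF gf[of x] m0]
              by (intro add_mono) (auto simp: m_def g_def)
            finally show ?thesis using True by (simp add: algebra_simps)
          next
            case False
            then have "form_norm r (\<lambda>K. v x K - w x K) = form_norm r (\<lambda>K :: 'n set. 0)"
              using v(3) by (intro form_norm_cong) (auto simp: X_def)
            then show ?thesis using False m0 f0[of x] by (simp add: form0)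
          qed
        qed
        also have "\<dots> = ((C1 + m) * L) * measure torus B + m * I"
          using fi by (subst Bochner_Integration.integral_add) (auto simp: I_def torus.emeasure_finite less_top[symmetric])
        also have "\<dots> \<le> ((C1 + m) * L) * ((A + 2) / L * I) + m * I"
          using mB C1 m0 L by (intro add_mono mult_left_mono) auto
        also have "\<dots> = ((C1 + m) * (A + 2) + m) * I" using L by (simp add: field_simps)
        also have "\<dots> \<le> C2 * I" using C2(3) I by (intro mult_right_mono) auto
        finally show "(\<integral>x. form_norm r (\<lambda>K. v x K - w x K) \<partial>torus) \<le> C2 * I" .
      next
        show "(\<lambda>x. v x K) \<in> borel_measurable borel" if "card K = r" for K by (rule v(1)[OF that])
      qed (rule v(2))
    qed
  qed
  show ?thesis
  proof (rule exI[of _ C1], rule exI[of _ C2], intro conjI allI impI)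
    show "C1 > 0" "C2 > 0" using C1 C2(2) by auto
  qed (elim conjE, rule main)
qed

section \<open>Transfer to Lebesgue measure on the cube\<close>

lemma AE_torus_cube_iff_unit_cell: "AE x in lborel. (x :: (real,'n::finite) vec) \<in> torus_cube \<longleftrightarrow> x \<in> unit_cell"
proof -
  have "AE x in lebesgue. (x :: (real,'n) vec) \<notin> cbox 0 1 - box 0 1"
    using negligible_frontier_interval[of "0 :: (real,'n) vec" 1] unfolding negligible_iff_null_sets by (rule AE_not_in)
  then have "AE x in lborel. (x :: (real,'n) vec) \<notin> cbox 0 1 - box 0 1"
    by (simp only: AE_completion_iff)
  then show ?thesis
  proof eventually_elim
    case (elim x)
    then show ?case using unit_cell_bounds[where 'n='n] unfolding torus_cube_def by blast
  qed
qed

text \<open>\<open>F\<close> need only agree almost everywhere with a Borel function supported on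
  the cell; completeness of Lebesgue measure then supplies its measurability.\<close>

lemma
  fixes F G :: "(real,'n::finite) vec \<Rightarrow> real"
  assumes [measurable]: "G \<in> borel_measurable borel" and eq: "AE x in lborel. F x = indicator unit_cell x * G x"
  shows lebesgue_integral_eq_torus: "(\<integral>x. F x \<partial>lebesgue) = (\<integral>x. G x \<partial>torus)"
    and lebesgue_integrable_iff_torus: "integrable lebesgue F \<longleftrightarrow> integrable torus G"
proof -
  let ?H = "\<lambda>x. indicator unit_cell x * G x"
  have t: "torus = density lborel (\<lambda>x. ennreal (indicator unit_cell x))"
    by (simp add: torus_def ennreal_indicator)
  have H [measurable]: "?H \<in> borel_measurable lborel" by measurable
  have HL: "?H \<in> borel_measurable lebesgue" by (rule measurable_completion[OF H])
  have aeL: "AE x in lebesgue. F x = ?H x" by (rule AE_completion[OF eq])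
  have FL: "F \<in> borel_measurable lebesgue"
    by (rule borel_measurable_AE[OF HL]) (use aeL in \<open>auto simp: eq_commute\<close>)
  show "(\<integral>x. F x \<partial>lebesgue) = (\<integral>x. G x \<partial>torus)"
    unfolding integral_cong_AE[OF FL HL aeL] integral_completion[OF H] t
    by (rule integral_real_density[symmetric]) auto
  have "integrable lebesgue F \<longleftrightarrow> integrable lborel ?H"
    unfolding integrable_cong_AE[OF FL HL aeL] by (rule integrable_completion[OF H])
  then show "integrable lebesgue F \<longleftrightarrow> integrable torus G"
    unfolding t by (subst integrable_real_density) auto
qed

lemma set_integral_torus_cube:
  fixes F G :: "(real,'n::finite) vec \<Rightarrow> real"
  assumes G: "G \<in> borel_measurable borel" and eq: "AE x in lborel. x \<in> unit_cell \<longrightarrow> F x = G x"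
  shows "(LINT x:torus_cube|lebesgue. F x) = (\<integral>x. G x \<partial>torus)"
  unfolding set_lebesgue_integral_def
proof (rule lebesgue_integral_eq_torus[OF G])
  show "AE x in lborel. indicator torus_cube x *\<^sub>R F x = indicator unit_cell x * G x"
    using eq AE_torus_cube_iff_unit_cell by eventually_elim (simp add: indicator_def)
qed

lemma smooth_fun_pderiv_measurable:
  "smooth_fun \<phi> \<Longrightarrow> pderiv j \<phi> \<in> borel_measurable borel"
proof -
  assume "smooth_fun \<phi>"
  then have "Ck (Suc 0) \<phi>" unfolding smooth_fun_def by blast
  then show ?thesis by (intro borel_measurable_continuous_onI) simp
qed

text \<open>The two conditions differ in the representative of the form, in Lebesgue versus Borel
  measure and in the boundary of the cube. None of these changes an integral, since all exceptional
  sets are null.\<close>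

lemma closed_form_iff_torus_closed:
  fixes u w :: "(real, 'n::{finite,linorder}) vec \<Rightarrow> 'n set \<Rightarrow> real"
  assumes m: "\<And>K. card K = r \<Longrightarrow> (\<lambda>x. w x K) \<in> borel_measurable borel"
    and eq: "AE x in lborel. x \<in> unit_cell \<longrightarrow> (\<forall>K. card K = r \<longrightarrow> w x K = u x K)"
  shows "closed_form r u \<longleftrightarrow> torus_closed r w"
proof -
  have "(LINT x:torus_cube|lebesgue. u x (J - {j}) * pderiv j \<phi> x) = (\<integral>x. w x (J - {j}) * pderiv j \<phi> x \<partial>torus)"
    if "card J = Suc r" "smooth_fun \<phi>" "j \<in> J" for J j \<phi>
  proof (rule set_integral_torus_cube)
    have c: "card (J - {j}) = r" using that by simp
    show "(\<lambda>x. w x (J - {j}) * pderiv j \<phi> x) \<in> borel_measurable borel"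
      by (intro borel_measurable_times m c smooth_fun_pderiv_measurable that)
    show "AE x in lborel. x \<in> unit_cell \<longrightarrow> u x (J - {j}) * pderiv j \<phi> x = w x (J - {j}) * pderiv j \<phi> x"
      using eq by eventually_elim (simp add: c)
  qed
  then have "(\<Sum>j\<in>J. (-1::real) ^ card {k\<in>J. k < j} * (LINT x:torus_cube|lebesgue. u x (J - {j}) * pderiv j \<phi> x))
     = (\<Sum>j\<in>J. fsign j J * (\<integral>x. w x (J - {j}) * pderiv j \<phi> x \<partial>torus))" if "card J = Suc r" "smooth_fun \<phi>" for J \<phi>
    unfolding fsign_def using that by (intro sum.cong) auto
  then show ?thesis unfolding closed_form_def torus_closed_def by (metis (no_types, lifting))
qed

text \<open>Each coefficient is replaced by a Borel version and extended from the cell by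
  \<open>wrap\<close>; values of \<open>u\<close> outside the cube and possibly nonperiodic values
  on its boundary are thereby discarded. There are finitely many index sets, so one null set serves
  for all of them.\<close>

lemma periodic_borel_representative:
  fixes u :: "(real, 'n::{finite,linorder}) vec \<Rightarrow> 'n set \<Rightarrow> real"
  assumes "\<forall>K. card K = r \<longrightarrow> set_integrable lebesgue torus_cube (\<lambda>y. u y K)"
  obtains w where "periodic_L1_form r w"
    "AE x in lborel. x \<in> unit_cell \<longrightarrow> (\<forall>K. card K = r \<longrightarrow> w x K = u x K)"
proof -
  have "\<exists>g. g \<in> borel_measurable lborel \<and> (AE x in lborel. indicator torus_cube x *\<^sub>R u x K = g x)" if "card K = r" for K
  proof -
    have "(\<lambda>x. indicator torus_cube x *\<^sub>R u x K) \<in> borel_measurable lebesgue"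
      using assms that unfolding set_integrable_def by (intro borel_measurable_integrable) blast
    from completion_ex_borel_measurable_real[OF this] show ?thesis by blast
  qed
  then obtain g where g: "\<And>K. card K = r \<Longrightarrow> g K \<in> borel_measurable lborel"
    "\<And>K. card K = r \<Longrightarrow> AE x in lborel. indicator torus_cube x *\<^sub>R u x K = g K x"
    by metis
  define w where "w x K = g K (wrap x)" for x K
  have wm: "(\<lambda>x. w x K) \<in> borel_measurable borel" if "card K = r" for K
    unfolding w_def using g(1)[OF that] by measurable
  have "AE x in lborel. \<forall>K\<in>{K. card K = r}. indicator torus_cube x *\<^sub>R u x K = g K x"
    using g(2) by (subst AE_finite_all) auto
  then have eq: "AE x in lborel. x \<in> unit_cell \<longrightarrow> (\<forall>K. card K = r \<longrightarrow> w x K = u x K)"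
    using AE_torus_cube_iff_unit_cell
  proof eventually_elim
    case (elim x)
    show ?case
    proof (intro impI allI)
      fix K :: "'n set" assume x: "x \<in> unit_cell" and K: "card K = r"
      have "indicator torus_cube x *\<^sub>R u x K = g K x" using elim(1) K by blast
      then show "w x K = u x K" using elim(2) x by (simp add: w_def wrap_id)
    qed
  qed
  have "integrable torus (\<lambda>x. w x K)" if K: "card K = r" for K
  proof -
    have "AE x in lborel. indicator torus_cube x *\<^sub>R u x K = indicator unit_cell x * w x K"
      using eq AE_torus_cube_iff_unit_cell by eventually_elim (simp add: indicator_def K)
    from lebesgue_integrable_iff_torus[OF wm[OF K] this] show ?thesis
      using assms K unfolding set_integrable_def by blast
  qed
  then have "periodic_L1_form r w"
    unfolding periodic_L1_form_def using wm by (auto simp: w_def intro: lattice_periodic_comp_wrap)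
  then show thesis using eq by (rule that)
qed

theorem theorem4p1:
  fixes r :: nat
  assumes "r \<le> CARD('n::{finite,linorder})"
  shows "\<exists>C1 C2 :: real. C1 > 0 \<and> C2 > 0 \<and>
    (\<forall>(u :: (real,'n) vec \<Rightarrow> ('n set \<Rightarrow> real)) (L :: real).
       (\<forall>K. card K = r \<longrightarrow> set_integrable lebesgue torus_cube (\<lambda>y. u y K)) \<and>
       closed_form r u \<and> L > 0 \<longrightarrow>
       (\<exists>v :: (real,'n) vec \<Rightarrow> ('n set \<Rightarrow> real).
          (\<forall>K. card K = r \<longrightarrow> set_borel_measurable lebesgue torus_cube (\<lambda>y. v y K)) \<and>
          closed_form r v \<and>
          (AE y in lebesgue. y \<in> torus_cube \<longrightarrow> form_norm r (v y) \<le> C1 * L) \<and>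
          measure lebesgue {y \<in> torus_cube. form_neq r (v y) (u y)}
            \<le> C2 / L * (LINT y:{y \<in> torus_cube. form_norm r (u y) > L}|lebesgue. form_norm r (u y)) \<and>
          (LINT y:torus_cube|lebesgue. form_norm r (\<lambda>K. v y K - u y K))
            \<le> C2 * (LINT y:{y \<in> torus_cube. form_norm r (u y) > L}|lebesgue. form_norm r (u y))))"
proof -
  obtain C1 C2 :: real where C: "C1 > 0" "C2 > 0" and main:
    "\<And>(w :: (real,'n) vec \<Rightarrow> 'n set \<Rightarrow> real) L. periodic_L1_form r w \<and> torus_closed r w \<and> L > 0 \<Longrightarrow>
      \<exists>v. (\<forall>K. card K = r \<longrightarrow> (\<lambda>x. v x K) \<in> borel_measurable borel) \<and> torus_closed r v \<and>
        (AE x in torus. form_norm r (v x) \<le> C1 * L) \<and>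
        measure torus {x. form_neq r (v x) (w x)} \<le> C2 / L * (\<integral>x. (if L < form_norm r (w x) then form_norm r (w x) else 0) \<partial>torus) \<and>
        (\<integral>x. form_norm r (\<lambda>K. v x K - w x K) \<partial>torus) \<le> C2 * (\<integral>x. (if L < form_norm r (w x) then form_norm r (w x) else 0) \<partial>torus)"
    using torus_truncation[of r, where 'n='n] by blast
  show ?thesis
  proof (rule exI[of _ C1], rule exI[of _ C2], intro conjI allI impI C)
    fix u :: "(real,'n) vec \<Rightarrow> 'n set \<Rightarrow> real" and L :: real
    assume "(\<forall>K. card K = r \<longrightarrow> set_integrable lebesgue torus_cube (\<lambda>y. u y K)) \<and> closed_form r u \<and> L > 0"
    then have u: "\<forall>K. card K = r \<longrightarrow> set_integrable lebesgue torus_cube (\<lambda>y. u y K)" "closed_form r u" and L: "L > 0" by auto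
    obtain w where w: "periodic_L1_form r w" and eq: "AE x in lborel. x \<in> unit_cell \<longrightarrow> (\<forall>K. card K = r \<longrightarrow> w x K = u x K)"
      by (rule periodic_borel_representative[OF u(1)])
    have wm: "(\<lambda>x. w x K) \<in> borel_measurable borel" if "card K = r" for K
      using w that by (simp add: periodic_L1_form_def)
    have wcl: "torus_closed r w" using closed_form_iff_torus_closed[OF wm eq] u(2) by simp
    obtain v where vm: "\<And>K. card K = r \<Longrightarrow> (\<lambda>x. v x K) \<in> borel_measurable borel" and vcl: "torus_closed r v"
      and vn: "AE x in torus. form_norm r (v x) \<le> C1 * L"
      and v1: "measure torus {x. form_neq r (v x) (w x)} \<le> C2 / L * (\<integral>x. (if L < form_norm r (w x) then form_norm r (w x) else 0) \<partial>torus)"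
      and v2: "(\<integral>x. form_norm r (\<lambda>K. v x K - w x K) \<partial>torus) \<le> C2 * (\<integral>x. (if L < form_norm r (w x) then form_norm r (w x) else 0) \<partial>torus)"
      using main[of w L] w wcl L by blast
    have nm [measurable]: "(\<lambda>x. form_norm r (w x)) \<in> borel_measurable borel" by (rule torus_form_norm(1)[OF w])
    \<comment> \<open>All three quantities read only the coefficients with
      \<open>card K = r\<close>, and these agree for \<open>w\<close> and \<open>u\<close> at almost
      every point of the cell.\<close>
    have neq_same: "form_norm r (u x) = form_norm r (w x)" "form_neq r (v x) (u x) \<longleftrightarrow> form_neq r (v x) (w x)"
      "form_norm r (\<lambda>K. v x K - u x K) = form_norm r (\<lambda>K. v x K - w x K)"
      if "\<forall>K. card K = r \<longrightarrow> w x K = u x K" for x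
      using that by (auto simp: form_neq_def intro!: form_norm_cong)
    have I: "(LINT y:{y \<in> torus_cube. form_norm r (u y) > L}|lebesgue. form_norm r (u y))
        = (\<integral>x. (if L < form_norm r (w x) then form_norm r (w x) else 0) \<partial>torus)"
      unfolding set_lebesgue_integral_def
    proof (rule lebesgue_integral_eq_torus)
      show "AE x in lborel. indicator {y \<in> torus_cube. form_norm r (u y) > L} x *\<^sub>R form_norm r (u x)
         = indicator unit_cell x * (if L < form_norm r (w x) then form_norm r (w x) else 0)"
        using eq AE_torus_cube_iff_unit_cell
      proof eventually_elim
        case (elim x)
        then show ?case using neq_same(1)[of x] by (auto simp: indicator_def)
      qed
    qed measurable
    have D: "measure lebesgue {y \<in> torus_cube. form_neq r (v y) (u y)} = measure torus {x. form_neq r (v x) (w x)}"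
    proof -
      have "{x. form_neq r (v x) (w x)} = (\<Union>K\<in>{K. card K = r}. {x \<in> space borel. v x K \<noteq> w x K})"
        by (auto simp: form_neq_def)
      also have "\<dots> \<in> sets borel"
        using vm wm by (intro sets.finite_UN) (auto intro!: borel_measurable_neq)
      finally have [measurable]: "{x. form_neq r (v x) (w x)} \<in> sets borel" .
      \<comment> \<open>The measure is written as the integral of an indicator, so that the transfer
        of integrals covers a set that is merely Lebesgue measurable.\<close>
      have "(\<integral>x. indicator {y \<in> torus_cube. form_neq r (v y) (u y)} x \<partial>lebesgue)
          = (\<integral>x. indicat_real {x. form_neq r (v x) (w x)} x \<partial>torus)"
      proof (rule lebesgue_integral_eq_torus)
        show "AE x in lborel. indicator {y \<in> torus_cube. form_neq r (v y) (u y)} x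
            = indicator unit_cell x * indicat_real {x. form_neq r (v x) (w x)} x"
          using eq AE_torus_cube_iff_unit_cell
        proof eventually_elim
          case (elim x)
          then show ?case using neq_same(2)[of x] by (auto simp: indicator_def)
        qed
      qed measurable
      then show ?thesis by simp
    qed
    have E: "(LINT y:torus_cube|lebesgue. form_norm r (\<lambda>K. v y K - u y K)) = (\<integral>x. form_norm r (\<lambda>K. v x K - w x K) \<partial>torus)"
    proof (rule set_integral_torus_cube)
      show "(\<lambda>x. form_norm r (\<lambda>K. v x K - w x K)) \<in> borel_measurable borel"
        unfolding form_norm_def using vm wm
        by (intro borel_measurable_sqrt[THEN measurable_compose[rotated]] borel_measurable_sum borel_measurable_power borel_measurable_diff) auto
      show "AE x in lborel. x \<in> unit_cell \<longrightarrow> form_norm r (\<lambda>K. v x K - u x K) = form_norm r (\<lambda>K. v x K - w x K)"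
        using eq by eventually_elim (simp add: neq_same(3))
    qed
    show "\<exists>v :: (real,'n) vec \<Rightarrow> ('n set \<Rightarrow> real).
          (\<forall>K. card K = r \<longrightarrow> set_borel_measurable lebesgue torus_cube (\<lambda>y. v y K)) \<and>
          closed_form r v \<and>
          (AE y in lebesgue. y \<in> torus_cube \<longrightarrow> form_norm r (v y) \<le> C1 * L) \<and>
          measure lebesgue {y \<in> torus_cube. form_neq r (v y) (u y)}
            \<le> C2 / L * (LINT y:{y \<in> torus_cube. form_norm r (u y) > L}|lebesgue. form_norm r (u y)) \<and>
          (LINT y:torus_cube|lebesgue. form_norm r (\<lambda>K. v y K - u y K))
            \<le> C2 * (LINT y:{y \<in> torus_cube. form_norm r (u y) > L}|lebesgue. form_norm r (u y))"
    proof (intro exI[of _ v] conjI allI impI)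
      show "set_borel_measurable lebesgue torus_cube (\<lambda>y. v y K)" if K: "card K = r" for K
      proof -
        have "(\<lambda>x. indicat_real torus_cube x *\<^sub>R v x K) \<in> borel_measurable lborel"
          unfolding torus_cube_def using vm[OF K] by (intro borel_measurable_scaleR borel_measurable_indicator) auto
        then show ?thesis unfolding set_borel_measurable_def by (rule measurable_completion)
      qed
      show "closed_form r v" using closed_form_iff_torus_closed[where u=v, OF vm] vcl by simp
      have "AE x in lborel. 0 < (indicator unit_cell x :: ennreal) \<longrightarrow> form_norm r (v x) \<le> C1 * L"
        using vn unfolding torus_def by (subst (asm) AE_density) auto
      then have "AE x in lborel. x \<in> torus_cube \<longrightarrow> form_norm r (v x) \<le> C1 * L"
        using AE_torus_cube_iff_unit_cell by eventually_elim (auto simp: indicator_def)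
      then show "AE y in lebesgue. y \<in> torus_cube \<longrightarrow> form_norm r (v y) \<le> C1 * L"
        by (rule AE_completion)
    qed (simp_all only: I D E v1 v2)
  qed
qed

end
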